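(* Let $Q=\mathbb{R}^+\times\mathbb{R}^+$, $g_1,g_2\in\mathcal{S}([0,\infty))$, $h_1\in C^\infty([0,\infty))$, and let $f_1,f_2\in C^\infty(\overline{Q})$ be such that for every $T>0$ and $j=1,2$, $$\sup\Big\{x^E\Big|\frac{\partial^{n+l}f_j(x,t)}{\partial x^n\partial t^l}\Big|:\ x>0,\ 0\le t\le T\Big\}<\infty\quad\text{for all nonnegative integers } n,l,E.$$ Let $\Psi_1(x,t),\Psi_2(x,t)$ be the functions defined in the context for $x>0$, $t>0$, $x\neq t$. Then for every $T>0$, $$\lim_{x\to+\infty}\left[x^E\frac{\partial^{n+l}\Psi_1(x,t)}{\partial x^n\partial t^l}\right]=0\quad\text{and}\quad\lim_{x\to+\infty}\left[x^E\frac{\partial^{n+l}\Psi_2(x,t)}{\partial x^n\partial t^l}\right]=0,$$ for all nonnegative integers $n$, $l$ and $E$, uniformly for $0<t\le T$.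
   Context: Fix a real number $m\ge 0$. $\mathbb{R}^+=(0,\infty)$. $\mathcal{S}([0,\infty))$ is the space of (complex-valued) $C^\infty$ functions $g$ on $[0,\infty)$ with $\sup_{x\ge0}x^a|g^{(b)}(x)|<\infty$ for all nonnegative integers $a,b$. For $\lambda\in\mathbb{R}$: $\rho(\lambda)=\sqrt{\lambda^2+m^2}$ (nonnegative root), $\omega_1(\lambda)=i\rho(\lambda)$, $\omega_2(\lambda)=-i\rho(\lambda)$, $\hat g_j(\lambda)=\int_0^\infty e^{-i\lambda y}g_j(y)\,dy$ ($j=1,2$). For $x>0$, $t>0$, $x\ne t$ set $$\mathcal{G}_{1,1}=\int_{-\infty}^{\infty}e^{i\lambda x-\omega_1(\lambda)t}\{\lambda\hat g_2(\lambda)+[i\omega_2(\lambda)+m]\hat g_1(\lambda)\}\tfrac{d\lambda}{2\rho(\lambda)},\quad \mathcal{G}_{1,2}=\int_{-\infty}^{\infty}e^{i\lambda x-\omega_1(\lambda)t}\{\lambda\hat g_2(-\lambda)-[i\omega_2(\lambda)+m]\hat g_1(-\lambda)\}\tfrac{d\lambda}{2\rho(\lambda)},$$ $$\mathcal{G}_{1,3}=\int_{-\infty}^{\infty}e^{i\lambda x-\omega_2(\lambda)t}\{\lambda\hat g_2(\lambda)+[i\omega_1(\lambda)+m]\hat g_1(\lambda)\}\tfrac{d\lambda}{2\rho(\lambda)},\quad \mathcal{G}_{1,4}=\int_{-\infty}^{\infty}e^{i\lambda x-\omega_2(\lambda)t}\{\lambda\hat g_2(-\lambda)-[i\omega_1(\lambda)+m]\hat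 g_1(-\lambda)\}\tfrac{d\lambda}{2\rho(\lambda)},$$ $$\mathcal{G}_{2,1}=\int_{-\infty}^{\infty}e^{i\lambda x-\omega_1(\lambda)t}\{\lambda\hat g_1(\lambda)-[i\omega_1(\lambda)+m]\hat g_2(\lambda)\}\tfrac{d\lambda}{2\rho(\lambda)},\quad \mathcal{G}_{2,2}=\int_{-\infty}^{\infty}e^{i\lambda x-\omega_1(\lambda)t}\{\lambda\hat g_1(-\lambda)+[i\omega_1(\lambda)+m]\hat g_2(-\lambda)\}\tfrac{d\lambda}{2\rho(\lambda)},$$ $$\mathcal{G}_{2,3}=\int_{-\infty}^{\infty}e^{i\lambda x-\omega_2(\lambda)t}\{\lambda\hat g_1(\lambda)-[i\omega_2(\lambda)+m]\hat g_2(\lambda)\}\tfrac{d\lambda}{2\rho(\lambda)},\quad \mathcal{G}_{2,4}=\int_{-\infty}^{\infty}e^{i\lambda x-\omega_2(\lambda)t}\{\lambda\hat g_1(-\lambda)+[i\omega_2(\lambda)+m]\hat g_2(-\lambda)\}\tfrac{d\lambda}{2\rho(\lambda)},$$ and, for $s=1,2$, $$\mathcal{H}_{1,s}=\int_{-\infty}^{\infty}e^{i\lambda x-\omega_s(\lambda)t}\Big[\int_0^t h_1(\tau)e^{\omega_s(\lambda)\tau}d\tau\Big]\tfrac{\lambda\,d\lambda}{\rho(\lambda)},\quad \mathcal{H}_{2,s}=\int_{-\infty}^{\infty}e^{i\lambda x-\omega_s(\lambda)t}\Big[\int_0^t h_1(\tau)e^{\omega_s(\lambda)\tau}d\tau\Big]\tfrac{[i\omega_s(\lambda)+m]\,d\lambda}{\rho(\lambda)}.$$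 The $\mathcal{G}$- and $\mathcal{H}$-integrals are understood in the generalized sense $\lim_{A\to\infty}\int_0^A+\lim_{A\to\infty}\int_{-A}^0$. For $f\in\{f_1,f_2\}$, $\omega\in\{\omega_1,\omega_2\}$: $\hat f(\lambda,t)=\int_0^\infty e^{-i\lambda y}f(y,t)\,dy$ and $\tilde{\hat f}(\lambda,\omega,t)=\int_0^te^{\omega(\lambda)\tau}\hat f(\lambda,\tau)\,d\tau$; in $\tilde{\hat f}(-\lambda,\omega,t)$ one replaces $\hat f(\lambda,\tau)$ by $\hat f(-\lambda,\tau)$ (note $\omega(-\lambda)=\omega(\lambda)$). Set $$\mathcal{F}_{1,1}=\int_{-\infty}^\infty e^{i\lambda x-\omega_1(\lambda)t}\{\lambda\tilde{\hat f}_2(\lambda,\omega_1,t)+[i\omega_2(\lambda)+m]\tilde{\hat f}_1(\lambda,\omega_1,t)\}\tfrac{d\lambda}{2\rho(\lambda)}+\int_{-\infty}^\infty e^{i\lambda x-\omega_1(\lambda)t}\{\lambda\tilde{\hat f}_2(-\lambda,\omega_1,t)-[i\omega_2(\lambda)+m]\tilde{\hat f}_1(-\lambda,\omega_1,t)\}\tfrac{d\lambda}{2\rho(\lambda)},$$ $$\mathcal{F}_{1,2}=-\int_{-\infty}^\infty e^{i\lambda x-\omega_2(\lambda)t}\{\lambda\tilde{\hat f}_2(\lambda,\omega_2,t)+[i\omega_1(\lambda)+m]\tilde{\hat f}_1(\lambda,\omega_2,t)\}\tfrac{d\lambda}{2\rho(\lambda)}-\int_{-\infty}^\infty e^{i\lambda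 x-\omega_2(\lambda)t}\{\lambda\tilde{\hat f}_2(-\lambda,\omega_2,t)-[i\omega_1(\lambda)+m]\tilde{\hat f}_1(-\lambda,\omega_2,t)\}\tfrac{d\lambda}{2\rho(\lambda)},$$ $$\mathcal{F}_{2,1}=\int_{-\infty}^\infty e^{i\lambda x-\omega_1(\lambda)t}\{\lambda\tilde{\hat f}_1(\lambda,\omega_1,t)-[i\omega_1(\lambda)+m]\tilde{\hat f}_2(\lambda,\omega_1,t)\}\tfrac{d\lambda}{2\rho(\lambda)}-\int_{-\infty}^\infty e^{i\lambda x-\omega_1(\lambda)t}\{\lambda\tilde{\hat f}_1(-\lambda,\omega_1,t)+[i\omega_1(\lambda)+m]\tilde{\hat f}_2(-\lambda,\omega_1,t)\}\tfrac{d\lambda}{2\rho(\lambda)},$$ $$\mathcal{F}_{2,2}=-\int_{-\infty}^\infty e^{i\lambda x-\omega_2(\lambda)t}\{\lambda\tilde{\hat f}_1(\lambda,\omega_2,t)-[i\omega_2(\lambda)+m]\tilde{\hat f}_2(\lambda,\omega_2,t)\}\tfrac{d\lambda}{2\rho(\lambda)}+\int_{-\infty}^\infty e^{i\lambda x-\omega_2(\lambda)t}\{\lambda\tilde{\hat f}_1(-\lambda,\omega_2,t)+[i\omega_2(\lambda)+m]\tilde{\hat f}_2(-\lambda,\omega_2,t)\}\tfrac{d\lambda}{2\rho(\lambda)}.$$ For $x>0$, $t>0$, $x\ne t$, the functions $\Psi_1,\Psi_2$ are defined by $$2\pi\Psi_1=\mathcal{G}_{1,1}+\mathcal{G}_{1,2}-\mathcal{G}_{1,3}-\mathcal{G}_{1,4}+\mathcal{H}_{1,1}-\mathcal{H}_{1,2}+\mathcal{F}_{1,1}+\mathcal{F}_{1,2},$$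 $$2\pi\Psi_2=\mathcal{G}_{2,1}-\mathcal{G}_{2,2}-\mathcal{G}_{2,3}+\mathcal{G}_{2,4}-\mathcal{H}_{2,1}+\mathcal{H}_{2,2}+\mathcal{F}_{2,1}+\mathcal{F}_{2,2}.$$ *)

theory Defs
  imports "HOL-Analysis.Analysis"
begin

(* Derivatives are taken within the domain of the function, hence are one-sided at the
   boundary of [0,oo) and of the closed quadrant; at points of an open domain they are
   the ordinary ones. *)

definition half_line_deriv :: "nat \<Rightarrow> (real \<Rightarrow> complex) \<Rightarrow> real \<Rightarrow> complex" where
  "half_line_deriv k g = ((\<lambda>u x. vector_derivative u (at x within {0..})) ^^ k) g"

definition smooth_half_line :: "(real \<Rightarrow> complex) \<Rightarrow> bool" where
  "smooth_half_line g \<longleftrightarrow>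
     (\<forall>k. \<forall>x\<ge>0. half_line_deriv k g differentiable (at x within {0..}))"

definition schwartz_half_line :: "(real \<Rightarrow> complex) \<Rightarrow> bool" where
  "schwartz_half_line g \<longleftrightarrow> smooth_half_line g \<and>
     (\<forall>a b. bdd_above ((\<lambda>x. x ^ a * norm (half_line_deriv b g x)) ` {0..}))"

definition partial_x ::
  "(real \<times> real) set \<Rightarrow> (real \<Rightarrow> real \<Rightarrow> complex) \<Rightarrow> real \<Rightarrow> real \<Rightarrow> complex" where
  "partial_x S u x t = vector_derivative (\<lambda>y. u y t) (at x within {y. (y, t) \<in> S})"

definition partial_t ::
  "(real \<times> real) set \<Rightarrow> (real \<Rightarrow> real \<Rightarrow> complex) \<Rightarrow> real \<Rightarrow> real \<Rightarrow> complex" where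
  "partial_t S u x t = vector_derivative (\<lambda>s. u x s) (at t within {s. (x, s) \<in> S})"

definition mixed_partial ::
  "(real \<times> real) set \<Rightarrow> nat \<Rightarrow> nat \<Rightarrow> (real \<Rightarrow> real \<Rightarrow> complex) \<Rightarrow> real \<Rightarrow> real \<Rightarrow> complex" where
  "mixed_partial S n l u = (partial_x S ^^ n) ((partial_t S ^^ l) u)"

definition partially_differentiable ::
  "(real \<times> real) set \<Rightarrow> (real \<Rightarrow> real \<Rightarrow> complex) \<Rightarrow> real \<Rightarrow> real \<Rightarrow> bool" where
  "partially_differentiable S u x t \<longleftrightarrow>
     (\<lambda>y. u y t) differentiable (at x within {y. (y, t) \<in> S}) \<and>
     (\<lambda>s. u x s) differentiable (at t within {s. (x, s) \<in> S})"

definition smooth_on :: "(real \<times> real) set \<Rightarrow> (real \<Rightarrow> real \<Rightarrow> complex) \<Rightarrow> bool" where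
  "smooth_on S u \<longleftrightarrow>
     (\<forall>n l. continuous_on S (\<lambda>(x, t). mixed_partial S n l u x t) \<and>
            (\<forall>(x, t)\<in>S. partially_differentiable S (mixed_partial S n l u) x t))"

definition closed_quadrant :: "(real \<times> real) set" where
  "closed_quadrant = {0..} \<times> {0..}"

definition Psi_domain :: "(real \<times> real) set" where
  "Psi_domain = {(x, t). x > 0 \<and> t > 0 \<and> x \<noteq> t}"

definition rho :: "real \<Rightarrow> real \<Rightarrow> real" where
  "rho m \<xi> = sqrt (\<xi>\<^sup>2 + m\<^sup>2)"

definition omega1 :: "real \<Rightarrow> real \<Rightarrow> complex" where
  "omega1 m \<xi> = \<i> * of_real (rho m \<xi>)"

definition omega2 :: "real \<Rightarrow> real \<Rightarrow> complex" where
  "omega2 m \<xi> = - \<i> * of_real (rho m \<xi>)"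

definition half_ft :: "(real \<Rightarrow> complex) \<Rightarrow> real \<Rightarrow> complex" where
  "half_ft g \<xi> = (LBINT y:{0..}. exp (- \<i> * of_real \<xi> * of_real y) * g y)"

(* The second frequency argument w is the value omega(xi), not the function omega;
   as omega is even, the transform at -xi is time_ft f (-xi) (omega(xi)) t. *)
definition time_ft :: "(real \<Rightarrow> real \<Rightarrow> complex) \<Rightarrow> real \<Rightarrow> complex \<Rightarrow> real \<Rightarrow> complex" where
  "time_ft f \<xi> w t = (LBINT \<tau>:{0..t}. exp (w * of_real \<tau>) * half_ft (\<lambda>y. f y \<tau>) \<xi>)"

definition time_int :: "(real \<Rightarrow> complex) \<Rightarrow> complex \<Rightarrow> real \<Rightarrow> complex" where
  "time_int h w t = (LBINT \<tau>:{0..t}. h \<tau> * exp (w * of_real \<tau>))"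

definition gen_integral :: "(real \<Rightarrow> complex) \<Rightarrow> complex" where
  "gen_integral F =
     Lim at_top (\<lambda>A. LBINT \<xi>:{0..A}. F \<xi>) + Lim at_top (\<lambda>A. LBINT \<xi>:{-A..0}. F \<xi>)"

definition phase :: "real \<Rightarrow> complex \<Rightarrow> real \<Rightarrow> real \<Rightarrow> complex" where
  "phase \<xi> w x t = exp (\<i> * of_real \<xi> * of_real x - w * of_real t)"

definition G11 :: "real \<Rightarrow> (real \<Rightarrow> complex) \<Rightarrow> (real \<Rightarrow> complex) \<Rightarrow> real \<Rightarrow> real \<Rightarrow> complex" where
  "G11 m g1 g2 x t = gen_integral (\<lambda>\<xi>.
      phase \<xi> (omega1 m \<xi>) x t *
        (of_real \<xi> * half_ft g2 \<xi>
          + (\<i> * omega2 m \<xi> + of_real m) * half_ft g1 \<xi>)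
        / of_real (2 * rho m \<xi>))"

definition G12 :: "real \<Rightarrow> (real \<Rightarrow> complex) \<Rightarrow> (real \<Rightarrow> complex) \<Rightarrow> real \<Rightarrow> real \<Rightarrow> complex" where
  "G12 m g1 g2 x t = gen_integral (\<lambda>\<xi>.
      phase \<xi> (omega1 m \<xi>) x t *
        (of_real \<xi> * half_ft g2 (-\<xi>)
          - (\<i> * omega2 m \<xi> + of_real m) * half_ft g1 (-\<xi>))
        / of_real (2 * rho m \<xi>))"

definition G13 :: "real \<Rightarrow> (real \<Rightarrow> complex) \<Rightarrow> (real \<Rightarrow> complex) \<Rightarrow> real \<Rightarrow> real \<Rightarrow> complex" where
  "G13 m g1 g2 x t = gen_integral (\<lambda>\<xi>.
      phase \<xi> (omega2 m \<xi>) x t *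
        (of_real \<xi> * half_ft g2 \<xi>
          + (\<i> * omega1 m \<xi> + of_real m) * half_ft g1 \<xi>)
        / of_real (2 * rho m \<xi>))"

definition G14 :: "real \<Rightarrow> (real \<Rightarrow> complex) \<Rightarrow> (real \<Rightarrow> complex) \<Rightarrow> real \<Rightarrow> real \<Rightarrow> complex" where
  "G14 m g1 g2 x t = gen_integral (\<lambda>\<xi>.
      phase \<xi> (omega2 m \<xi>) x t *
        (of_real \<xi> * half_ft g2 (-\<xi>)
          - (\<i> * omega1 m \<xi> + of_real m) * half_ft g1 (-\<xi>))
        / of_real (2 * rho m \<xi>))"

definition G21 :: "real \<Rightarrow> (real \<Rightarrow> complex) \<Rightarrow> (real \<Rightarrow> complex) \<Rightarrow> real \<Rightarrow> real \<Rightarrow> complex" where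
  "G21 m g1 g2 x t = gen_integral (\<lambda>\<xi>.
      phase \<xi> (omega1 m \<xi>) x t *
        (of_real \<xi> * half_ft g1 \<xi>
          - (\<i> * omega1 m \<xi> + of_real m) * half_ft g2 \<xi>)
        / of_real (2 * rho m \<xi>))"

definition G22 :: "real \<Rightarrow> (real \<Rightarrow> complex) \<Rightarrow> (real \<Rightarrow> complex) \<Rightarrow> real \<Rightarrow> real \<Rightarrow> complex" where
  "G22 m g1 g2 x t = gen_integral (\<lambda>\<xi>.
      phase \<xi> (omega1 m \<xi>) x t *
        (of_real \<xi> * half_ft g1 (-\<xi>)
          + (\<i> * omega1 m \<xi> + of_real m) * half_ft g2 (-\<xi>))
        / of_real (2 * rho m \<xi>))"

definition G23 :: "real \<Rightarrow> (real \<Rightarrow> complex) \<Rightarrow> (real \<Rightarrow> complex) \<Rightarrow> real \<Rightarrow> real \<Rightarrow> complex" where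
  "G23 m g1 g2 x t = gen_integral (\<lambda>\<xi>.
      phase \<xi> (omega2 m \<xi>) x t *
        (of_real \<xi> * half_ft g1 \<xi>
          - (\<i> * omega2 m \<xi> + of_real m) * half_ft g2 \<xi>)
        / of_real (2 * rho m \<xi>))"

definition G24 :: "real \<Rightarrow> (real \<Rightarrow> complex) \<Rightarrow> (real \<Rightarrow> complex) \<Rightarrow> real \<Rightarrow> real \<Rightarrow> complex" where
  "G24 m g1 g2 x t = gen_integral (\<lambda>\<xi>.
      phase \<xi> (omega2 m \<xi>) x t *
        (of_real \<xi> * half_ft g1 (-\<xi>)
          + (\<i> * omega2 m \<xi> + of_real m) * half_ft g2 (-\<xi>))
        / of_real (2 * rho m \<xi>))"

definition H11 :: "real \<Rightarrow> (real \<Rightarrow> complex) \<Rightarrow> real \<Rightarrow> real \<Rightarrow> complex" where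
  "H11 m h1 x t = gen_integral (\<lambda>\<xi>.
      phase \<xi> (omega1 m \<xi>) x t * time_int h1 (omega1 m \<xi>) t *
        of_real \<xi> / of_real (rho m \<xi>))"

definition H12 :: "real \<Rightarrow> (real \<Rightarrow> complex) \<Rightarrow> real \<Rightarrow> real \<Rightarrow> complex" where
  "H12 m h1 x t = gen_integral (\<lambda>\<xi>.
      phase \<xi> (omega2 m \<xi>) x t * time_int h1 (omega2 m \<xi>) t *
        of_real \<xi> / of_real (rho m \<xi>))"

definition H21 :: "real \<Rightarrow> (real \<Rightarrow> complex) \<Rightarrow> real \<Rightarrow> real \<Rightarrow> complex" where
  "H21 m h1 x t = gen_integral (\<lambda>\<xi>.
      phase \<xi> (omega1 m \<xi>) x t * time_int h1 (omega1 m \<xi>) t *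
        (\<i> * omega1 m \<xi> + of_real m) / of_real (rho m \<xi>))"

definition H22 :: "real \<Rightarrow> (real \<Rightarrow> complex) \<Rightarrow> real \<Rightarrow> real \<Rightarrow> complex" where
  "H22 m h1 x t = gen_integral (\<lambda>\<xi>.
      phase \<xi> (omega2 m \<xi>) x t * time_int h1 (omega2 m \<xi>) t *
        (\<i> * omega2 m \<xi> + of_real m) / of_real (rho m \<xi>))"

(* Unlike the G- and H-integrals, the F-integrals are ordinary (absolutely convergent)
   Lebesgue integrals over the real line. *)

definition F11 :: "real \<Rightarrow> (real \<Rightarrow> real \<Rightarrow> complex) \<Rightarrow> (real \<Rightarrow> real \<Rightarrow> complex) \<Rightarrow> real \<Rightarrow> real \<Rightarrow> complex" where
  "F11 m f1 f2 x t =
    (LBINT \<xi>.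
      phase \<xi> (omega1 m \<xi>) x t *
        (of_real \<xi> * time_ft f2 \<xi> (omega1 m \<xi>) t
          + (\<i> * omega2 m \<xi> + of_real m) * time_ft f1 \<xi> (omega1 m \<xi>) t)
        / of_real (2 * rho m \<xi>))
    + (LBINT \<xi>.
      phase \<xi> (omega1 m \<xi>) x t *
        (of_real \<xi> * time_ft f2 (-\<xi>) (omega1 m \<xi>) t
          - (\<i> * omega2 m \<xi> + of_real m) * time_ft f1 (-\<xi>) (omega1 m \<xi>) t)
        / of_real (2 * rho m \<xi>))"

definition F12 :: "real \<Rightarrow> (real \<Rightarrow> real \<Rightarrow> complex) \<Rightarrow> (real \<Rightarrow> real \<Rightarrow> complex) \<Rightarrow> real \<Rightarrow> real \<Rightarrow> complex" where
  "F12 m f1 f2 x t =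
    - (LBINT \<xi>.
      phase \<xi> (omega2 m \<xi>) x t *
        (of_real \<xi> * time_ft f2 \<xi> (omega2 m \<xi>) t
          + (\<i> * omega1 m \<xi> + of_real m) * time_ft f1 \<xi> (omega2 m \<xi>) t)
        / of_real (2 * rho m \<xi>))
    - (LBINT \<xi>.
      phase \<xi> (omega2 m \<xi>) x t *
        (of_real \<xi> * time_ft f2 (-\<xi>) (omega2 m \<xi>) t
          - (\<i> * omega1 m \<xi> + of_real m) * time_ft f1 (-\<xi>) (omega2 m \<xi>) t)
        / of_real (2 * rho m \<xi>))"

definition F21 :: "real \<Rightarrow> (real \<Rightarrow> real \<Rightarrow> complex) \<Rightarrow> (real \<Rightarrow> real \<Rightarrow> complex) \<Rightarrow> real \<Rightarrow> real \<Rightarrow> complex" where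
  "F21 m f1 f2 x t =
    (LBINT \<xi>.
      phase \<xi> (omega1 m \<xi>) x t *
        (of_real \<xi> * time_ft f1 \<xi> (omega1 m \<xi>) t
          - (\<i> * omega1 m \<xi> + of_real m) * time_ft f2 \<xi> (omega1 m \<xi>) t)
        / of_real (2 * rho m \<xi>))
    - (LBINT \<xi>.
      phase \<xi> (omega1 m \<xi>) x t *
        (of_real \<xi> * time_ft f1 (-\<xi>) (omega1 m \<xi>) t
          + (\<i> * omega1 m \<xi> + of_real m) * time_ft f2 (-\<xi>) (omega1 m \<xi>) t)
        / of_real (2 * rho m \<xi>))"

definition F22 :: "real \<Rightarrow> (real \<Rightarrow> real \<Rightarrow> complex) \<Rightarrow> (real \<Rightarrow> real \<Rightarrow> complex) \<Rightarrow> real \<Rightarrow> real \<Rightarrow> complex" where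
  "F22 m f1 f2 x t =
    - (LBINT \<xi>.
      phase \<xi> (omega2 m \<xi>) x t *
        (of_real \<xi> * time_ft f1 \<xi> (omega2 m \<xi>) t
          - (\<i> * omega2 m \<xi> + of_real m) * time_ft f2 \<xi> (omega2 m \<xi>) t)
        / of_real (2 * rho m \<xi>))
    + (LBINT \<xi>.
      phase \<xi> (omega2 m \<xi>) x t *
        (of_real \<xi> * time_ft f1 (-\<xi>) (omega2 m \<xi>) t
          + (\<i> * omega2 m \<xi> + of_real m) * time_ft f2 (-\<xi>) (omega2 m \<xi>) t)
        / of_real (2 * rho m \<xi>))"

definition Psi1 ::
  "real \<Rightarrow> (real \<Rightarrow> complex) \<Rightarrow> (real \<Rightarrow> complex) \<Rightarrow> (real \<Rightarrow> complex) \<Rightarrow> (real \<Rightarrow> real \<Rightarrow> complex) \<Rightarrow>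
     (real \<Rightarrow> real \<Rightarrow> complex) \<Rightarrow> real \<Rightarrow> real \<Rightarrow> complex" where
  "Psi1 m g1 g2 h1 f1 f2 x t =
     (G11 m g1 g2 x t + G12 m g1 g2 x t - G13 m g1 g2 x t - G14 m g1 g2 x t
      + H11 m h1 x t - H12 m h1 x t + F11 m f1 f2 x t + F12 m f1 f2 x t) / of_real (2 * pi)"

definition Psi2 ::
  "real \<Rightarrow> (real \<Rightarrow> complex) \<Rightarrow> (real \<Rightarrow> complex) \<Rightarrow> (real \<Rightarrow> complex) \<Rightarrow> (real \<Rightarrow> real \<Rightarrow> complex) \<Rightarrow>
     (real \<Rightarrow> real \<Rightarrow> complex) \<Rightarrow> real \<Rightarrow> real \<Rightarrow> complex" where
  "Psi2 m g1 g2 h1 f1 f2 x t =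
     (G21 m g1 g2 x t - G22 m g1 g2 x t - G23 m g1 g2 x t + G24 m g1 g2 x t
      - H21 m h1 x t + H22 m h1 x t + F21 m f1 f2 x t + F22 m f1 f2 x t) / of_real (2 * pi)"

end

theory Submission
  imports Defs "HOL-Probability.Sinc_Integral"
begin

text \<open>
The idea is finite speed of propagation. Each integral in the definition of \<Psi> carries only one of
the two phases exp(i\<xi>x \<mp> i\<rho>t) and taken alone does not propagate at finite speed, because the
square root \<rho> is not an entire function of \<xi>. The integrals come in pairs, however: in \<Psi> the integral with \<omega>_1 and the
one with \<omega>_2 are subtracted, and the pair has the form \<integral> exp(i\<xi>x) M(\<xi>,t) h(\<xi>) d\<xi> with a multiplier M that is
a combination of cos(\<rho>t), sin(\<rho>t)/\<rho> and \<xi> sin(\<rho>t)/\<rho>. These three functions are entire in \<xi> of exponential type t,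
hence Fourier transforms of distributions carried by [-t,t]; explicitly,
  sin(\<rho>s)/\<rho> = 1/2 \<integral> J_0(m sqrt(s^2 - y^2)) exp(-i\<xi>y) dy  (y from -s to s),
and the other two arise from it by d/ds and by multiplication with \<xi>. So multiplying by M in frequency is, in the
physical variable, a weighted average over the points x - s\<alpha> with |\<alpha>| \<le> 1. This correspondence is
recorded by the predicate propagator.

Beyond the light cone, x > t, all points x - s\<alpha> with 0 \<le> s \<le> t are positive, and there the three
kinds of data behave as follows.

The initial data enter through their half-line transforms. Fourier inversion returns 2\<pi>g at positive
points from the transform at \<xi> and returns 0 from the transform at -\<xi>, since the latter belongs to the
reflected function (half_ft_inversion). So a pair of data integrals is an average of g over [x - t, x + t]
(propagator_limit, initial_block), or zero.

The forcing enters in the same way at each time \<tau> and is integrated over \<tau> (propagator_duhamel,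
forcing_block).

The boundary value h_1 acts at the point 0, which averages centred at x do not reach when x > t; its contribution
vanishes by the Riemann-Lebesgue lemma (propagator_source, boundary_terms_cancel).

Hence \<Psi> restricted to x > t is a finite sum of averages over the unit square of rapidly decreasing
functions at points at distance at least x - t from the boundary. Differentiation in x or t produces
averages of the same kind, so all derivatives decrease rapidly, uniformly for t \<le> T
(spread_decays, Psi_decays).

Splitting \<Psi> into pairs requires that the single integrals converge: the generalized integrals are
sums of two limits, and limits may be subtracted only when they exist. Integrating by parts once shows
that the data and boundary integrands are sums of terms c exp(i\<xi>\<delta>)/\<xi> up to O(\<xi>^(-2)) with \<delta> \<noteq> 0 because x > t
(half_conv_asy), and the forcing integrands are O(\<xi>^(-2)) (forcing_integrable).
\<close>

section \<open>Bessel kernels and the multipliers they represent\<close>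

text \<open>These are the entire functions u^(-k/2) J_k(2 sqrt u), up to the sign (-1)^k; with that sign each
is the derivative of the preceding one.\<close>

definition bes :: "nat \<Rightarrow> real \<Rightarrow> real" where
  "bes k u = (\<Sum>n. (-1) ^ (n + k) / (fact n * fact (n + k)) * u ^ n)"

lemma summable_bes: "summable (\<lambda>n. (-1) ^ (n + k) / (fact n * fact (n + k)) * (u::real) ^ n)"
proof (rule summable_comparison_test')
  show "summable (\<lambda>n. \<bar>u\<bar> ^ n / fact n)"
    using summable_exp_generic[of "\<bar>u\<bar>"] by (simp add: divide_real_def mult.commute)
  fix n :: nat
  have "1 * fact n \<le> fact n * (fact (n + k) :: real)"
    using mult_left_mono[of 1 "fact (n + k)" "fact n :: real"] by (simp add: fact_ge_1)
  then have "\<bar>u\<bar> ^ n / (fact n * fact (n + k)) \<le> \<bar>u\<bar> ^ n / fact n"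
    by (intro divide_left_mono) auto
  then show "norm ((-1) ^ (n + k) / (fact n * fact (n + k)) * u ^ n) \<le> \<bar>u\<bar> ^ n / fact n"
    by (simp add: abs_mult power_abs)
qed

lemma DERIV_bes: "(bes k has_real_derivative bes (Suc k) u) (at u)"
proof -
  have "((\<lambda>x. \<Sum>n. (-1) ^ (n + k) / (fact n * fact (n + k)) * x ^ n) has_field_derivative
      (\<Sum>n. diffs (\<lambda>n. (-1) ^ (n + k) / (fact n * fact (n + k))) n * u ^ n)) (at u)"
    by (rule termdiffs_strong_converges_everywhere) (rule summable_bes)
  moreover have "diffs (\<lambda>n. (-1) ^ (n + k) / (fact n * fact (n + k)) :: real) n
      = (-1) ^ (n + Suc k) / (fact n * fact (n + Suc k))" for n
    by (simp add: diffs_def divide_simps)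
  ultimately show ?thesis
    by (simp add: bes_def[abs_def])
qed

lemma DERIV_bes_chain:
  assumes "(g has_real_derivative g') (at x within S)"
  shows "((\<lambda>x. bes k (g x)) has_real_derivative bes (Suc k) (g x) * g') (at x within S)"
  using DERIV_chain2[OF DERIV_bes assms] .

lemma continuous_on_bes [continuous_intros]:
  assumes "continuous_on A f" shows "continuous_on A (\<lambda>x. bes k (f x))"
proof -
  have "continuous_on UNIV (bes k)"
    using DERIV_bes DERIV_isCont continuous_at_imp_continuous_on by blast
  then show ?thesis
    using assms continuous_on_compose2 by blast
qed

lemma bes_0_0: "bes 0 0 = 1"
  using suminf_finite[of "{0::nat}" "\<lambda>n. (-1) ^ (n + 0) / (fact n * fact (n + 0)) * (0::real) ^ n"]
  by (simp add: bes_def)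

text \<open>Bessel's equation u f'' + f' + f = 0 for f(u) = J_0(2 sqrt u). The coefficients of the series cancel
degree by degree.\<close>

lemma bes_ode: "u * bes 2 u + bes 1 u + bes 0 u = 0"
proof -
  let ?a = "\<lambda>k n. (-1) ^ (n + k) / (fact n * fact (n + k)) * u ^ n"
  have s2: "(\<lambda>n. case n of 0 \<Rightarrow> 0 | Suc n \<Rightarrow> u * ?a 2 n) sums (u * bes 2 u)"
    using sums_Suc[of "\<lambda>n. case n of 0 \<Rightarrow> 0 | Suc n \<Rightarrow> u * ?a 2 n"]
      sums_mult[OF summable_sums[OF summable_bes[of 2 u]], of u]
    by (simp add: bes_def)
  have "(\<lambda>n. (case n of 0 \<Rightarrow> 0 | Suc n \<Rightarrow> u * ?a 2 n) + ?a 1 n + ?a 0 n) sums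
      (u * bes 2 u + bes 1 u + bes 0 u)"
    using s2 summable_sums[OF summable_bes[of 1 u]] summable_sums[OF summable_bes[of 0 u]]
    by (intro sums_add) (auto simp: bes_def)
  moreover have "(case n of 0 \<Rightarrow> 0 | Suc n \<Rightarrow> u * ?a 2 n) + ?a 1 n + ?a 0 n = 0" for n
  proof (cases n)
    case (Suc j)
    have "(fact (Suc j) :: real) = (real j + 1) * fact j" "(fact (j + 2) :: real) = (real j + 2) * (real j + 1) * fact j"
      by (simp_all add: algebra_simps numeral_2_eq_2)
    then show ?thesis
      unfolding Suc by (simp add: divide_simps) (simp add: algebra_simps)?
  qed simp
  ultimately show ?thesis
    by (metis (no_types, lifting) sums_unique2 sums_zero sums_cong)
qed

lemma has_vector_derivative_cis:
  assumes "(f has_real_derivative f') (at x within S)"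
  shows "((\<lambda>x. cis (f x)) has_vector_derivative (\<i> * of_real f' * cis (f x))) (at x within S)"
proof -
  have "((\<lambda>x. of_real (cos (f x)) + \<i> * of_real (sin (f x))) has_vector_derivative
      of_real (- sin (f x) * f') + \<i> * of_real (cos (f x) * f')) (at x within S)"
    using assms
    by (intro has_vector_derivative_add has_vector_derivative_mult_right has_vector_derivative_of_real)
       (auto intro!: derivative_eq_intros simp: has_real_derivative_iff_has_vector_derivative[symmetric])
  moreover have "(\<lambda>x. of_real (cos (f x)) + \<i> * of_real (sin (f x))) = (\<lambda>x. cis (f x))"
    by (auto simp: complex_eq_iff)
  moreover have "of_real (- sin (f x) * f') + \<i> * of_real (cos (f x) * f') = \<i> * of_real f' * cis (f x)"
    by (auto simp: complex_eq_iff)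
  ultimately show ?thesis
    by simp
qed

text \<open>A superposition of the waves exp(-i\<xi>s\<alpha>(w)), that is, the Fourier transform of a weight spread over
the points s\<alpha>(w). The weights s^j bes k (c(w) s^2) form a class closed under d/ds, which is what makes every
kernel below and all of its time derivatives of this one form. A constant \<alpha> gives a single plane wave.\<close>

definition atom ::
  "(real \<Rightarrow> complex) \<Rightarrow> nat \<Rightarrow> nat \<Rightarrow> (real \<Rightarrow> real) \<Rightarrow> (real \<Rightarrow> real) \<Rightarrow> real \<Rightarrow> real \<Rightarrow> complex" where
  "atom q j k c \<alpha> \<xi> s =
     integral {0..1} (\<lambda>w. q w * of_real (s ^ j * bes k (c w * s\<^sup>2)) * cis (- (\<xi> * s * \<alpha> w)))"

lemma atom_has_integral:
  assumes [continuous_intros]: "continuous_on {0..1} q" "continuous_on {0..1} c" "continuous_on {0..1} \<alpha>"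
  shows "((\<lambda>w. q w * of_real (s ^ j * bes k (c w * s\<^sup>2)) * cis (- (\<xi> * s * \<alpha> w)))
    has_integral atom q j k c \<alpha> \<xi> s) {0..1}"
  unfolding atom_def
  by (intro integrable_integral integrable_continuous_interval continuous_intros)

text \<open>The three terms come from the power of s, from the Bessel factor and from the exponential.\<close>

lemma atom_has_vector_derivative:
  assumes [continuous_intros]: "continuous_on {0..1} q" "continuous_on {0..1} c" "continuous_on {0..1} \<alpha>"
  shows "(atom q j k c \<alpha> \<xi> has_vector_derivative
      atom (\<lambda>w. of_nat j * q w) (j - 1) k c \<alpha> \<xi> s
      + atom (\<lambda>w. of_real (2 * c w) * q w) (Suc j) (Suc k) c \<alpha> \<xi> s
      + atom (\<lambda>w. - \<i> * of_real (\<xi> * \<alpha> w) * q w) j k c \<alpha> \<xi> s) (at s)"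
proof -
  let ?f = "\<lambda>s w. q w * of_real (s ^ j * bes k (c w * s\<^sup>2)) * cis (- (\<xi> * s * \<alpha> w))"
  let ?f' = "\<lambda>s w. q w * of_real (real j * s ^ (j - 1) * bes k (c w * s\<^sup>2)
        + s ^ j * (bes (Suc k) (c w * s\<^sup>2) * (2 * c w * s))) * cis (- (\<xi> * s * \<alpha> w))
      + q w * of_real (s ^ j * bes k (c w * s\<^sup>2)) * (\<i> * of_real (- (\<xi> * \<alpha> w)) * cis (- (\<xi> * s * \<alpha> w)))"
  have [continuous_intros]: "continuous_on (UNIV \<times> {0..1}) (\<lambda>x. q (snd x))"
    "continuous_on (UNIV \<times> {0..1}) (\<lambda>x. c (snd x))" "continuous_on (UNIV \<times> {0..1}) (\<lambda>x. \<alpha> (snd x))"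
    by (rule assms[THEN continuous_on_compose2]; auto intro: continuous_intros)+
  have "((\<lambda>s. integral (cbox 0 1) (?f s)) has_vector_derivative integral (cbox 0 1) (?f' s)) (at s within UNIV)"
  proof (rule leibniz_rule_vector_derivative)
    fix s w :: real assume w: "w \<in> cbox 0 1"
    have b: "((\<lambda>s. s ^ j * bes k (c w * s\<^sup>2)) has_real_derivative
        (real j * s ^ (j - 1) * bes k (c w * s\<^sup>2) + s ^ j * (bes (Suc k) (c w * s\<^sup>2) * (2 * c w * s))))
        (at s within UNIV)"
      by (rule derivative_eq_intros DERIV_bes_chain refl | simp)+
    have e: "((\<lambda>s. cis (- (\<xi> * s * \<alpha> w))) has_vector_derivative
        \<i> * of_real (- (\<xi> * \<alpha> w)) * cis (- (\<xi> * s * \<alpha> w))) (at s within UNIV)"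
      by (rule has_vector_derivative_cis) (auto intro!: derivative_eq_intros)
    have q: "((\<lambda>s. q w) has_vector_derivative 0) (at s within UNIV)"
      by simp
    show "((\<lambda>s. ?f s w) has_vector_derivative ?f' s w) (at s within UNIV)"
      by (rule has_vector_derivative_eq_rhs[OF has_vector_derivative_mult[OF has_vector_derivative_mult[OF q
            has_vector_derivative_of_real[OF b]] e]])
         (simp only: mult_zero_left add_0_left add_0_right, rule add.commute)
  next
    show "?f s integrable_on cbox 0 1" for s
      unfolding cbox_interval by (intro integrable_continuous_interval continuous_intros)
    show "continuous_on (UNIV \<times> cbox 0 1) (\<lambda>(s, w). ?f' s w)"
      unfolding cbox_interval case_prod_unfold by (intro continuous_intros)
  qed auto
  moreover have "(?f' s has_integral
      atom (\<lambda>w. of_nat j * q w) (j - 1) k c \<alpha> \<xi> s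
      + atom (\<lambda>w. of_real (2 * c w) * q w) (Suc j) (Suc k) c \<alpha> \<xi> s
      + atom (\<lambda>w. - \<i> * of_real (\<xi> * \<alpha> w) * q w) j k c \<alpha> \<xi> s) {0..1}"
    by (rule has_integral_eq[rotated], rule has_integral_add, rule has_integral_add;
        (rule atom_has_integral; intro continuous_intros)?)
       (simp add: algebra_simps)
  ultimately show ?thesis
    by (simp add: atom_def[abs_def] integral_unique)
qed

text \<open>With y = s (2w - 1) the segment [-s,s] is parametrized by w in [0,1], and
s^2 m^2 w (1 - w) = m^2 (s^2 - y^2) / 4, so that bes 0 of it is J_0(m sqrt(s^2 - y^2)).\<close>

abbreviation cone :: "real \<Rightarrow> real \<Rightarrow> real" where
  "cone m \<equiv> (\<lambda>w. m\<^sup>2 * w * (1 - w))"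

abbreviation chord :: "real \<Rightarrow> real" where
  "chord \<equiv> (\<lambda>w. 2 * w - 1)"

text \<open>Integration by parts in w against the affine weight a + d w. The term with factor \<xi> is a derivative of the
exponential, and shifting that derivative to the other factors leaves the endpoint waves
exp(\<mp>i\<xi>t) and a smooth remainder. This is the source of the plane waves in the kernels for
cos(\<rho>s) and \<xi> sin(\<rho>s)/\<rho>.\<close>

lemma atom_parts:
  fixes a d :: complex
  shows "d * atom (\<lambda>w. 1) 0 0 (cone m) chord \<xi> t
    + atom (\<lambda>w. (a + d * of_real w) * of_real (m\<^sup>2 * (1 - 2 * w))) 2 1 (cone m) chord \<xi> t
    - 2 * \<i> * of_real \<xi> * atom (\<lambda>w. a + d * of_real w) 1 0 (cone m) chord \<xi> t
    = (a + d) * cis (- (\<xi> * t)) - a * cis (\<xi> * t)"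
proof -
  let ?F = "\<lambda>w. (a + d * of_real w) * of_real (bes 0 (cone m w * t\<^sup>2)) * cis (- (\<xi> * t * chord w))"
  let ?F' = "\<lambda>w. d * of_real (bes 0 (cone m w * t\<^sup>2)) * cis (- (\<xi> * t * chord w))
     + (a + d * of_real w) * of_real (bes 1 (cone m w * t\<^sup>2) * (m\<^sup>2 * (1 - 2 * w) * t\<^sup>2)) * cis (- (\<xi> * t * chord w))
     + (a + d * of_real w) * of_real (bes 0 (cone m w * t\<^sup>2)) * (\<i> * of_real (- (2 * \<xi> * t)) * cis (- (\<xi> * t * chord w)))"
  have FI: "(?F' has_integral (?F 1 - ?F 0)) {0..1}"
  proof (rule fundamental_theorem_of_calculus)
    fix w :: real
    have b: "((\<lambda>w. bes 0 (cone m w * t\<^sup>2)) has_real_derivative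
        bes 1 (cone m w * t\<^sup>2) * (m\<^sup>2 * (1 - 2 * w) * t\<^sup>2)) (at w within {0..1})"
      unfolding One_nat_def
      by (rule DERIV_bes_chain) (auto intro!: derivative_eq_intros simp: algebra_simps)
    have c: "((\<lambda>w. cis (- (\<xi> * t * chord w))) has_vector_derivative
        \<i> * of_real (- (2 * \<xi> * t)) * cis (- (\<xi> * t * chord w))) (at w within {0..1})"
      by (rule has_vector_derivative_cis) (auto intro!: derivative_eq_intros)
    have l: "((\<lambda>w. a + d * of_real w) has_vector_derivative d) (at w within {0..1})"
      by (auto intro!: derivative_eq_intros has_vector_derivative_of_real)
    show "(?F has_vector_derivative ?F' w) (at w within {0..1})"
      using has_vector_derivative_mult[OF has_vector_derivative_mult[OF l
            has_vector_derivative_of_real[OF b]] c]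
      by (simp add: algebra_simps)
  qed simp
  have fI: "((\<lambda>w. d * (1 * of_real (t ^ 0 * bes 0 (cone m w * t\<^sup>2)) * cis (- (\<xi> * t * chord w)))
      + (a + d * of_real w) * of_real (m\<^sup>2 * (1 - 2 * w)) * of_real (t\<^sup>2 * bes 1 (cone m w * t\<^sup>2)) * cis (- (\<xi> * t * chord w))
      - 2 * \<i> * of_real \<xi> * ((a + d * of_real w) * of_real (t ^ 1 * bes 0 (cone m w * t\<^sup>2)) * cis (- (\<xi> * t * chord w))))
     has_integral
     (d * atom (\<lambda>w. 1) 0 0 (cone m) chord \<xi> t
    + atom (\<lambda>w. (a + d * of_real w) * of_real (m\<^sup>2 * (1 - 2 * w))) 2 1 (cone m) chord \<xi> t
    - 2 * \<i> * of_real \<xi> * atom (\<lambda>w. a + d * of_real w) 1 0 (cone m) chord \<xi> t)) {0..1}"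
    (is "(?f has_integral _) _")
    by (intro has_integral_diff has_integral_add has_integral_mult_right atom_has_integral continuous_intros)
  have "?f = ?F'"
    by (simp add: fun_eq_iff algebra_simps power2_eq_square)
  from has_integral_unique[OF fI[unfolded this] FI] show ?thesis
    by (simp add: bes_0_0)
qed

lemma atom_add:
  assumes "continuous_on {0..1} q" "continuous_on {0..1} r" "continuous_on {0..1} c" "continuous_on {0..1} \<alpha>"
  shows "atom q j k c \<alpha> \<xi> s + atom r j k c \<alpha> \<xi> s = atom (\<lambda>w. q w + r w) j k c \<alpha> \<xi> s"
  using has_integral_add[OF atom_has_integral[OF assms(1,3,4)] atom_has_integral[OF assms(2-4)],
      of s j k \<xi> s j k \<xi>]
  by (simp add: atom_def integral_unique distrib_right)

lemma atom_cmult: "a * atom q j k c \<alpha> \<xi> s = atom (\<lambda>w. a * q w) j k c \<alpha> \<xi> s"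
  by (simp add: atom_def mult.assoc)

lemma atom_trivial: "atom (\<lambda>w. a) 0 0 (\<lambda>w. 0) (\<lambda>w. b) \<xi> s = a * cis (- (\<xi> * s * b))"
  by (simp add: atom_def bes_0_0)

text \<open>The representation of sin(\<rho>s)/\<rho> by an integral over [-s,s] of J_0(m sqrt(s^2 - y^2)), and its
s-derivative, where the endpoints of the moving segment contribute cos(\<xi>s). That they have these
values is shown in sinc_kernel_eq.\<close>

definition sinc_kernel :: "real \<Rightarrow> real \<Rightarrow> real \<Rightarrow> complex" where
  "sinc_kernel m = atom (\<lambda>w. 1) 1 0 (cone m) chord"

definition cos_kernel :: "real \<Rightarrow> real \<Rightarrow> real \<Rightarrow> complex" where
  "cos_kernel m \<xi> s = of_real (cos (\<xi> * s)) + atom (\<lambda>w. of_real (m\<^sup>2 / 2)) 2 1 (cone m) chord \<xi> s"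

lemma cis_plus: "cis a + cis (- a) = 2 * of_real (cos a)" and cis_minus: "cis (- a) - cis a = - 2 * \<i> * of_real (sin a)"
  by (auto simp: complex_eq_iff)

text \<open>The term with factor \<xi> in the derivative is removed by atom_parts with the weight w - 1/2 = chord w / 2.\<close>

lemma sinc_kernel_deriv: "(sinc_kernel m \<xi> has_vector_derivative cos_kernel m \<xi> s) (at s)"
proof -
  let ?A = "\<lambda>q j k. atom q j k (cone m) chord \<xi> s"
  \<comment> \<open>the endpoint waves with weights 1/2 and 1/2 add up to cos\<close>
  have E1: "?A (\<lambda>w. 1) 0 0 + ?A (\<lambda>w. (- 1 / 2 + 1 * of_real w) * of_real (m\<^sup>2 * (1 - 2 * w))) 2 1
     - 2 * \<i> * of_real \<xi> * ?A (\<lambda>w. - 1 / 2 + 1 * of_real w) 1 0 = of_real (cos (\<xi> * s))"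
    using atom_parts[of 1 m \<xi> s "- 1 / 2"] cis_plus[of "\<xi> * s"] by (simp add: field_simps)
  \<comment> \<open>2 m^2 w (1 - w) = m^2/2 + (w - 1/2) m^2 (1 - 2w)\<close>
  have E2: "?A (\<lambda>w. of_real (2 * cone m w) * 1) (Suc 1) (Suc 0) =
      ?A (\<lambda>w. of_real (m\<^sup>2 / 2)) 2 1 + ?A (\<lambda>w. (- 1 / 2 + 1 * of_real w) * of_real (m\<^sup>2 * (1 - 2 * w))) 2 1"
    by (subst atom_add, (intro continuous_intros)+)
       (simp add: numeral_2_eq_2[symmetric], rule arg_cong[of _ _ "\<lambda>q. ?A q 2 (Suc 0)"],
         simp add: fun_eq_iff field_simps power2_eq_square)
  have E3: "?A (\<lambda>w. - \<i> * of_real (\<xi> * chord w) * 1) 1 0 =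
      - 2 * \<i> * of_real \<xi> * ?A (\<lambda>w. - 1 / 2 + 1 * of_real w) 1 0"
    unfolding atom_cmult by (rule arg_cong[of _ _ "\<lambda>q. ?A q 1 0"]) (simp add: fun_eq_iff algebra_simps)
  have "(sinc_kernel m \<xi> has_vector_derivative
      ?A (\<lambda>w. of_nat 1 * 1) (1 - 1) 0 + ?A (\<lambda>w. of_real (2 * cone m w) * 1) (Suc 1) (Suc 0)
      + ?A (\<lambda>w. - \<i> * of_real (\<xi> * chord w) * 1) 1 0) (at s)"
    unfolding sinc_kernel_def by (rule atom_has_vector_derivative) (intro continuous_intros)+
  then show ?thesis
    unfolding E2 E3 cos_kernel_def E1[symmetric]
    by (rule has_vector_derivative_eq_rhs) (simp only: of_nat_1 mult_1 diff_self_eq_0, algebra)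
qed

text \<open>The case of a constant weight, which expresses \<xi> sin(\<rho>s)/\<rho> as sin(\<xi>s) plus a bounded average.\<close>

lemma atom_parts_0:
  "atom (\<lambda>w. (a + 0 * of_real w) * of_real (m\<^sup>2 * (1 - 2 * w))) 2 1 (cone m) chord \<xi> s
    = 2 * \<i> * (a * (of_real \<xi> * sinc_kernel m \<xi> s - of_real (sin (\<xi> * s))))"
proof -
  have Y: "atom (\<lambda>w. a + 0 * of_real w) 1 0 (cone m) chord \<xi> s = a * sinc_kernel m \<xi> s"
    by (simp add: sinc_kernel_def atom_cmult)
  have "atom (\<lambda>w. (a + 0 * of_real w) * of_real (m\<^sup>2 * (1 - 2 * w))) 2 1 (cone m) chord \<xi> s
    = a * (cis (- (\<xi> * s)) - cis (\<xi> * s)) + 2 * \<i> * of_real \<xi> * (a * sinc_kernel m \<xi> s)"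
    using atom_parts[of 0 m \<xi> s a] unfolding Y by algebra
  then show ?thesis
    unfolding cis_minus by (simp only: right_diff_distrib) (simp add: mult_ac)
qed

text \<open>Together with sinc_kernel_deriv this is the oscillator equation v'' = -\<rho>^2 v. The terms without \<xi> add up
to -m^2 v by Bessel's equation, and atom_parts_0 evaluates the remaining one.\<close>

lemma cos_kernel_deriv:
  "(cos_kernel m \<xi> has_vector_derivative - of_real (\<xi>\<^sup>2 + m\<^sup>2) * sinc_kernel m \<xi> s) (at s)"
proof -
  let ?A = "\<lambda>q j k. atom q j k (cone m) chord \<xi> s"
  let ?q = "\<lambda>w::real. of_real (m\<^sup>2 / 2) :: complex"
  have A: "(atom ?q 2 1 (cone m) chord \<xi> has_vector_derivative
      ?A (\<lambda>w. of_nat 2 * ?q w) (2 - 1) 1 + ?A (\<lambda>w. of_real (2 * cone m w) * ?q w) (Suc 2) (Suc 1)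
      + ?A (\<lambda>w. - \<i> * of_real (\<xi> * chord w) * ?q w) 2 1) (at s)"
    by (rule atom_has_vector_derivative) (intro continuous_intros)+
  have "((\<lambda>s. of_real (cos (\<xi> * s)) :: complex) has_vector_derivative of_real (- \<xi> * sin (\<xi> * s))) (at s)"
    by (intro has_vector_derivative_of_real) (auto intro!: derivative_eq_intros)
  note D = has_vector_derivative_add[OF this A]
  have parts: "?A (\<lambda>w. (\<i> * of_real (\<xi> / 2) + 0 * of_real w) * of_real (m\<^sup>2 * (1 - 2 * w))) 2 1
      = of_real (\<xi> * sin (\<xi> * s)) - of_real (\<xi>\<^sup>2) * sinc_kernel m \<xi> s"
    unfolding atom_parts_0 by (simp add: power2_eq_square right_diff_distrib)
  have eq: "?A (\<lambda>w. - \<i> * of_real (\<xi> * chord w) * ?q w) 2 1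
      = ?A (\<lambda>w. (\<i> * of_real (\<xi> / 2) + 0 * of_real w) * of_real (m\<^sup>2 * (1 - 2 * w))) 2 1"
    by (rule arg_cong[of _ _ "\<lambda>q. ?A q 2 1"]) (simp add: fun_eq_iff field_simps)
  \<comment> \<open>the integrand is m^2 s times the left side of Bessel's equation at m^2 w (1 - w) s^2\<close>
  have ode: "of_real (m\<^sup>2) * sinc_kernel m \<xi> s + ?A (\<lambda>w. of_nat 2 * ?q w) (2 - 1) 1
      + ?A (\<lambda>w. of_real (2 * cone m w) * ?q w) (Suc 2) (Suc 1) = 0" (is "?L = 0")
  proof -
    have "((\<lambda>w. (of_real (m\<^sup>2) * 1) * of_real (s ^ 1 * bes 0 (cone m w * s\<^sup>2)) * cis (- (\<xi> * s * chord w))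
        + of_nat 2 * ?q w * of_real (s ^ (2 - 1) * bes 1 (cone m w * s\<^sup>2)) * cis (- (\<xi> * s * chord w))
        + of_real (2 * cone m w) * ?q w * of_real (s ^ Suc 2 * bes (Suc 1) (cone m w * s\<^sup>2)) * cis (- (\<xi> * s * chord w)))
       has_integral ?L) {0..1}" (is "(?f has_integral _) _")
      unfolding sinc_kernel_def atom_cmult
      by (intro has_integral_add atom_has_integral continuous_intros)
    moreover have "?f = (\<lambda>w. 0)"
    proof
      fix w
      have "?f w = of_real (m\<^sup>2 * s * (cone m w * s\<^sup>2 * bes 2 (cone m w * s\<^sup>2) + bes 1 (cone m w * s\<^sup>2)
          + bes 0 (cone m w * s\<^sup>2))) * cis (- (\<xi> * s * chord w))"
        by (simp add: numeral_2_eq_2 algebra_simps)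
      then show "?f w = 0"
        unfolding bes_ode by simp
    qed
    ultimately show ?thesis
      using has_integral_unique[OF _ has_integral_0, of ?L] by simp
  qed
  have "of_real (- \<xi> * sin (\<xi> * s)) + (?A (\<lambda>w. of_nat 2 * ?q w) (2 - 1) 1 + ?A (\<lambda>w. of_real (2 * cone m w) * ?q w) (Suc 2) (Suc 1)
      + ?A (\<lambda>w. - \<i> * of_real (\<xi> * chord w) * ?q w) 2 1) = - of_real (\<xi>\<^sup>2 + m\<^sup>2) * sinc_kernel m \<xi> s"
  proof -
    have aux: "- s + (X + Y + (s - z * v)) = - (z * v + A)" if "A + X + Y = 0" for A X Y s z v :: complex
      using that by algebra
    show ?thesis
      unfolding eq parts using aux[OF ode, of "of_real (\<xi> * sin (\<xi> * s))" "of_real (\<xi>\<^sup>2)" "sinc_kernel m \<xi> s"]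
      by (simp only: of_real_add distrib_right of_real_minus mult_minus_left)
  qed
  then show ?thesis
    using D unfolding cos_kernel_def[abs_def] by simp
qed

lemma kernel_initial: "sinc_kernel m \<xi> 0 = 0" "cos_kernel m \<xi> 0 = 1"
  by (simp_all add: sinc_kernel_def cos_kernel_def atom_def)

lemma rho_pos: "\<xi> \<noteq> 0 \<Longrightarrow> rho m \<xi> > 0" and rho_sq: "(rho m \<xi>)\<^sup>2 = \<xi>\<^sup>2 + m\<^sup>2"
  by (simp_all add: rho_def sum_power2_gt_zero_iff)

text \<open>Both sides solve the oscillator equation with the same initial values. Uniqueness is shown by hand: the two
bilinear expressions in the kernels and in sin(\<rho>s), cos(\<rho>s) that express a rotation have zero derivative, hence keep
their initial values 0 and 1, and sin^2 + cos^2 = 1 inverts the rotation. At \<xi> = 0 the quotient may be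
a division by zero, while the kernel is still continuous there.\<close>

lemma sinc_kernel_eq:
  assumes "\<xi> \<noteq> 0" shows "sinc_kernel m \<xi> s = of_real (sin (rho m \<xi> * s) / rho m \<xi>)"
    and "cos_kernel m \<xi> s = of_real (cos (rho m \<xi> * s))"
proof -
  let ?r = "rho m \<xi>" and ?v = "sinc_kernel m \<xi>" and ?u = "cos_kernel m \<xi>"
  have r: "?r > 0" "?r \<noteq> 0"
    using rho_pos[OF assms, of m] by auto
  have r2: "of_real (\<xi>\<^sup>2 + m\<^sup>2) = (of_real ?r :: complex)\<^sup>2"
    unfolding rho_sq[symmetric] by simp
  have dc: "((\<lambda>s. of_real (cos (?r * s)) :: complex) has_vector_derivative of_real (- ?r * sin (?r * s))) (at s within UNIV)"
   and ds: "((\<lambda>s. of_real (sin (?r * s)) :: complex) has_vector_derivative of_real (?r * cos (?r * s))) (at s within UNIV)" for s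
    by (intro has_vector_derivative_of_real; auto intro!: derivative_eq_intros)+
  note D = has_vector_derivative_mult[OF sinc_kernel_deriv dc] has_vector_derivative_mult[OF cos_kernel_deriv dc]
     has_vector_derivative_mult[OF sinc_kernel_deriv ds] has_vector_derivative_mult[OF cos_kernel_deriv ds]
  have "((\<lambda>s. of_real ?r * (?v s * of_real (cos (?r * s))) - ?u s * of_real (sin (?r * s))) has_vector_derivative 0) (at s within UNIV)" for s
    by (rule has_vector_derivative_eq_rhs[OF has_vector_derivative_diff[OF
          has_vector_derivative_mult_right[OF D(1)[of m \<xi> s], of "of_real ?r"] D(4)[of m \<xi> s]]])
       (simp only: r2 of_real_mult of_real_minus, algebra)
  then obtain a where "\<And>s. s \<in> UNIV \<Longrightarrow> of_real ?r * (?v s * of_real (cos (?r * s))) - ?u s * of_real (sin (?r * s)) = a"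
    by (rule has_vector_derivative_zero_constant[OF convex_UNIV]) blast
  from this[of 0] this[of s]
  have 1: "of_real ?r * (?v s * of_real (cos (?r * s))) = ?u s * of_real (sin (?r * s))"
    by (simp add: kernel_initial)
  have "((\<lambda>s. of_real ?r * (?v s * of_real (sin (?r * s))) + ?u s * of_real (cos (?r * s))) has_vector_derivative 0) (at s within UNIV)" for s
    by (rule has_vector_derivative_eq_rhs[OF has_vector_derivative_add[OF
          has_vector_derivative_mult_right[OF D(3)[of m \<xi> s], of "of_real ?r"] D(2)[of m \<xi> s]]])
       (simp only: r2 of_real_mult of_real_minus, algebra)
  then obtain b where "\<And>s. s \<in> UNIV \<Longrightarrow> of_real ?r * (?v s * of_real (sin (?r * s))) + ?u s * of_real (cos (?r * s)) = b"
    by (rule has_vector_derivative_zero_constant[OF convex_UNIV]) blast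
  from this[of 0] this[of s]
  have 2: "of_real ?r * (?v s * of_real (sin (?r * s))) + ?u s * of_real (cos (?r * s)) = 1"
    by (simp add: kernel_initial)
  have sc: "(of_real (sin (?r * s)))\<^sup>2 + (of_real (cos (?r * s)))\<^sup>2 = (1::complex)"
    unfolding of_real_power[symmetric] of_real_add[symmetric] by simp
  let ?S = "of_real (sin (?r * s)) :: complex" and ?C = "of_real (cos (?r * s)) :: complex"
  have "of_real ?r * ?v s = ?S"
  proof -
    have "of_real ?r * ?v s = of_real ?r * ?v s * (?S\<^sup>2 + ?C\<^sup>2)" by (simp add: sc)
    also have "\<dots> = ?S * (of_real ?r * (?v s * ?S)) + ?C * (of_real ?r * (?v s * ?C))" by algebra
    also have "\<dots> = ?S * (of_real ?r * (?v s * ?S)) + ?C * (?u s * ?S)" by (simp only: 1)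
    also have "\<dots> = ?S * (of_real ?r * (?v s * ?S) + ?u s * ?C)" by algebra
    finally show ?thesis by (simp add: 2)
  qed
  then show "?v s = of_real (sin (?r * s) / ?r)"
    using r by (simp add: field_simps)
  have "?u s = ?u s * (?S\<^sup>2 + ?C\<^sup>2)" by (simp add: sc)
  also have "\<dots> = ?S * (?u s * ?S) + ?C * (?u s * ?C)" by algebra
  also have "\<dots> = ?S * (of_real ?r * (?v s * ?C)) + ?C * (?u s * ?C)" by (simp only: 1)
  also have "\<dots> = ?C * (of_real ?r * (?v s * ?S) + ?u s * ?C)" by algebra
  finally show "?u s = ?C" by (simp add: 2)
qed

lemma xi_sinc_kernel:
  "of_real \<xi> * sinc_kernel m \<xi> s = of_real (sin (\<xi> * s))
     + atom (\<lambda>w. \<i> / 2 * of_real (m\<^sup>2 * chord w)) 2 1 (cone m) chord \<xi> s"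
proof -
  have "atom (\<lambda>w. \<i> / 2 * of_real (m\<^sup>2 * chord w)) 2 1 (cone m) chord \<xi> s
     = - atom (\<lambda>w. (\<i> / 2 + 0 * of_real w) * of_real (m\<^sup>2 * (1 - 2 * w))) 2 1 (cone m) chord \<xi> s"
    using atom_cmult[of "-1" "\<lambda>w. (\<i> / 2 + 0 * of_real w) * of_real (m\<^sup>2 * (1 - 2 * w))" 2 1 "cone m" chord \<xi> s]
    by (simp add: algebra_simps)
  then show ?thesis
    using atom_parts_0[of "\<i> / 2" m \<xi> s] by (simp add: algebra_simps)
qed

text \<open>The amplitude of an atom, without its wave factor.\<close>

abbreviation amp :: "(real \<Rightarrow> complex) \<Rightarrow> nat \<Rightarrow> nat \<Rightarrow> (real \<Rightarrow> real) \<Rightarrow> real \<Rightarrow> real \<Rightarrow> complex" where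
  "amp q j k c s w \<equiv> q w * of_real (s ^ j * bes k (c w * s\<^sup>2))"

text \<open>Finite speed of propagation as a relation between a Fourier multiplier M(\<xi>,s) and an operator N on
functions of position: replacing each wave exp(-i\<xi>s\<alpha>) in M by translation by s\<alpha> yields N. The bound
|\<alpha>| \<le> 1 is the speed limit. The zero set of \<alpha> is finite so that the waves emitted from the boundary
oscillate in time for almost every w, as is required by the Riemann-Lebesgue argument in atom_source. The relation is inductive
so that properties of multipliers can be reduced to single atoms and sums of them.\<close>

inductive propagator ::
    "(real \<Rightarrow> real \<Rightarrow> complex) \<Rightarrow> ((real \<Rightarrow> complex) \<Rightarrow> real \<Rightarrow> real \<Rightarrow> complex) \<Rightarrow> bool" where
  atom: "continuous_on {0..1} q \<Longrightarrow> continuous_on {0..1} c \<Longrightarrow> continuous_on {0..1} \<alpha> \<Longrightarrow>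
     \<alpha> ` {0..1} \<subseteq> {-1..1} \<Longrightarrow> finite {w\<in>{0..1}. \<alpha> w = 0} \<Longrightarrow>
     propagator (atom q j k c \<alpha>) (\<lambda>g s x. integral {0..1} (\<lambda>w. amp q j k c s w * g (x - s * \<alpha> w)))"
| add: "propagator M N \<Longrightarrow> propagator M' N' \<Longrightarrow>
     propagator (\<lambda>\<xi> s. M \<xi> s + M' \<xi> s) (\<lambda>g s x. N g s x + N' g s x)"

lemma propagator_cmult: "propagator M N \<Longrightarrow> \<exists>N. propagator (\<lambda>\<xi> s. a * M \<xi> s) N"
proof (induction rule: propagator.induct)
  case (atom q c \<alpha> j k)
  then have "propagator (atom (\<lambda>w. a * q w) j k c \<alpha>)
      (\<lambda>g s x. integral {0..1} (\<lambda>w. amp (\<lambda>w. a * q w) j k c s w * g (x - s * \<alpha> w)))"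
    by (intro propagator.atom continuous_intros)
  then show ?case
    unfolding atom_cmult by blast
next
  case (add M N M' N')
  then show ?case
    unfolding distrib_left by (elim exE) (rule exI, rule propagator.add)
qed

lemma propagator_add:
  "\<exists>N. propagator M N \<Longrightarrow> \<exists>N. propagator M' N \<Longrightarrow> \<exists>N. propagator (\<lambda>\<xi> s. M \<xi> s + M' \<xi> s) N"
  by (elim exE) (rule exI, rule propagator.add)

lemma propagator_chord:
  assumes "continuous_on {0..1} q" shows "\<exists>N. propagator (atom q j k (cone m) chord) N"
proof -
  have "{w \<in> {0..1}. chord w = 0} \<subseteq> {1/2}" by auto
  then have "finite {w \<in> {0..1}. chord w = 0}" by (rule finite_subset) simp
  with assms have "propagator (atom q j k (cone m) chord)
      (\<lambda>g s x. integral {0..1} (\<lambda>w. amp q j k (cone m) s w * g (x - s * chord w)))"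
    by (intro propagator.atom continuous_intros) auto
  then show ?thesis by blast
qed

lemma propagator_cis:
  "\<exists>N. propagator (\<lambda>\<xi> s. a * cis (- (\<xi> * s))) N" "\<exists>N. propagator (\<lambda>\<xi> s. a * cis (\<xi> * s)) N"
proof -
  have "propagator (atom (\<lambda>w. a) 0 0 (\<lambda>w. 0) (\<lambda>w. b))
      (\<lambda>g s x. integral {0..1} (\<lambda>w. amp (\<lambda>w. a) 0 0 (\<lambda>w. 0) s w * g (x - s * b)))" if "b \<in> {-1, 1}" for b
    using that by (intro propagator.atom continuous_intros) auto
  from this[of 1] this[of "-1"] show "\<exists>N. propagator (\<lambda>\<xi> s. a * cis (- (\<xi> * s))) N"
      "\<exists>N. propagator (\<lambda>\<xi> s. a * cis (\<xi> * s)) N"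
    by (auto simp: atom_trivial[abs_def])
qed

lemma propagator_cos:
  "\<exists>M N. propagator M N \<and> (\<forall>\<xi> s. \<xi> \<noteq> 0 \<longrightarrow> M \<xi> s = of_real (cos (rho m \<xi> * s)))"
proof -
  have "of_real (cos (\<xi> * s)) = 1 / 2 * cis (- (\<xi> * s)) + 1 / 2 * cis (\<xi> * s)" for \<xi> s
    by (auto simp: complex_eq_iff)
  then have "\<exists>N. propagator (cos_kernel m) N"
    unfolding cos_kernel_def[abs_def]
    by (simp only:) (intro propagator_add propagator_cis propagator_chord continuous_intros)
  then show ?thesis
    using sinc_kernel_eq(2) by blast
qed

lemma propagator_sinc:
  "\<exists>M N. propagator M N \<and> (\<forall>\<xi> s. \<xi> \<noteq> 0 \<longrightarrow> M \<xi> s = of_real (sin (rho m \<xi> * s) / rho m \<xi>))"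
proof -
  have "\<exists>N. propagator (sinc_kernel m) N"
    unfolding sinc_kernel_def by (intro propagator_chord continuous_intros)
  then show ?thesis
    using sinc_kernel_eq(1) by blast
qed

lemma propagator_xi_sinc:
  "\<exists>M N. propagator M N \<and> (\<forall>\<xi> s. \<xi> \<noteq> 0 \<longrightarrow> M \<xi> s = of_real (\<xi> * sin (rho m \<xi> * s) / rho m \<xi>))"
proof -
  have "of_real (sin (\<xi> * s)) = \<i> / 2 * cis (- (\<xi> * s)) + - \<i> / 2 * cis (\<xi> * s)" for \<xi> s
    by (auto simp: complex_eq_iff)
  then have "\<exists>N. propagator (\<lambda>\<xi> s. of_real \<xi> * sinc_kernel m \<xi> s) N"
    unfolding xi_sinc_kernel
    by (simp only:) (intro propagator_add propagator_cis propagator_chord continuous_intros)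
  moreover have "of_real \<xi> * sinc_kernel m \<xi> s = of_real (\<xi> * sin (rho m \<xi> * s) / rho m \<xi>)" if "\<xi> \<noteq> 0" for \<xi> s
    using sinc_kernel_eq(1)[OF that, of m s] by simp
  ultimately show ?thesis by blast
qed

section \<open>Half-line Fourier transforms\<close>

text \<open>The constant is explicit because the estimates below have to be uniform over families of functions,
such as the time slices of a forcing term.\<close>

definition decay2 :: "real \<Rightarrow> (real \<Rightarrow> complex) \<Rightarrow> bool" where
  "decay2 C g \<longleftrightarrow> continuous_on {0..} g \<and> (\<forall>y\<ge>0. norm (g y) \<le> C / (1 + y\<^sup>2))"

lemma decay2_nonneg: "decay2 C g \<Longrightarrow> C \<ge> 0"
  unfolding decay2_def by (metis add.right_neutral div_by_1 norm_ge_zero order_refl order_trans power_zero_numeral)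

lemma decay2_norm_le: "decay2 C g \<Longrightarrow> y \<ge> 0 \<Longrightarrow> norm (g y) \<le> C"
proof -
  assume g: "decay2 C g" and y: "y \<ge> 0"
  have "C / (1 + y\<^sup>2) \<le> C / 1"
    using decay2_nonneg[OF g] by (intro divide_left_mono) (auto simp: add_pos_nonneg)
  with g y show ?thesis
    unfolding decay2_def by force
qed

lemma decay2_mult:
  assumes "decay2 C g" "continuous_on {0..} h" "\<And>y. y \<ge> 0 \<Longrightarrow> norm (h y) \<le> B"
  shows "decay2 (B * C) (\<lambda>y. h y * g y)"
  unfolding decay2_def
proof (intro conjI allI impI continuous_intros)
  fix y :: real assume "y \<ge> 0"
  then have "norm (h y) * norm (g y) \<le> B * (C / (1 + y\<^sup>2))"
    using assms by (intro mult_mono) (auto simp: decay2_def intro: order_trans[OF norm_ge_zero])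
  then show "norm (h y * g y) \<le> B * C / (1 + y\<^sup>2)"
    by (simp add: norm_mult)
qed (use assms in \<open>auto simp: decay2_def\<close>)

lemma inverse_square_integrable: "set_integrable lborel {0..} (\<lambda>y::real. C / (1 + y\<^sup>2))"
  and inverse_square_integral: "(LBINT y:{0..}. C / (1 + y\<^sup>2)) = C * (pi / 2)"
proof -
  have "set_integrable lborel {0<..} (\<lambda>y::real. 1 / (1 + y\<^sup>2))"
    using integrable_I0i_1_div_plus_square
    by (simp add: interval_lebesgue_integral_0_infty)
  then have "set_integrable lborel {0..} (\<lambda>y::real. 1 / (1 + y\<^sup>2))"
    unfolding set_integrable_def
    by (rule integrable_cong_AE_imp) (auto intro!: AE_I[where N="{0}"] split: split_indicator)
  then show "set_integrable lborel {0..} (\<lambda>y::real. C / (1 + y\<^sup>2))"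
    using set_integrable_mult_right[of C lborel "{0..}" "\<lambda>y. 1 / (1 + y\<^sup>2)"] by simp
  have "(LBINT y:{0..}. 1 / (1 + y\<^sup>2)) = (LBINT y:{0<..}. 1 / (1 + (y::real)\<^sup>2))"
    unfolding set_lebesgue_integral_def
    by (rule integral_cong_AE) (auto intro!: AE_I[where N="{0}"] split: split_indicator)
  also have "\<dots> = pi / 2"
    using LBINT_I0i_1_div_plus_square by (simp add: interval_lebesgue_integral_0_infty)
  finally show "(LBINT y:{0..}. C / (1 + y\<^sup>2)) = C * (pi / 2)"
    using set_integral_mult_right[of lborel "{0..}" C "\<lambda>y. 1 / (1 + y\<^sup>2)"] by simp
qed

lemma decay2_integrable:
  assumes "decay2 C g" shows "set_integrable lborel {0..} g"
  unfolding set_integrable_def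
proof (rule Bochner_Integration.integrable_bound)
  show "integrable lborel (\<lambda>y. indicator {0..} y *\<^sub>R (C / (1 + y\<^sup>2)))"
    using inverse_square_integrable by (simp add: set_integrable_def)
  show "(\<lambda>y. indicator {0..} y *\<^sub>R g y) \<in> borel_measurable lborel"
    using borel_measurable_continuous_on_indicator[of "{0..}" g] assms by (simp add: decay2_def)
  show "AE y in lborel. norm (indicator {0..} y *\<^sub>R g y) \<le> norm (indicator {0..} y *\<^sub>R (C / (1 + y\<^sup>2)))"
    using assms decay2_nonneg[OF assms]
    by (auto simp: decay2_def split: split_indicator)
qed

lemma decay2_integral_norm:
  assumes "decay2 C g" shows "(LBINT y:{0..}. norm (g y)) \<le> 2 * C"
    and "norm (LBINT y:{0..}. g y) \<le> 2 * C"
proof -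
  have "(LBINT y:{0..}. norm (g y)) \<le> (LBINT y:{0..}. C / (1 + y\<^sup>2))"
    using assms decay2_integrable[OF assms] inverse_square_integrable
    by (intro set_integral_mono set_integrable_norm) (auto simp: decay2_def)
  also have "\<dots> \<le> 2 * C"
    using mult_left_mono[of "pi / 2" 2 C] pi_half_less_two decay2_nonneg[OF assms]
    by (simp only: inverse_square_integral) simp
  finally show 1: "(LBINT y:{0..}. norm (g y)) \<le> 2 * C" .
  have "norm (LBINT y:{0..}. g y) \<le> (LBINT y:{0..}. norm (g y))"
    by (rule set_integral_norm_bound) (rule decay2_integrable[OF assms])
  with 1 show "norm (LBINT y:{0..}. g y) \<le> 2 * C" by linarith
qed

lemma decay2_tendsto:
  assumes "decay2 C g"
  shows "((\<lambda>N. integral {0..N} g) \<longlongrightarrow> (LBINT y:{0..}. g y)) at_top"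
    and "(g \<longlongrightarrow> 0) at_top"
proof -
  have "((\<lambda>N. LBINT y:{0..N}. g y) \<longlongrightarrow> (LBINT y:{0..}. g y)) at_top"
    by (intro tendsto_set_lebesgue_integral_at_top decay2_integrable[OF assms]) auto
  moreover have "(LBINT y:{0..N}. g y) = integral {0..N} g" for N
    by (intro set_borel_integral_eq_integral borel_integrable_atLeastAtMost')
       (use assms in \<open>auto simp: decay2_def intro: continuous_on_subset\<close>)
  ultimately show "((\<lambda>N. integral {0..N} g) \<longlongrightarrow> (LBINT y:{0..}. g y)) at_top"
    by simp
  have "((\<lambda>y. C / (1 + y\<^sup>2)) \<longlongrightarrow> 0) at_top"
    by real_asymp
  then show "(g \<longlongrightarrow> 0) at_top"
    by (rule Lim_null_comparison[rotated])
       (use assms in \<open>auto simp: decay2_def intro!: eventually_at_top_linorderI[of 0]\<close>)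
qed

text \<open>Dominated convergence with the common majorant C/(1 + y^2).\<close>

lemma continuous_on_decay2_integral:
  fixes F :: "'a::metric_space \<Rightarrow> real \<Rightarrow> complex"
  assumes "\<And>p. p \<in> S \<Longrightarrow> decay2 C (F p)" "\<And>y. y \<ge> 0 \<Longrightarrow> continuous_on S (\<lambda>p. F p y)"
  shows "continuous_on S (\<lambda>p. LBINT y:{0..}. F p y)"
  unfolding continuous_on_sequentially
proof (intro allI ballI impI, elim conjE)
  fix X p assume p: "p \<in> S" and X: "\<forall>n. X n \<in> S" "X \<longlonglongrightarrow> p"
  show "((\<lambda>p. LBINT y:{0..}. F p y) \<circ> X) \<longlonglongrightarrow> (LBINT y:{0..}. F p y)"
    unfolding o_def set_lebesgue_integral_def
  proof (rule integral_dominated_convergence)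
    show "integrable lborel (\<lambda>y. indicator {0..} y *\<^sub>R (C / (1 + y\<^sup>2)))"
      using inverse_square_integrable by (simp add: set_integrable_def)
    show "(\<lambda>y. indicator {0..} y *\<^sub>R F p y) \<in> borel_measurable lborel"
      "\<And>n. (\<lambda>y. indicator {0..} y *\<^sub>R F (X n) y) \<in> borel_measurable lborel"
      using decay2_integrable[OF assms(1)] p X(1) by (auto simp: set_integrable_def)
    show "AE y in lborel. norm (indicator {0..} y *\<^sub>R F (X n) y) \<le> indicator {0..} y *\<^sub>R (C / (1 + y\<^sup>2))" for n
      using assms(1)[of "X n"] X(1) by (auto simp: decay2_def split: split_indicator)
    show "AE y in lborel. (\<lambda>n. indicator {0..} y *\<^sub>R F (X n) y) \<longlonglongrightarrow> indicator {0..} y *\<^sub>R F p y"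
    proof (intro AE_I2)
      fix y :: real
      have "(\<lambda>n. F (X n) y) \<longlonglongrightarrow> F p y" if "y \<ge> 0"
        using assms(2)[OF that] p X by (auto simp: continuous_on_sequentially o_def)
      then show "(\<lambda>n. indicator {0..} y *\<^sub>R F (X n) y) \<longlonglongrightarrow> indicator {0..} y *\<^sub>R F p y"
        by (cases "y \<ge> 0") (auto simp: tendsto_intros)
    qed
  qed
qed

lemma integral_decay2_swap:
  fixes F :: "real \<Rightarrow> real \<Rightarrow> complex"
  assumes dec: "\<And>p. p \<in> {a..b} \<Longrightarrow> decay2 C (F p)"
    and cont: "continuous_on ({a..b} \<times> {0..}) (\<lambda>(p, y). F p y)"
  shows "integral {a..b} (\<lambda>p. LBINT y:{0..}. F p y) = (LBINT y:{0..}. integral {a..b} (\<lambda>p. F p y))"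
proof -
  have c1: "continuous_on {a..b} (\<lambda>p. F p y)" if "y \<ge> 0" for y
    by (rule continuous_on_compose2[OF cont, of _ "\<lambda>p. (p, y)", simplified])
       (use that in \<open>auto intro!: continuous_intros\<close>)
  have c2: "continuous_on {a..b} (\<lambda>p. LBINT y:{0..}. F p y)"
    by (rule continuous_on_decay2_integral[OF dec c1])
  let ?G = "\<lambda>p y. indicator ({a..b} \<times> {0..}) (p, y) *\<^sub>R F p y"
  have G: "?G p y = indicator {a..b} p *\<^sub>R (indicator {0..} y *\<^sub>R F p y)" for p y
    by (simp add: indicator_times)
  have meas: "(\<lambda>(p, y). ?G p y) \<in> borel_measurable (lborel \<Otimes>\<^sub>M lborel)"
    using borel_measurable_continuous_on_indicator[OF _ cont] 
    by (simp add: case_prod_unfold lborel_prod borel_closed closed_Times)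
  have int: "integrable (lborel \<Otimes>\<^sub>M lborel) (\<lambda>(p, y). ?G p y)"
  proof (rule lborel_pair.Fubini_integrable[OF meas])
    show "AE p in lborel. integrable lborel (\<lambda>y. case (p, y) of (p, y) \<Rightarrow> ?G p y)"
      using decay2_integrable[OF dec] unfolding G
      by (auto simp: set_integrable_def split: split_indicator)
    show "integrable lborel (\<lambda>p. LBINT y. norm (case (p, y) of (p, y) \<Rightarrow> ?G p y))"
    proof (rule Bochner_Integration.integrable_bound)
      show "integrable lborel (\<lambda>p. indicator {a..b} p *\<^sub>R (2 * C))"
        using borel_integrable_atLeastAtMost'[of a b "\<lambda>p. 2 * C"] by (simp add: set_integrable_def)
      show "(\<lambda>p. LBINT y. norm (case (p, y) of (p, y) \<Rightarrow> ?G p y)) \<in> borel_measurable lborel"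
        using measurable_compose[OF meas borel_measurable_norm]
        by (intro lborel.borel_measurable_lebesgue_integral) (simp add: case_prod_unfold)
      have "norm (LBINT y. norm (?G p y)) \<le> norm (indicator {a..b} p *\<^sub>R (2 * C))" for p
        using decay2_integral_norm(1)[OF dec, of p] decay2_nonneg[OF dec, of p] unfolding G
        by (auto simp: set_lebesgue_integral_def split: split_indicator)
      then show "AE p in lborel. norm (LBINT y. norm (case (p, y) of (p, y) \<Rightarrow> ?G p y)) \<le> norm (indicator {a..b} p *\<^sub>R (2 * C))"
        by simp
    qed
  qed
  have "integral {a..b} (\<lambda>p. LBINT y:{0..}. F p y) = (LBINT p:{a..b}. LBINT y:{0..}. F p y)"
    by (intro set_borel_integral_eq_integral(2)[symmetric] borel_integrable_atLeastAtMost' c2)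
  also have "\<dots> = (LBINT p. LBINT y. ?G p y)"
    unfolding G set_lebesgue_integral_def
    by (intro Bochner_Integration.integral_cong refl) (simp split: split_indicator)
  also have "\<dots> = (LBINT y. LBINT p. ?G p y)"
    using lborel_pair.Fubini_integral[OF int] by simp
  also have "\<dots> = (LBINT y:{0..}. LBINT p:{a..b}. F p y)"
    unfolding set_lebesgue_integral_def by (auto intro!: Bochner_Integration.integral_cong simp: indicator_times split: split_indicator)
  also have "\<dots> = (LBINT y:{0..}. integral {a..b} (\<lambda>p. F p y))"
    by (intro set_lebesgue_integral_cong) (auto intro!: set_borel_integral_eq_integral(2) borel_integrable_atLeastAtMost' c1)
  finally show ?thesis .
qed

lemma half_ft_cis: "half_ft g \<xi> = (LBINT y:{0..}. cis (- (\<xi> * y)) * g y)"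
  by (simp add: half_ft_def cis_conv_exp mult.assoc)

lemma decay2_cis: "decay2 C g \<Longrightarrow> decay2 C (\<lambda>y. cis (- (\<xi> * y)) * g y)"
  using decay2_mult[of C g "\<lambda>y. cis (- (\<xi> * y))" 1] by (simp add: continuous_intros)

lemma half_ft_bound: "decay2 C g \<Longrightarrow> norm (half_ft g \<xi>) \<le> 2 * C"
  unfolding half_ft_cis by (intro decay2_integral_norm decay2_cis)

lemma continuous_on_half_ft:
  assumes "\<And>\<tau>. \<tau> \<in> T \<Longrightarrow> decay2 C (f \<tau>)" "\<And>y. y \<ge> 0 \<Longrightarrow> continuous_on T (\<lambda>\<tau>. f \<tau> y)"
  shows "continuous_on (UNIV \<times> T) (\<lambda>(\<xi>, \<tau>::real). half_ft (f \<tau>) \<xi>)"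
  unfolding half_ft_cis case_prod_unfold
proof (rule continuous_on_decay2_integral)
  show "decay2 C (\<lambda>y. cis (- (fst p * y)) * f (snd p) y)" if "p \<in> UNIV \<times> T" for p
    using that by (auto intro!: decay2_cis[OF assms(1)])
  show "continuous_on (UNIV \<times> T) (\<lambda>p. cis (- (fst p * y)) * f (snd p) y)" if "y \<ge> 0" for y
    by (intro continuous_intros continuous_on_compose2[OF assms(2)[OF that]]) auto
qed

lemma continuous_on_half_ft_UNIV: "decay2 C g \<Longrightarrow> continuous_on UNIV (half_ft g)"
  unfolding half_ft_cis[abs_def]
  by (rule continuous_on_decay2_integral[of _ C]) (auto intro!: decay2_cis continuous_intros)

definition decay2_C1 :: "real \<Rightarrow> (real \<Rightarrow> complex) \<Rightarrow> (real \<Rightarrow> complex) \<Rightarrow> bool" where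
  "decay2_C1 C g g' \<longleftrightarrow> decay2 C g \<and> decay2 C g' \<and> (\<forall>y\<ge>0. (g has_vector_derivative g' y) (at y within {0..}))"

text \<open>Integration by parts over the half-line. The primitive h of the oscillating factor only has to be bounded, so the boundary term at
infinity vanishes by the decay of g.\<close>

lemma half_line_parts:
  assumes g: "decay2_C1 C g g'"
    and h: "\<And>y. (h has_vector_derivative h' y) (at y)" "continuous_on UNIV h'"
      "\<And>y. y \<ge> 0 \<Longrightarrow> norm (h y) \<le> B" "\<And>y. y \<ge> 0 \<Longrightarrow> norm (h' y) \<le> B"
  shows "(LBINT y:{0..}. h' y * g y) = - (h 0 * g 0) - (LBINT y:{0..}. h y * g' y)"
proof -
  have ch: "continuous_on {0..} h" "continuous_on {0..} h'"
    using has_vector_derivative_continuous[OF h(1)] continuous_on_subset[OF h(2)]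
    by (auto intro: continuous_at_imp_continuous_on)
  have d: "decay2 (B * C) (\<lambda>y. h' y * g y)" "decay2 (B * C) (\<lambda>y. h y * g' y)" "decay2 (B * C) (\<lambda>y. h y * g y)"
    using g h ch unfolding decay2_C1_def by (auto intro!: decay2_mult)
  have "integral {0..N} (\<lambda>y. h' y * g y) + integral {0..N} (\<lambda>y. h y * g' y) = h N * g N - h 0 * g 0" if "N \<ge> 0" for N
  proof -
    have "((\<lambda>y. h y * g' y + h' y * g y) has_integral h N * g N - h 0 * g 0) {0..N}"
    proof (rule fundamental_theorem_of_calculus[OF that])
      fix y assume y: "y \<in> {0..N}"
      then have "(g has_vector_derivative g' y) (at y within {0..N})"
        using g unfolding decay2_C1_def by (auto intro: has_vector_derivative_within_subset)
      moreover have "(h has_vector_derivative h' y) (at y within {0..N})"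
        using h(1) by (rule has_vector_derivative_at_within)
      ultimately show "((\<lambda>y. h y * g y) has_vector_derivative h y * g' y + h' y * g y) (at y within {0..N})"
        by (intro has_vector_derivative_mult)
    qed
    moreover have "(\<lambda>y. h' y * g y) integrable_on {0..N}" "(\<lambda>y. h y * g' y) integrable_on {0..N}"
      using d by (auto intro!: integrable_continuous_interval simp: decay2_def intro: continuous_on_subset)
    ultimately show ?thesis
      using integral_add[of "\<lambda>y. h y * g' y" "{0..N}" "\<lambda>y. h' y * g y"] by (simp add: integral_unique)
  qed
  then have "\<forall>\<^sub>F N in at_top. integral {0..N} (\<lambda>y. h' y * g y) + integral {0..N} (\<lambda>y. h y * g' y) = h N * g N - h 0 * g 0"
    by (auto intro: eventually_at_top_linorderI[of 0])
  moreover have "((\<lambda>N. integral {0..N} (\<lambda>y. h' y * g y) + integral {0..N} (\<lambda>y. h y * g' y)) \<longlongrightarrow>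
      (LBINT y:{0..}. h' y * g y) + (LBINT y:{0..}. h y * g' y)) at_top"
    by (intro tendsto_add decay2_tendsto(1)[OF d(1)] decay2_tendsto(1)[OF d(2)])
  moreover have "((\<lambda>N. h N * g N - h 0 * g 0) \<longlongrightarrow> 0 - h 0 * g 0) at_top"
    by (intro tendsto_diff tendsto_const decay2_tendsto(2)[OF d(3)])
  ultimately have "(LBINT y:{0..}. h' y * g y) + (LBINT y:{0..}. h y * g' y) = 0 - h 0 * g 0"
    by (intro tendsto_unique[OF trivial_limit_at_top_linorder]) (simp_all only: tendsto_cong)
  then show ?thesis
    by (simp add: algebra_simps eq_neg_iff_add_eq_0)
qed

lemma half_ft_parts:
  assumes g: "decay2_C1 C g g'" and "\<xi> \<noteq> 0"
  shows "half_ft g \<xi> = (g 0 + half_ft g' \<xi>) / (\<i> * of_real \<xi>)"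
proof -
  let ?h = "\<lambda>y. cis (- (\<xi> * y)) / (- \<i> * of_real \<xi>)"
  have "(LBINT y:{0..}. cis (- (\<xi> * y)) * g y) = - (?h 0 * g 0) - (LBINT y:{0..}. ?h y * g' y)"
  proof (rule half_line_parts[OF g, where B="1 + 1 / \<bar>\<xi>\<bar>"])
    show "(?h has_vector_derivative cis (- (\<xi> * y))) (at y)" for y
    proof -
      have "((\<lambda>y. cis (- (\<xi> * y))) has_vector_derivative \<i> * of_real (- \<xi>) * cis (- (\<xi> * y))) (at y)"
        by (rule has_vector_derivative_cis) (auto intro!: derivative_eq_intros)
      from has_vector_derivative_divide[OF this, of "- \<i> * of_real \<xi>"] show ?thesis
        using assms by simp
    qed
  qed (use assms in \<open>auto intro!: continuous_intros simp: norm_divide norm_mult divide_simps\<close>)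
  moreover have "(LBINT y:{0..}. ?h y * g' y) = half_ft g' \<xi> / (- \<i> * of_real \<xi>)"
    unfolding half_ft_cis using set_integral_divide_zero[of lborel "{0..}" "\<lambda>y. cis (- (\<xi> * y)) * g' y" "- \<i> * of_real \<xi>"]
    by (simp add: divide_simps)
  ultimately show ?thesis
    unfolding half_ft_cis[of g] using assms by (simp add: field_simps)
qed

lemma half_ft_bound_inverse:
  assumes g: "decay2_C1 C g g'" and "\<xi> \<noteq> 0"
  shows "norm (half_ft g \<xi>) \<le> 3 * C / \<bar>\<xi>\<bar>"
proof -
  have "norm (g 0 + half_ft g' \<xi>) \<le> C + 2 * C"
    using g unfolding decay2_C1_def by (intro order_trans[OF norm_triangle_ineq] add_mono decay2_norm_le half_ft_bound) auto
  then show ?thesis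
    unfolding half_ft_parts[OF assms] by (simp add: norm_divide norm_mult divide_right_mono)
qed

section \<open>Fourier inversion on the half-line\<close>

text \<open>The Dirichlet kernel, written with sinc so that v = 0 is included.\<close>

lemma integral_cis:
  assumes "A \<ge> 0"
  shows "integral {-A..A} (\<lambda>\<xi>. cis (\<xi> * v)) = of_real (2 * (A * sinc (A * v)))"
proof (cases "v = 0")
  case True
  then show ?thesis using assms by (simp add: scaleR_conv_of_real)
next
  case False
  have "((\<lambda>\<xi>. cis (\<xi> * v)) has_integral cis (A * v) / (\<i> * of_real v) - cis (- A * v) / (\<i> * of_real v)) {-A..A}"
  proof (rule fundamental_theorem_of_calculus)
    fix \<xi>
    have "((\<lambda>\<xi>. cis (\<xi> * v)) has_vector_derivative \<i> * of_real v * cis (\<xi> * v)) (at \<xi> within {-A..A})"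
      by (rule has_vector_derivative_cis) (auto intro!: derivative_eq_intros)
    from has_vector_derivative_divide[OF this, of "\<i> * of_real v"]
    show "((\<lambda>\<xi>. cis (\<xi> * v) / (\<i> * of_real v)) has_vector_derivative cis (\<xi> * v)) (at \<xi> within {-A..A})"
      using False by simp
  qed (use assms in auto)
  moreover have "cis (A * v) / (\<i> * of_real v) - cis (- A * v) / (\<i> * of_real v) = of_real (2 * (A * sinc (A * v)))"
    using False cis_minus[of "A * v"]
    by (simp add: diff_divide_distrib[symmetric] minus_diff_commute field_simps)
  ultimately show ?thesis by (simp add: integral_unique)
qed

text \<open>The truncated inversion integral is the convolution of g with the Dirichlet kernel, which is a
derivative of the sine integral Si. Integrating by parts moves that derivative to g and leaves the bounded
function Si, for which both uniform bounds and the limit are immediate.\<close>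

lemma half_ft_partial_inversion:
  assumes g: "decay2_C1 C g g'" and A: "A \<ge> 0"
  shows "integral {-A..A} (\<lambda>\<xi>. cis (\<xi> * y) * half_ft g \<xi>)
     = 2 * (of_real (Si (A * y)) * g 0 + (LBINT u:{0..}. of_real (Si (A * (y - u))) * g' u))"
proof -
  have gd: "decay2 C g" and gc: "continuous_on {0..} g"
    using g by (auto simp: decay2_C1_def decay2_def)
  obtain B where B: "\<And>T. \<bar>Si T\<bar> \<le> B"
    using bounded_Si by blast
  have "integral {-A..A} (\<lambda>\<xi>. cis (\<xi> * y) * half_ft g \<xi>)
      = integral {-A..A} (\<lambda>\<xi>. LBINT u:{0..}. cis (\<xi> * y) * (cis (- (\<xi> * u)) * g u))"
    by (simp add: half_ft_cis)
  also have "\<dots> = (LBINT u:{0..}. integral {-A..A} (\<lambda>\<xi>. cis (\<xi> * y) * (cis (- (\<xi> * u)) * g u)))"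
  proof (rule integral_decay2_swap)
    show "decay2 (1 * C) (\<lambda>u. cis (\<xi> * y) * (cis (- (\<xi> * u)) * g u))" for \<xi>
      by (rule decay2_mult[OF decay2_cis[OF gd]]) (auto intro: continuous_intros)
    show "continuous_on ({- A..A} \<times> {0..}) (\<lambda>(\<xi>, u). cis (\<xi> * y) * (cis (- (\<xi> * u)) * g u))"
      unfolding case_prod_unfold by (intro continuous_intros continuous_on_compose2[OF gc]) auto
  qed
  also have "\<dots> = (LBINT u:{0..}. - 2 * (of_real (- (A * sinc (A * (y - u)))) * g u))"
  proof -
    have "integral {-A..A} (\<lambda>\<xi>. cis (\<xi> * y) * (cis (- (\<xi> * u)) * g u)) = - 2 * (of_real (- (A * sinc (A * (y - u)))) * g u)" for u
    proof -
      have "integral {-A..A} (\<lambda>\<xi>. cis (\<xi> * y) * (cis (- (\<xi> * u)) * g u)) = integral {-A..A} (\<lambda>\<xi>. cis (\<xi> * (y - u)) * g u)"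
        by (simp add: mult.assoc[symmetric] cis_mult right_diff_distrib)
      also have "\<dots> = integral {-A..A} (\<lambda>\<xi>. cis (\<xi> * (y - u))) * g u"
        by simp
      finally show ?thesis using integral_cis[OF A, of "y - u"] by simp
    qed
    then show ?thesis by (simp only:)
  qed
  also have "\<dots> = - 2 * (LBINT u:{0..}. of_real (- (A * sinc (A * (y - u)))) * g u)"
    by (rule set_integral_mult_right)
  also have "(LBINT u:{0..}. of_real (- (A * sinc (A * (y - u)))) * g u)
      = - (of_real (Si (A * (y - 0))) * g 0) - (LBINT u:{0..}. of_real (Si (A * (y - u))) * g' u)"
  \<comment> \<open>B bounds Si, and A bounds its derivative, as sinc is at most 1\<close>
  proof (rule half_line_parts[OF g, where B="B + A"])
    show "((\<lambda>u. of_real (Si (A * (y - u))) :: complex) has_vector_derivative of_real (- (A * sinc (A * (y - u))))) (at u)" for u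
      by (intro has_vector_derivative_of_real DERIV_cong[OF DERIV_chain2[OF DERIV_Si]])
         (auto intro!: derivative_eq_intros simp del: sinc_neg)
    show "continuous_on UNIV (\<lambda>u. of_real (- (A * sinc (A * (y - u)))) :: complex)"
      by (intro continuous_intros)
    show "norm (of_real (Si (A * (y - u))) :: complex) \<le> B + A" for u
      using B[of "A * (y - u)"] A by simp
    have "\<bar>sinc v\<bar> \<le> 1" for v
      using abs_sin_le_one[of v] abs_sin_x_le_abs_x[of v] by (auto simp: divide_simps)
    from mult_left_mono[OF this A]
    have "A * \<bar>sinc v\<bar> \<le> B + A" for v
      using B[of 0] by (smt (verit) abs_ge_zero mult.right_neutral)
    then show "norm (of_real (- (A * sinc (A * (y - u)))) :: complex) \<le> B + A" for u
      unfolding norm_of_real abs_minus_cancel abs_mult using A by (simp only: abs_of_nonneg)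
  qed
  finally show ?thesis by simp
qed

lemma half_ft_partial_inversion_bound:
  "\<exists>K. \<forall>C g g' A y. decay2_C1 C g g' \<longrightarrow> A \<ge> 0 \<longrightarrow> norm (integral {-A..A} (\<lambda>\<xi>. cis (\<xi> * y) * half_ft g \<xi>)) \<le> K * C"
proof -
  obtain B where B: "\<And>T. \<bar>Si T\<bar> \<le> B"
    using bounded_Si by blast
  have half_sum_bound: "x \<le> 2 * (a + b) \<Longrightarrow> a \<le> z \<Longrightarrow> b \<le> 2 * z \<Longrightarrow> x \<le> 6 * z" for a b x z :: real
    using add_mono[of a z b "2 * z"] by argo
  have "norm (integral {-A..A} (\<lambda>\<xi>. cis (\<xi> * y) * half_ft g \<xi>)) \<le> (6 * B) * C" if g: "decay2_C1 C g g'" and A: "A \<ge> 0" for C g g' A y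
  proof -
    have "norm (of_real (Si (A * y)) * g 0) \<le> B * C"
      using g B[of "A * y"] unfolding norm_mult decay2_C1_def
      by (intro mult_mono) (auto intro: decay2_norm_le order_trans[OF abs_ge_zero])
    moreover have "norm (LBINT u:{0..}. of_real (Si (A * (y - u))) * g' u) \<le> 2 * (B * C)"
      using g B unfolding decay2_C1_def
      by (intro decay2_integral_norm decay2_mult)
         (auto intro!: continuous_at_imp_continuous_on isCont_o2[OF _ isCont_Si] continuous_intros)
    moreover have "norm (2 * (of_real (Si (A * y)) * g 0 + (LBINT u:{0..}. of_real (Si (A * (y - u))) * g' u)))
      \<le> 2 * (norm (of_real (Si (A * y)) * g 0) + norm (LBINT u:{0..}. of_real (Si (A * (y - u))) * g' u))"
      unfolding norm_mult[of 2] norm_numeral by (rule mult_left_mono[OF norm_triangle_ineq]) simp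
    ultimately show ?thesis
      unfolding half_ft_partial_inversion[OF g A] mult.assoc[of 6 B C]
      using half_sum_bound by blast
  qed
  then show ?thesis by blast
qed

lemma Si_at_top_scaled: 
  assumes "v \<noteq> 0" shows "((\<lambda>A. Si (A * v)) \<longlongrightarrow> sgn v * (pi / 2)) at_top"
proof (cases "v > 0")
  case True
  then have "filterlim (\<lambda>A. A * v) at_top at_top"
    by (intro filterlim_at_top_mult_tendsto_pos[OF tendsto_const]) (auto intro: filterlim_ident)
  from filterlim_compose[OF Si_at_top this] True show ?thesis by simp
next
  case False
  then have "filterlim (\<lambda>A. A * (- v)) at_top at_top"
    using assms by (intro filterlim_at_top_mult_tendsto_pos[OF tendsto_const]) (auto intro: filterlim_ident)
  from tendsto_minus[OF filterlim_compose[OF Si_at_top this]]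
  have "((\<lambda>A. - Si (- (A * v))) \<longlongrightarrow> - (pi / 2)) at_top" by simp
  moreover have "\<forall>\<^sub>F A in at_top. - Si (- (A * v)) = Si (A * v)"
  proof (rule eventually_at_top_linorderI)
    fix A :: real assume "A \<ge> 0"
    then have "0 \<le> - (A * v)" using False by (simp add: mult_nonneg_nonpos)
    from Si_neg[OF this] show "- Si (- (A * v)) = Si (A * v)" by simp
  qed
  ultimately have "((\<lambda>A. Si (A * v)) \<longlongrightarrow> - (pi / 2)) at_top"
    by (simp only: tendsto_cong)
  then show ?thesis
    using False assms by simp
qed

text \<open>As A tends to infinity, Si(Av) tends to sgn(v) \<pi>/2, so the representation by Si becomes the integral of g'
against a step function, which the fundamental theorem of calculus evaluates. The zero for y < 0 reflects that g is
extended by zero; at y = 0 the jump would give an average.\<close>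

lemma half_ft_inversion:
  assumes g: "decay2_C1 C g g'" and y: "y \<noteq> 0"
  shows "((\<lambda>A. integral {-A..A} (\<lambda>\<xi>. cis (\<xi> * y) * half_ft g \<xi>)) \<longlongrightarrow>
     (if y > 0 then of_real (2 * pi) * g y else 0)) at_top"
proof -
  obtain B where B: "\<And>T. \<bar>Si T\<bar> \<le> B"
    using bounded_Si by blast
  have gd: "decay2 C g'" and g0: "(g \<longlongrightarrow> 0) at_top"
    using g decay2_tendsto(2) by (auto simp: decay2_C1_def)
  let ?s = "\<lambda>u. of_real (sgn (y - u) * (pi / 2)) :: complex"
  have i: "set_integrable lborel {0..} g'"
    by (rule decay2_integrable[OF gd])
  have atLeastLessThan_subset: "{0..<y} \<subseteq> {0..}"
    by auto
  have ftc: "integral {a..b} g' = g b - g a" if "0 \<le> a" "a \<le> b" for a b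
    using that g unfolding decay2_C1_def
    by (intro integral_unique fundamental_theorem_of_calculus)
       (auto intro!: has_vector_derivative_within_subset[of g _ _ "{0..}" "{a..b}"])
  have ftc': "(LBINT u:{a..}. g' u) = - g a" if "a \<ge> 0" for a
  proof -
    have ia: "set_integrable lborel {a..} g'"
      by (rule set_integrable_subset[OF i]) (use that in auto)
    have "((\<lambda>N. LBINT u:{a..N}. g' u) \<longlongrightarrow> (LBINT u:{a..}. g' u)) at_top"
      by (intro tendsto_set_lebesgue_integral_at_top ia) auto
    moreover have "\<forall>\<^sub>F N in at_top. (LBINT u:{a..N}. g' u) = g N - g a"
    proof (rule eventually_at_top_linorderI)
      fix N assume "a \<le> N"
      have "set_integrable lborel {a..N} g'"
        by (rule set_integrable_subset[OF ia]) auto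
      then show "(LBINT u:{a..N}. g' u) = g N - g a"
        using ftc[OF that \<open>a \<le> N\<close>] by (simp add: set_borel_integral_eq_integral)
    qed
    moreover have "((\<lambda>N. g N - g a) \<longlongrightarrow> 0 - g a) at_top"
      by (intro tendsto_intros g0)
    ultimately have "(LBINT u:{a..}. g' u) = 0 - g a"
      by (intro tendsto_unique[OF trivial_limit_at_top_linorder]) (simp_all only: tendsto_cong)
    then show ?thesis by simp
  qed
  have "((\<lambda>A. LBINT u:{0..}. of_real (Si (A * (y - u))) * g' u) \<longlongrightarrow> (LBINT u:{0..}. ?s u * g' u)) at_top"
    unfolding set_lebesgue_integral_def
  proof (rule integral_dominated_convergence_at_top)
    have m [measurable]: "(\<lambda>u. indicator {0..} u *\<^sub>R g' u) \<in> borel_measurable lborel"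
      using i by (simp add: set_integrable_def)
    have "(\<lambda>u. ?s u * (indicator {0..} u *\<^sub>R g' u)) \<in> borel_measurable lborel"
      "(\<lambda>u. of_real (Si (A * (y - u))) * (indicator {0..} u *\<^sub>R g' u)) \<in> borel_measurable lborel" for A
      by measurable
    then show "(\<lambda>u. indicator {0..} u *\<^sub>R (?s u * g' u)) \<in> borel_measurable lborel"
      "(\<lambda>u. indicator {0..} u *\<^sub>R (of_real (Si (A * (y - u))) * g' u)) \<in> borel_measurable lborel" for A
      by (simp_all only: mult_scaleR_right)
    show "integrable lborel (\<lambda>u. indicator {0..} u *\<^sub>R (B * norm (g' u)))"
      using set_integrable_mult_right[OF set_integrable_norm[OF i], of B] by (simp add: set_integrable_def)
    show "\<forall>\<^sub>F A in at_top. AE u in lborel.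
        norm (indicator {0..} u *\<^sub>R (of_real (Si (A * (y - u))) * g' u)) \<le> indicator {0..} u *\<^sub>R (B * norm (g' u))"
      using B by (intro always_eventually allI AE_I2) (auto simp: norm_mult intro!: mult_right_mono split: split_indicator)
    have "((\<lambda>A. indicator {0..} u *\<^sub>R (of_real (Si (A * (y - u))) * g' u)) \<longlongrightarrow> indicator {0..} u *\<^sub>R (?s u * g' u)) at_top"
      if "u \<noteq> y" for u
      using that by (intro tendsto_intros Si_at_top_scaled) auto
    then show "AE u in lborel. ((\<lambda>A. indicator {0..} u *\<^sub>R (of_real (Si (A * (y - u))) * g' u)) \<longlongrightarrow> indicator {0..} u *\<^sub>R (?s u * g' u)) at_top"
      by (intro AE_I[where N="{y}"]) auto
  qed
  then have "((\<lambda>A. 2 * (of_real (Si (A * y)) * g 0 + (LBINT u:{0..}. of_real (Si (A * (y - u))) * g' u))) \<longlongrightarrow>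
     2 * (of_real (sgn y * (pi / 2)) * g 0 + (LBINT u:{0..}. ?s u * g' u))) at_top"
    by (intro tendsto_intros Si_at_top_scaled y)
  moreover have "2 * (of_real (sgn y * (pi / 2)) * g 0 + (LBINT u:{0..}. ?s u * g' u)) = (if y > 0 then of_real (2 * pi) * g y else 0)"
  proof (cases "y > 0")
    case False
    with y have "y < 0" by simp
    then have "(LBINT u:{0..}. ?s u * g' u) = (LBINT u:{0..}. - of_real (pi / 2) * g' u)"
      by (intro set_lebesgue_integral_cong) auto
    also have "\<dots> = - of_real (pi / 2) * (LBINT u:{0..}. g' u)"
      by (rule set_integral_mult_right)
    finally show ?thesis
      using \<open>y < 0\<close> ftc'[of 0] by simp
  next
    case True
    have "set_integrable lborel {y..} g'"
      using True by (intro set_integrable_subset[OF i]) auto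
    then have "(\<lambda>u. indicator {y..} u *\<^sub>R g' u) \<in> borel_measurable lborel"
      by (simp add: set_integrable_def)
    then have "(\<lambda>u. ?s u * (indicator {y..} u *\<^sub>R g' u)) \<in> borel_measurable lborel"
      "(\<lambda>u. - of_real (pi / 2) * (indicator {y..} u *\<^sub>R g' u)) \<in> borel_measurable lborel"
      by measurable
    then have M: "(\<lambda>u. indicator {y..} u *\<^sub>R (?s u * g' u)) \<in> borel_measurable lborel"
      "(\<lambda>u. indicator {y..} u *\<^sub>R (- of_real (pi / 2) * g' u)) \<in> borel_measurable lborel"
      by (simp_all only: mult_scaleR_right)
    have "(LBINT u:{0..}. ?s u * g' u) = (LBINT u:{0..<y} \<union> {y..}. ?s u * g' u)"
      using True by (intro arg_cong[of _ _ "\<lambda>S. LBINT u:S. ?s u * g' u"]) auto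
    also have "\<dots> = (LBINT u:{0..<y}. ?s u * g' u) + (LBINT u:{y..}. ?s u * g' u)"
    proof (rule set_integral_Un)
      have "set_integrable lborel {0..<y} (\<lambda>u. of_real (pi / 2) * g' u)"
        by (intro set_integrable_mult_right set_integrable_subset[OF i]) auto
      then show "set_integrable lborel {0..<y} (\<lambda>u. ?s u * g' u)"
        by (rule set_integrable_cong[THEN iffD1, rotated -1]) auto
      have "set_integrable lborel {y..} (\<lambda>u. - of_real (pi / 2) * g' u)"
        using True by (intro set_integrable_mult_right set_integrable_subset[OF i]) auto
      then show "set_integrable lborel {y..} (\<lambda>u. ?s u * g' u)"
        unfolding set_integrable_def
        by (rule integrable_cong_AE_imp) (use M in \<open>auto intro!: AE_I[where N="{y}"] split: split_indicator\<close>)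
    qed auto
    also have "(LBINT u:{0..<y}. ?s u * g' u) = (LBINT u:{0..<y}. of_real (pi / 2) * g' u)"
      by (intro set_lebesgue_integral_cong) auto
    also have "\<dots> = of_real (pi / 2) * (LBINT u:{0..<y}. g' u)"
      by (rule set_integral_mult_right)
    also have "(LBINT u:{0..<y}. g' u) = (LBINT u:{0..y}. g' u)"
      unfolding set_lebesgue_integral_def
      by (rule integral_cong_AE)
         (use set_integrable_subset[OF i, of "{0..y}"] set_integrable_subset[OF i, of "{0..<y}", OF _ atLeastLessThan_subset]
          in \<open>auto simp: set_integrable_def split: split_indicator intro!: AE_I[where N="{y}"]\<close>)
    also have "\<dots> = g y - g 0"
      using ftc[of 0 y] True set_integrable_subset[OF i, of "{0..y}"] by (simp add: set_borel_integral_eq_integral)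
    also have "(LBINT u:{y..}. ?s u * g' u) = (LBINT u:{y..}. - of_real (pi / 2) * g' u)"
      unfolding set_lebesgue_integral_def
      by (rule integral_cong_AE)
         (use M in \<open>auto intro!: AE_I[where N="{y}"] split: split_indicator\<close>)
    also have "\<dots> = - of_real (pi / 2) * (LBINT u:{y..}. g' u)"
      by (rule set_integral_mult_right)
    finally have X: "(LBINT u:{0..}. ?s u * g' u) = of_real (pi / 2) * (g y - g 0) + - of_real (pi / 2) * - g y"
      using True ftc'[of y] by simp
    have eq: "of_real (2 * pi) = 4 * (of_real (pi / 2) :: complex)"
      by simp
    show ?thesis
      unfolding X eq using True by (simp only: sgn_pos mult_1 if_True) algebra
  qed
  ultimately have "((\<lambda>A. 2 * (of_real (Si (A * y)) * g 0 + (LBINT u:{0..}. of_real (Si (A * (y - u))) * g' u))) \<longlongrightarrow>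
     (if y > 0 then of_real (2 * pi) * g y else 0)) at_top"
    by simp
  then show ?thesis
    by (rule Lim_transform_eventually)
       (auto intro!: eventually_at_top_linorderI[of 0] simp: half_ft_partial_inversion[OF g])
qed

section \<open>Multipliers acting on initial data, forcing and boundary values\<close>

lemma integral_swap_real:
  fixes f :: "real \<Rightarrow> real \<Rightarrow> complex"
  assumes "continuous_on ({a..b} \<times> {c..d}) (\<lambda>(x, y). f x y)"
  shows "integral {a..b} (\<lambda>x. integral {c..d} (f x)) = integral {c..d} (\<lambda>y. integral {a..b} (\<lambda>x. f x y))"
  using integral_swap_continuous[of a c b d f] assms
  by (simp add: cbox_Pair_eq)

lemma continuous_on_integral_real:
  fixes f :: "'a::topological_space \<Rightarrow> real \<Rightarrow> complex"
  assumes "continuous_on (U \<times> {a..b}) (\<lambda>(x, w). f x w)"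
  shows "continuous_on U (\<lambda>x. integral {a..b} (f x))"
  using integral_continuous_on_param[of U a b f] assms by simp

text \<open>Bounded convergence for integrals over an interval, with finitely many exceptional points.\<close>

lemma integral_tendsto_bounded:
  fixes F :: "real \<Rightarrow> real \<Rightarrow> complex"
  assumes F: "\<And>A. continuous_on {a..b} (F A)" and G: "continuous_on {a..b} G"
    and bound: "\<And>A w. A \<ge> 0 \<Longrightarrow> w \<in> {a..b} \<Longrightarrow> norm (F A w) \<le> K"
    and lim: "\<And>w. w \<in> {a..b} - S \<Longrightarrow> ((\<lambda>A. F A w) \<longlongrightarrow> G w) at_top" and S: "finite S"
  shows "((\<lambda>A. integral {a..b} (F A)) \<longlongrightarrow> integral {a..b} G) at_top"
proof -
  have i: "set_integrable lborel {a..b} (F A)" "set_integrable lborel {a..b} G" for A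
    by (intro borel_integrable_atLeastAtMost' F G)+
  have "((\<lambda>A. LBINT w:{a..b}. F A w) \<longlongrightarrow> (LBINT w:{a..b}. G w)) at_top"
    unfolding set_lebesgue_integral_def
  proof (rule integral_dominated_convergence_at_top)
    show "(\<lambda>w. indicator {a..b} w *\<^sub>R G w) \<in> borel_measurable lborel"
      "\<And>A. (\<lambda>w. indicator {a..b} w *\<^sub>R F A w) \<in> borel_measurable lborel"
      using i by (auto simp: set_integrable_def)
    show "integrable lborel (\<lambda>w. indicator {a..b} w *\<^sub>R K)"
      using borel_integrable_atLeastAtMost'[of a b "\<lambda>w. K"] by (simp add: set_integrable_def)
    show "\<forall>\<^sub>F A in at_top. AE w in lborel. norm (indicator {a..b} w *\<^sub>R F A w) \<le> indicator {a..b} w *\<^sub>R K"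
      using bound by (intro eventually_at_top_linorderI[of 0] AE_I2) (auto split: split_indicator)
    have "S \<in> null_sets lborel"
      using S by (rule finite_imp_null_set_lborel)
    then have "AE w in lborel. w \<notin> S"
      by (rule AE_not_in)
    then show "AE w in lborel. ((\<lambda>A. indicator {a..b} w *\<^sub>R F A w) \<longlongrightarrow> indicator {a..b} w *\<^sub>R G w) at_top"
      by eventually_elim (use lim in \<open>auto split: split_indicator\<close>)
  qed
  then show ?thesis
    using i by (simp add: set_borel_integral_eq_integral)
qed

text \<open>The abstract form in which Fourier inversion is used: h is inverted to L on the positive axis, and K bounds the truncated integrals at every
point, including the negative ones, so that dominated convergence applies to averages of them.\<close>

definition inverts :: "real \<Rightarrow> (real \<Rightarrow> complex) \<Rightarrow> (real \<Rightarrow> complex) \<Rightarrow> bool" where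
  "inverts K h L \<longleftrightarrow> continuous_on UNIV h \<and> continuous_on {0<..} L \<and>
     (\<forall>A\<ge>0. \<forall>y. norm (integral {-A..A} (\<lambda>\<xi>. cis (\<xi> * y) * h \<xi>)) \<le> K) \<and>
     (\<forall>y>0. ((\<lambda>A. integral {-A..A} (\<lambda>\<xi>. cis (\<xi> * y) * h \<xi>)) \<longlongrightarrow> L y) at_top)"

text \<open>Replacing \<xi> by -\<xi> in the transform reflects the function to the negative axis, where inversion yields 0 at y > 0.\<close>

lemma inverts_half_ft:
  "\<exists>K. \<forall>C g g'. decay2_C1 C g g' \<longrightarrow>
     inverts (K * C) (half_ft g) (\<lambda>y. of_real (2 * pi) * g y) \<and> inverts (K * C) (\<lambda>\<xi>. half_ft g (- \<xi>)) (\<lambda>y. 0)"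
proof -
  obtain K where K: "\<And>C g g' A y. decay2_C1 C g g' \<Longrightarrow> A \<ge> 0 \<Longrightarrow>
      norm (integral {-A..A} (\<lambda>\<xi>. cis (\<xi> * y) * half_ft g \<xi>)) \<le> K * C"
    using half_ft_partial_inversion_bound by blast
  have "inverts (K * C) (half_ft g) (\<lambda>y. of_real (2 * pi) * g y) \<and> inverts (K * C) (\<lambda>\<xi>. half_ft g (- \<xi>)) (\<lambda>y. 0)"
    if g: "decay2_C1 C g g'" for C g g'
  proof -
    have gd: "decay2 C g" using g by (simp add: decay2_C1_def)
    have c: "continuous_on UNIV (half_ft g)" "continuous_on {0<..} g"
      using continuous_on_half_ft_UNIV[OF gd] gd by (auto simp: decay2_def intro: continuous_on_subset)
    have reflect: "integral {-A..A} (\<lambda>\<xi>. cis (\<xi> * y) * half_ft g (- \<xi>)) = integral {-A..A} (\<lambda>\<xi>. cis (\<xi> * - y) * half_ft g \<xi>)" for A y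
      using Henstock_Kurzweil_Integration.integral_reflect_real[of A "- A" "\<lambda>\<xi>. cis (\<xi> * - y) * half_ft g \<xi>"]
      by simp
    have lim: "((\<lambda>A. integral {-A..A} (\<lambda>\<xi>. cis (\<xi> * y) * half_ft g \<xi>)) \<longlongrightarrow> of_real (2 * pi) * g y) at_top"
      "((\<lambda>A. integral {-A..A} (\<lambda>\<xi>. cis (\<xi> * - y) * half_ft g \<xi>)) \<longlongrightarrow> 0) at_top" if "y > 0" for y
      using half_ft_inversion[OF g, of y] half_ft_inversion[OF g, of "- y"] that by simp_all
    have c': "continuous_on UNIV (\<lambda>\<xi>. half_ft g (- \<xi>))" "continuous_on {0<..} (\<lambda>y. of_real (2 * pi) * g y)"
      by (intro continuous_intros continuous_on_compose2[OF c(1)] c(2); simp)+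
    show ?thesis
      unfolding inverts_def reflect
      by (intro conjI allI impI c' c lim K[OF g] continuous_on_const)
  qed
  then show ?thesis by blast
qed

lemma continuous_on_snd_Icc:
  "continuous_on {0..1} q \<Longrightarrow> X \<subseteq> UNIV \<times> {0..1::real} \<Longrightarrow> continuous_on X (\<lambda>x. q (snd x))"
  by (rule continuous_on_compose2[of "{0..1}" q]) (auto intro: continuous_intros)

lemma continuous_on_propagator:
  assumes "propagator M N"
  shows "continuous_on UNIV (\<lambda>(\<xi>, s). M \<xi> s)"
  using assms
proof (induction rule: propagator.induct)
  case (atom q c \<alpha> j k)
  note [continuous_intros] = atom(1-3)[THEN continuous_on_snd_Icc]
  show ?case
    unfolding atom_def case_prod_unfold
    by (rule continuous_on_integral_real) (auto simp: case_prod_unfold intro!: continuous_intros)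
next
  case (add M N M' N')
  then show ?case
    by (auto simp: case_prod_unfold intro: continuous_intros)
qed

lemma continuous_on_propagator_compose:
  assumes "propagator M N" "continuous_on X a" "continuous_on X b"
  shows "continuous_on X (\<lambda>z. M (a z) (b z))"
  using continuous_on_compose2[OF continuous_on_propagator[OF assms(1)] continuous_on_Pair[OF assms(2,3)]]
  by simp

lemma amp_bounded:
  assumes "continuous_on {0..1} q" "continuous_on {0..1} c"
  shows "\<exists>B\<ge>0. \<forall>s\<in>{0..T}. \<forall>w\<in>{0..1}. norm (amp q j k c s w) \<le> B"
proof -
  note [continuous_intros] = assms[THEN continuous_on_snd_Icc]
  have "compact ((\<lambda>(s, w). amp q j k c s w) ` ({0..T} \<times> {0..1}))"
    unfolding case_prod_unfold by (intro compact_continuous_image compact_Times compact_Icc continuous_intros) auto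
  then obtain B where "\<forall>z\<in>(\<lambda>(s, w). amp q j k c s w) ` ({0..T} \<times> {0..1}). norm z \<le> B"
    using compact_imp_bounded bounded_iff by blast
  then have "\<forall>s\<in>{0..T}. \<forall>w\<in>{0..1}. norm (amp q j k c s w) \<le> max B 0"
    by force
  then show ?thesis by (intro exI[of _ "max B 0"]) auto
qed

lemma integral_norm_le_unit:
  fixes f :: "real \<Rightarrow> complex"
  assumes "continuous_on {0..1} f" "\<And>w. w \<in> {0..1} \<Longrightarrow> norm (f w) \<le> B"
  shows "norm (integral {0..1} f) \<le> B"
  using integral_bound[of 0 1 f B] assms by simp

text \<open>By Fubini, the truncated integral with multiplier M is an average of truncated inversion integrals at the
points x - t\<alpha>. For x > t these are positive, so each integral converges to L there, and the uniform bound allows the passage to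
the limit under the average.\<close>

lemma propagator_limit:
  assumes "propagator M N"
  shows "\<And>K h L x t. inverts K h L \<Longrightarrow> 0 \<le> t \<Longrightarrow> t < x \<Longrightarrow>
      ((\<lambda>A. integral {-A..A} (\<lambda>\<xi>. cis (\<xi> * x) * (M \<xi> t * h \<xi>))) \<longlongrightarrow> N L t x) at_top"
    and "\<And>T. \<exists>B\<ge>0. \<forall>K h L. inverts K h L \<longrightarrow> (\<forall>t\<in>{0..T}. \<forall>x. \<forall>A\<ge>0.
      norm (integral {-A..A} (\<lambda>\<xi>. cis (\<xi> * x) * (M \<xi> t * h \<xi>))) \<le> B * K)"
  using assms
proof (induction rule: propagator.induct)
  case (atom q c \<alpha> j k)
  note [continuous_intros] = atom(1-3)[THEN continuous_on_snd_Icc]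
  note [continuous_intros] = atom(1-3)
  \<comment> \<open>the truncated inversion integral of h at the point y\<close>
  let ?D = "\<lambda>h A y. integral {-A..A} (\<lambda>\<xi>. cis (\<xi> * y) * h \<xi>)"
  have cD: "continuous_on {0..1} (\<lambda>w. amp q j k c t w * ?D h A (x - t * \<alpha> w))" if "continuous_on UNIV h" for h t A x
  proof -
    note [continuous_intros] = atom(1-3)[THEN continuous_on_compose2[of _ _ _ fst]]
    have "continuous_on {0..1} (\<lambda>w. ?D h A (x - t * \<alpha> w))"
      by (rule continuous_on_integral_real)
         (auto simp: case_prod_unfold intro!: continuous_intros continuous_on_compose2[OF that])
    then show ?thesis
      by (intro continuous_intros)
  qed
  have swap: "integral {-A..A} (\<lambda>\<xi>. cis (\<xi> * x) * (atom q j k c \<alpha> \<xi> t * h \<xi>))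
      = integral {0..1} (\<lambda>w. amp q j k c t w * ?D h A (x - t * \<alpha> w))" if h: "continuous_on UNIV h" for h A x t
  proof -
    have "integral {-A..A} (\<lambda>\<xi>. cis (\<xi> * x) * (atom q j k c \<alpha> \<xi> t * h \<xi>))
       = integral {-A..A} (\<lambda>\<xi>. integral {0..1} (\<lambda>w. amp q j k c t w * (cis (\<xi> * (x - t * \<alpha> w)) * h \<xi>)))"
    proof (rule integral_cong)
      fix \<xi>
      have "cis (\<xi> * x) * (atom q j k c \<alpha> \<xi> t * h \<xi>) = integral {0..1} (\<lambda>w. cis (\<xi> * x) * (amp q j k c t w * cis (- (\<xi> * t * \<alpha> w)) * h \<xi>))"
        by (simp add: atom_def)
      also have "(\<lambda>w. cis (\<xi> * x) * (amp q j k c t w * cis (- (\<xi> * t * \<alpha> w)) * h \<xi>)) = (\<lambda>w. amp q j k c t w * (cis (\<xi> * (x - t * \<alpha> w)) * h \<xi>))"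
      proof
        fix w
        have "cis (\<xi> * (x - t * \<alpha> w)) = cis (\<xi> * x) * cis (- (\<xi> * t * \<alpha> w))"
          by (simp add: cis_mult algebra_simps)
        then show "cis (\<xi> * x) * (amp q j k c t w * cis (- (\<xi> * t * \<alpha> w)) * h \<xi>) = amp q j k c t w * (cis (\<xi> * (x - t * \<alpha> w)) * h \<xi>)"
          by (simp only: mult_ac)
      qed
      finally show "cis (\<xi> * x) * (atom q j k c \<alpha> \<xi> t * h \<xi>) = integral {0..1} (\<lambda>w. amp q j k c t w * (cis (\<xi> * (x - t * \<alpha> w)) * h \<xi>))" .
    qed
    also have "\<dots> = integral {0..1} (\<lambda>w. integral {-A..A} (\<lambda>\<xi>. amp q j k c t w * (cis (\<xi> * (x - t * \<alpha> w)) * h \<xi>)))"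
      by (rule integral_swap_real)
         (auto simp: case_prod_unfold intro!: continuous_intros continuous_on_compose2[OF h])
    finally show ?thesis by simp
  qed
  {
    case (1 K h L x t)
    then have h: "continuous_on UNIV h" and L: "continuous_on {0<..} L"
      and b: "\<And>A y. A \<ge> 0 \<Longrightarrow> norm (?D h A y) \<le> K"
      and lim: "\<And>y. y > 0 \<Longrightarrow> ((\<lambda>A. ?D h A y) \<longlongrightarrow> L y) at_top"
      by (auto simp: inverts_def)
    have pos: "x - t * \<alpha> w > 0" if "w \<in> {0..1}" for w
      using atom(4) that 1(2,3) mult_left_mono[of "\<alpha> w" 1 t] by force
    obtain B where B: "B \<ge> 0" "\<forall>s\<in>{0..t}. \<forall>w\<in>{0..1}. norm (amp q j k c s w) \<le> B"
      using amp_bounded[OF atom(1,2)] by blast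
    show ?case
      unfolding swap[OF h]
    proof (rule integral_tendsto_bounded[where S="{}" and K="B * K"])
      show "continuous_on {0..1} (\<lambda>w. amp q j k c t w * ?D h A (x - t * \<alpha> w))" for A
        by (rule cD[OF h])
      show "continuous_on {0..1} (\<lambda>w. amp q j k c t w * L (x - t * \<alpha> w))"
        by (intro continuous_intros continuous_on_compose2[OF L]) (use pos in auto)
      show "norm (amp q j k c t w * ?D h A (x - t * \<alpha> w)) \<le> B * K" if "A \<ge> 0" "w \<in> {0..1}" for A w
        unfolding norm_mult[of "amp q j k c t w"] using B 1(2) that b[OF that(1)] by (intro mult_mono) auto
      show "((\<lambda>A. amp q j k c t w * ?D h A (x - t * \<alpha> w)) \<longlongrightarrow> amp q j k c t w * L (x - t * \<alpha> w)) at_top"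
        if "w \<in> {0..1} - {}" for w
        using that pos by (intro tendsto_intros lim) auto
    qed auto
  next
    case (2 T)
    obtain B where B: "B \<ge> 0" "\<forall>s\<in>{0..T}. \<forall>w\<in>{0..1}. norm (amp q j k c s w) \<le> B"
      using amp_bounded[OF atom(1,2)] by blast
    have "norm (integral {-A..A} (\<lambda>\<xi>. cis (\<xi> * x) * (atom q j k c \<alpha> \<xi> t * h \<xi>))) \<le> B * K"
      if "inverts K h L" "t \<in> {0..T}" "A \<ge> 0" for K h L t x A
    proof -
      have h: "continuous_on UNIV h" and b: "\<And>y. norm (?D h A y) \<le> K"
        using that by (auto simp: inverts_def)
      show ?thesis
        unfolding swap[OF h]
      proof (rule integral_norm_le_unit[OF cD[OF h]])
        show "norm (amp q j k c t w * ?D h A (x - t * \<alpha> w)) \<le> B * K" if "w \<in> {0..1}" for w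
          unfolding norm_mult[of "amp q j k c t w"] using B \<open>t \<in> {0..T}\<close> that b by (intro mult_mono) auto
      qed
    qed
    with B(1) show ?case by blast
  }
next
  case (add M N M' N')
  have c: "continuous_on UNIV (\<lambda>\<xi>. M \<xi> t)" "continuous_on UNIV (\<lambda>\<xi>. M' \<xi> t)" for t
    by (rule continuous_on_propagator_compose[OF add.hyps(1)] continuous_on_propagator_compose[OF add.hyps(2)];
        intro continuous_intros)+
  have sum: "integral {-A..A} (\<lambda>\<xi>. cis (\<xi> * x) * ((M \<xi> t + M' \<xi> t) * h \<xi>))
    = integral {-A..A} (\<lambda>\<xi>. cis (\<xi> * x) * (M \<xi> t * h \<xi>)) + integral {-A..A} (\<lambda>\<xi>. cis (\<xi> * x) * (M' \<xi> t * h \<xi>))"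
    if "continuous_on UNIV h" for h A t x
    unfolding distrib_left distrib_right
    by (intro integral_add integrable_continuous_interval continuous_intros)
       (auto intro: continuous_on_subset[OF c(1)] continuous_on_subset[OF c(2)] continuous_on_subset[OF that])
  {
    case (1 K h L x t)
    then show ?case
      using add.IH(1,3) sum[of h] by (auto simp: inverts_def intro!: tendsto_add)
  next
    case (2 T)
    obtain B where B: "B \<ge> 0" "\<And>K h L t x A. inverts K h L \<Longrightarrow> t \<in> {0..T} \<Longrightarrow> A \<ge> 0 \<Longrightarrow>
        norm (integral {-A..A} (\<lambda>\<xi>. cis (\<xi> * x) * (M \<xi> t * h \<xi>))) \<le> B * K"
      using add.IH(2)[of T] by blast
    obtain B' where B': "B' \<ge> 0" "\<And>K h L t x A. inverts K h L \<Longrightarrow> t \<in> {0..T} \<Longrightarrow> A \<ge> 0 \<Longrightarrow>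
        norm (integral {-A..A} (\<lambda>\<xi>. cis (\<xi> * x) * (M' \<xi> t * h \<xi>))) \<le> B' * K"
      using add.IH(4)[of T] by blast
    show ?case
    proof (intro exI[of _ "B + B'"] conjI allI impI ballI)
      fix K h L t x A assume *: "inverts K h L" "t \<in> {0..T}" "(0::real) \<le> A"
      then have "continuous_on UNIV h" by (simp add: inverts_def)
      from sum[OF this] show "norm (integral {-A..A} (\<lambda>\<xi>. cis (\<xi> * x) * ((M \<xi> t + M' \<xi> t) * h \<xi>))) \<le> (B + B') * K"
        using B(2)[OF *] B'(2)[OF *] by (simp add: distrib_right norm_triangle_mono)
    qed (use B B' in auto)
  }
qed

lemma propagator_cmult_right: "propagator M N \<Longrightarrow> N (\<lambda>y. a * g y) t x = a * N g t x"
  by (induction rule: propagator.induct) (simp_all add: mult.left_commute[of _ a] distrib_left)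

lemma propagator_0: "propagator M N \<Longrightarrow> N (\<lambda>y. 0) t x = 0"
  using propagator_cmult_right[of M N 0 "\<lambda>y. 0" t x] by simp

lemma continuous_on_propagated:
  assumes "propagator M N" and L: "continuous_on ({0..t} \<times> {0<..}) (\<lambda>(\<tau>, y). L \<tau> y)" and "t < x"
  shows "continuous_on {0..t} (\<lambda>\<tau>. N (L \<tau>) (t - \<tau>) x)"
  using assms(1)
proof (induction rule: propagator.induct)
  case (atom q c \<alpha> j k)
  note [continuous_intros] = atom(1-3)[THEN continuous_on_snd_Icc]
  have "(t - \<tau>) * \<alpha> w < x" if "\<tau> \<in> {0..t}" "w \<in> {0..1}" for \<tau> w
    using atom(4) that \<open>t < x\<close> mult_left_mono[of "\<alpha> w" 1 "t - \<tau>"] by force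
  then show ?case
    by (intro continuous_on_integral_real)
       (auto simp: case_prod_unfold intro!: continuous_intros continuous_on_compose2[OF L, of _ "\<lambda>z. (_ z, _ z)", simplified])
next
  case (add M N M' N')
  then show ?case by (intro continuous_intros)
qed

text \<open>Duhamel's principle: the data given at time \<tau> propagate for the time t - \<tau>. The limit passes through the \<tau>-integral because
propagator_limit provides a bound uniform in the elapsed time.\<close>

lemma propagator_duhamel:
  assumes M: "propagator M N" and t: "0 \<le> t" "t < x"
    and h: "\<And>\<tau>. \<tau> \<in> {0..t} \<Longrightarrow> inverts K (h \<tau>) (L \<tau>)"
    and ch: "continuous_on (UNIV \<times> {0..t}) (\<lambda>(\<xi>, \<tau>). h \<tau> \<xi>)"
    and cL: "continuous_on ({0..t} \<times> {0<..}) (\<lambda>(\<tau>, y). L \<tau> y)"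
  shows "((\<lambda>A. integral {-A..A} (\<lambda>\<xi>. cis (\<xi> * x) * integral {0..t} (\<lambda>\<tau>. M \<xi> (t - \<tau>) * h \<tau> \<xi>)))
    \<longlongrightarrow> integral {0..t} (\<lambda>\<tau>. N (L \<tau>) (t - \<tau>) x)) at_top"
proof -
  note c = continuous_on_propagator_compose[OF M]
  have ch': "continuous_on (X \<times> {0..t}) (\<lambda>z. h (snd z) (fst z))" "continuous_on ({0..t} \<times> X) (\<lambda>z. h (fst z) (snd z))" for X
    by (rule continuous_on_compose2[OF ch, of _ "\<lambda>z. (_ z, _ z)", simplified]; auto intro!: continuous_intros)+
  have swap: "integral {-A..A} (\<lambda>\<xi>. cis (\<xi> * x) * integral {0..t} (\<lambda>\<tau>. M \<xi> (t - \<tau>) * h \<tau> \<xi>))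
     = integral {0..t} (\<lambda>\<tau>. integral {-A..A} (\<lambda>\<xi>. cis (\<xi> * x) * (M \<xi> (t - \<tau>) * h \<tau> \<xi>)))" for A
  proof -
    have "integral {-A..A} (\<lambda>\<xi>. integral {0..t} (\<lambda>\<tau>. cis (\<xi> * x) * (M \<xi> (t - \<tau>) * h \<tau> \<xi>)))
     = integral {0..t} (\<lambda>\<tau>. integral {-A..A} (\<lambda>\<xi>. cis (\<xi> * x) * (M \<xi> (t - \<tau>) * h \<tau> \<xi>)))"
      by (rule integral_swap_real) (auto simp: case_prod_unfold intro!: continuous_intros c ch')
    then show ?thesis by simp
  qed
  obtain B where B: "\<And>K h L s x A. inverts K h L \<Longrightarrow> s \<in> {0..t} \<Longrightarrow> A \<ge> 0 \<Longrightarrow>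
        norm (integral {-A..A} (\<lambda>\<xi>. cis (\<xi> * x) * (M \<xi> s * h \<xi>))) \<le> B * K"
    using propagator_limit(2)[OF M, of t] by blast
  show ?thesis
    unfolding swap
  proof (rule integral_tendsto_bounded[where S="{}" and K="B * K"])
    show "continuous_on {0..t} (\<lambda>\<tau>. integral {-A..A} (\<lambda>\<xi>. cis (\<xi> * x) * (M \<xi> (t - \<tau>) * h \<tau> \<xi>)))" for A
      by (rule continuous_on_integral_real) (auto simp: case_prod_unfold intro!: continuous_intros c ch')
    show "continuous_on {0..t} (\<lambda>\<tau>. N (L \<tau>) (t - \<tau>) x)"
      by (rule continuous_on_propagated[OF M cL t(2)])
    show "norm (integral {-A..A} (\<lambda>\<xi>. cis (\<xi> * x) * (M \<xi> (t - \<tau>) * h \<tau> \<xi>))) \<le> B * K"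
      if "A \<ge> 0" "\<tau> \<in> {0..t}" for A \<tau>
      using that by (intro B[OF h]) auto
    show "((\<lambda>A. integral {-A..A} (\<lambda>\<xi>. cis (\<xi> * x) * (M \<xi> (t - \<tau>) * h \<tau> \<xi>))) \<longlongrightarrow> N (L \<tau>) (t - \<tau>) x) at_top"
      if "\<tau> \<in> {0..t} - {}" for \<tau>
      using that t by (intro propagator_limit(1)[OF M h]) auto
  qed simp
qed

text \<open>One integration by parts gains a factor 1/A.\<close>

lemma riemann_lebesgue_C1:
  fixes \<phi> :: "real \<Rightarrow> complex"
  assumes \<phi>: "\<And>\<tau>. \<tau> \<in> {0..t} \<Longrightarrow> (\<phi> has_vector_derivative \<phi>' \<tau>) (at \<tau> within {0..t})"
    and c: "continuous_on {0..t} \<phi>'" and a: "a \<noteq> 0" and t: "0 \<le> t"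
  shows "((\<lambda>A. integral {0..t} (\<lambda>\<tau>. \<phi> \<tau> * of_real (sin (A * (b + a * \<tau>))))) \<longlongrightarrow> 0) at_top"
proof -
  obtain B where B: "\<And>\<tau>. \<tau> \<in> {0..t} \<Longrightarrow> norm (\<phi>' \<tau>) \<le> B"
    using continuous_on_compact_bound[OF compact_Icc c] by metis
  let ?K = "norm (\<phi> t) + norm (\<phi> 0) + B * t"
  have bound: "norm (integral {0..t} (\<lambda>\<tau>. \<phi> \<tau> * of_real (sin (A * (b + a * \<tau>))))) \<le> ?K / (A * \<bar>a\<bar>)" if A: "A > 0" for A
  proof -
    let ?c = "\<lambda>\<tau>. cos (A * (b + a * \<tau>))"
    have "((\<lambda>\<tau>. \<phi> \<tau> * of_real (- A * a * sin (A * (b + a * \<tau>))) + \<phi>' \<tau> * of_real (?c \<tau>)) has_integral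
       \<phi> t * of_real (?c t) - \<phi> 0 * of_real (?c 0)) {0..t}"
    proof (rule fundamental_theorem_of_calculus[OF t])
      fix \<tau> assume "\<tau> \<in> {0..t}"
      have "(?c has_real_derivative - A * a * sin (A * (b + a * \<tau>))) (at \<tau> within {0..t})"
        by (auto intro!: derivative_eq_intros)
      from has_vector_derivative_mult[OF \<phi>[OF \<open>\<tau> \<in> {0..t}\<close>] has_vector_derivative_of_real[OF this]]
      show "((\<lambda>\<tau>. \<phi> \<tau> * of_real (?c \<tau>)) has_vector_derivative
         \<phi> \<tau> * of_real (- A * a * sin (A * (b + a * \<tau>))) + \<phi>' \<tau> * of_real (?c \<tau>)) (at \<tau> within {0..t})" .
    qed
    moreover have "(\<lambda>\<tau>. \<phi>' \<tau> * of_real (?c \<tau>)) integrable_on {0..t}"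
      by (intro integrable_continuous_interval continuous_intros c)
    ultimately have "((\<lambda>\<tau>. - of_real (A * a) * (\<phi> \<tau> * of_real (sin (A * (b + a * \<tau>))))) has_integral
       \<phi> t * of_real (?c t) - \<phi> 0 * of_real (?c 0) - integral {0..t} (\<lambda>\<tau>. \<phi>' \<tau> * of_real (?c \<tau>))) {0..t}"
      by (rule has_integral_eq[rotated, OF has_integral_diff[OF _ integrable_integral]]) simp
    then have "- of_real (A * a) * integral {0..t} (\<lambda>\<tau>. \<phi> \<tau> * of_real (sin (A * (b + a * \<tau>)))) =
       \<phi> t * of_real (?c t) - \<phi> 0 * of_real (?c 0) - integral {0..t} (\<lambda>\<tau>. \<phi>' \<tau> * of_real (?c \<tau>))"
      unfolding integral_mult_right[symmetric] by (rule integral_unique)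
    from arg_cong[OF this, of norm]
    have "A * \<bar>a\<bar> * norm (integral {0..t} (\<lambda>\<tau>. \<phi> \<tau> * of_real (sin (A * (b + a * \<tau>))))) =
       norm (\<phi> t * of_real (?c t) - \<phi> 0 * of_real (?c 0) - integral {0..t} (\<lambda>\<tau>. \<phi>' \<tau> * of_real (?c \<tau>)))"
      unfolding norm_mult norm_minus_cancel norm_of_real abs_mult abs_of_pos[OF A] .
    also have "\<dots> \<le> norm (\<phi> t * of_real (?c t)) + norm (\<phi> 0 * of_real (?c 0)) + norm (integral {0..t} (\<lambda>\<tau>. \<phi>' \<tau> * of_real (?c \<tau>)))"
      by (intro order_trans[OF norm_triangle_ineq4] add_mono norm_triangle_ineq4 order_refl)
    also have "\<dots> \<le> ?K"
    proof (intro add_mono)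
      have "norm (integral {0..t} (\<lambda>\<tau>. \<phi>' \<tau> * of_real (?c \<tau>))) \<le> B * (t - 0)"
      proof (rule integral_bound[OF t])
        show "continuous_on {0..t} (\<lambda>\<tau>. \<phi>' \<tau> * of_real (?c \<tau>))"
          by (intro continuous_intros c)
        show "norm (\<phi>' \<tau> * of_real (?c \<tau>)) \<le> B" if "\<tau> \<in> {0..t}" for \<tau>
          using mult_mono[OF B[OF that] abs_cos_le_one[of "A * (b + a * \<tau>)"]] order_trans[OF norm_ge_zero B[OF that]]
          by (simp add: norm_mult)
      qed
      then show "norm (integral {0..t} (\<lambda>\<tau>. \<phi>' \<tau> * of_real (?c \<tau>))) \<le> B * t" by simp
    qed (auto simp: norm_mult mult_left_le)
    finally show ?thesis
      using A a by (simp add: field_simps)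
  qed
  have lim: "((\<lambda>A. ?K / (A * \<bar>a\<bar>)) \<longlongrightarrow> 0) at_top"
    using a by real_asymp
  show ?thesis
    by (rule Lim_null_comparison[OF _ lim]) (rule eventually_mono[OF eventually_gt_at_top[of 0] bound])
qed

lemma integral_cis_pos:
  assumes "A \<ge> 0" "v > 0"
  shows "integral {-A..A} (\<lambda>\<xi>. cis (\<xi> * v)) = of_real (2 / v * sin (A * v))"
  using integral_cis[OF assms(1), of v] assms(2) by (auto simp del: sinc_neg)

text \<open>A source at the boundary point 0 has a constant Fourier transform, so the truncated integral is the Dirichlet
kernel 2 sin(Ay)/y at y = x - (t - \<tau>)\<alpha>(w). For x > t this y stays at distance x - t from 0, so no mass
concentrates, and the phase Ay has \<tau>-derivative A\<alpha>(w), so the integral over \<tau> tends to 0 wherever \<alpha>(w) \<noteq> 0.\<close>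

lemma atom_source:
  assumes q: "continuous_on {0..1} q" and c: "continuous_on {0..1} c" and \<alpha>: "continuous_on {0..1} \<alpha>"
    and \<alpha>1: "\<alpha> ` {0..1} \<subseteq> {-1..1}" and fin: "finite {w\<in>{0..1}. \<alpha> w = 0}"
    and t: "0 \<le> t" "t < x"
    and h: "\<And>\<tau>. \<tau> \<in> {0..t} \<Longrightarrow> (h has_vector_derivative h' \<tau>) (at \<tau> within {0..t})"
    and ch': "continuous_on {0..t} h'"
  shows "((\<lambda>A. integral {-A..A} (\<lambda>\<xi>. cis (\<xi> * x) * integral {0..t} (\<lambda>\<tau>. h \<tau> * atom q j k c \<alpha> \<xi> (t - \<tau>)))) \<longlongrightarrow> 0) at_top"
proof -
  \<comment> \<open>?y is the distance from the source to the point reached from x backwards along the ray\<close>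
  let ?p = "\<lambda>\<tau> w. h \<tau> * amp q j k c (t - \<tau>) w" and ?y = "\<lambda>\<tau> w. x - (t - \<tau>) * \<alpha> w"
  have ch: "continuous_on {0..t} h"
    by (rule continuous_on_vector_derivative[OF h])
  have y: "?y \<tau> w \<ge> x - t" if "\<tau> \<in> {0..t}" "w \<in> {0..1}" for \<tau> w
    using \<alpha>1 that t mult_left_mono[of "\<alpha> w" 1 "t - \<tau>"] by force
  have y0: "?y \<tau> w > 0" if "\<tau> \<in> {0..t}" "w \<in> {0..1}" for \<tau> w
    using y[OF that] t by linarith
  have ynz: "x \<noteq> (t - \<tau>) * \<alpha> w" if "0 \<le> \<tau>" "\<tau> \<le> t" "0 \<le> w" "w \<le> 1" for \<tau> w
    using y0[of \<tau> w] that by simp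
  have cq: "continuous_on X (\<lambda>z. q (f z))" "continuous_on X (\<lambda>z. c (f z))" "continuous_on X (\<lambda>z. \<alpha> (f z))"
    if "continuous_on X f" "f ` X \<subseteq> {0..1}" for X and f :: "'z::topological_space \<Rightarrow> real"
    using that by (auto intro: continuous_on_compose2[OF q] continuous_on_compose2[OF c] continuous_on_compose2[OF \<alpha>])
  have chf: "continuous_on X (\<lambda>z. h (f z))" if "continuous_on X f" "f ` X \<subseteq> {0..t}" for X and f :: "'z::topological_space \<Rightarrow> real"
    using that by (auto intro: continuous_on_compose2[OF ch])
  let ?I = "\<lambda>A w. integral {0..t} (\<lambda>\<tau>. ?p \<tau> w * of_real (2 / ?y \<tau> w * sin (A * ?y \<tau> w)))"
  have eq: "integral {-A..A} (\<lambda>\<xi>. cis (\<xi> * x) * integral {0..t} (\<lambda>\<tau>. h \<tau> * atom q j k c \<alpha> \<xi> (t - \<tau>)))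
     = integral {0..1} (?I A)" if A: "A \<ge> 0" for A
  proof -
    have "cis (\<xi> * x) * integral {0..t} (\<lambda>\<tau>. h \<tau> * atom q j k c \<alpha> \<xi> (t - \<tau>)) =
       integral {0..1} (\<lambda>w. integral {0..t} (\<lambda>\<tau>. ?p \<tau> w * cis (\<xi> * ?y \<tau> w)))" for \<xi>
    proof -
      have "cis (\<xi> * x) * integral {0..t} (\<lambda>\<tau>. h \<tau> * atom q j k c \<alpha> \<xi> (t - \<tau>)) =
        integral {0..t} (\<lambda>\<tau>. integral {0..1} (\<lambda>w. cis (\<xi> * x) * (h \<tau> * (amp q j k c (t - \<tau>) w * cis (- (\<xi> * (t - \<tau>) * \<alpha> w))))))"
        by (simp add: atom_def)
      also have "(\<lambda>\<tau> w. cis (\<xi> * x) * (h \<tau> * (amp q j k c (t - \<tau>) w * cis (- (\<xi> * (t - \<tau>) * \<alpha> w))))) =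
         (\<lambda>\<tau> w. ?p \<tau> w * cis (\<xi> * ?y \<tau> w))"
      proof (intro ext)
        fix \<tau> w
        have "cis (\<xi> * ?y \<tau> w) = cis (\<xi> * x) * cis (- (\<xi> * (t - \<tau>) * \<alpha> w))"
          by (simp add: cis_mult algebra_simps)
        then show "cis (\<xi> * x) * (h \<tau> * (amp q j k c (t - \<tau>) w * cis (- (\<xi> * (t - \<tau>) * \<alpha> w)))) = ?p \<tau> w * cis (\<xi> * ?y \<tau> w)"
          by (simp only: mult_ac)
      qed
      also have "integral {0..t} (\<lambda>\<tau>. integral {0..1} (\<lambda>w. ?p \<tau> w * cis (\<xi> * ?y \<tau> w))) =
         integral {0..1} (\<lambda>w. integral {0..t} (\<lambda>\<tau>. ?p \<tau> w * cis (\<xi> * ?y \<tau> w)))"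
        by (rule integral_swap_real) (auto simp: case_prod_unfold intro!: continuous_intros cq chf)
      finally show ?thesis .
    qed
    then have "integral {-A..A} (\<lambda>\<xi>. cis (\<xi> * x) * integral {0..t} (\<lambda>\<tau>. h \<tau> * atom q j k c \<alpha> \<xi> (t - \<tau>)))
      = integral {-A..A} (\<lambda>\<xi>. integral {0..1} (\<lambda>w. integral {0..t} (\<lambda>\<tau>. ?p \<tau> w * cis (\<xi> * ?y \<tau> w))))"
      by simp
    also have "\<dots> = integral {0..1} (\<lambda>w. integral {-A..A} (\<lambda>\<xi>. integral {0..t} (\<lambda>\<tau>. ?p \<tau> w * cis (\<xi> * ?y \<tau> w))))"
      by (rule integral_swap_real)
         (auto simp: case_prod_unfold intro!: continuous_on_integral_real continuous_intros cq chf)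
    also have "\<dots> = integral {0..1} (\<lambda>w. integral {0..t} (\<lambda>\<tau>. integral {-A..A} (\<lambda>\<xi>. ?p \<tau> w * cis (\<xi> * ?y \<tau> w))))"
      by (intro integral_cong integral_swap_real)
         (auto simp: case_prod_unfold intro!: continuous_intros cq chf)
    also have "\<dots> = integral {0..1} (?I A)"
      by (intro integral_cong) (simp add: integral_cis_pos[OF A y0])
    finally show ?thesis .
  qed
  obtain B where B: "B \<ge> 0" "\<forall>s\<in>{0..t}. \<forall>w\<in>{0..1}. norm (amp q j k c s w) \<le> B"
    using amp_bounded[OF q c] by blast
  obtain H where H: "\<And>\<tau>. \<tau> \<in> {0..t} \<Longrightarrow> norm (h \<tau>) \<le> H"
    using continuous_on_compact_bound[OF compact_Icc ch] by metis
  have H0: "H \<ge> 0" using order_trans[OF norm_ge_zero H[of 0]] t by simp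
  have "((\<lambda>A. integral {0..1} (?I A)) \<longlongrightarrow> integral {0..1} (\<lambda>w::real. 0)) at_top"
  proof (rule integral_tendsto_bounded[where S="{w \<in> {0..1}. \<alpha> w = 0}" and K="H * B * (2 / (x - t)) * (t - 0)"])
    show "continuous_on {0..1} (?I A)" for A
      by (rule continuous_on_integral_real, unfold case_prod_unfold, intro continuous_intros cq chf)
         (auto simp: ynz)
    show "norm (?I A w) \<le> H * B * (2 / (x - t)) * (t - 0)" if "w \<in> {0..1}" for A w
    proof (rule integral_bound[OF t(1)])
      show "continuous_on {0..t} (\<lambda>\<tau>. ?p \<tau> w * of_real (2 / ?y \<tau> w * sin (A * ?y \<tau> w)))"
        using that by (intro continuous_intros chf) (auto simp: ynz)
      show "norm (?p \<tau> w * of_real (2 / ?y \<tau> w * sin (A * ?y \<tau> w))) \<le> H * B * (2 / (x - t))" if \<tau>: "\<tau> \<in> {0..t}" for \<tau>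
      proof -
        have "norm (of_real (2 / ?y \<tau> w * sin (A * ?y \<tau> w)) :: complex) \<le> 2 / (x - t) * 1"
          unfolding norm_of_real abs_mult
          using y[OF \<tau> \<open>w \<in> {0..1}\<close>] y0[OF \<tau> \<open>w \<in> {0..1}\<close>] t by (intro mult_mono) (auto intro!: divide_left_mono)
        moreover have "norm (amp q j k c (t - \<tau>) w) \<le> B"
          by (rule B(2)[rule_format]) (use \<tau> \<open>w \<in> {0..1}\<close> in auto)
        ultimately have "norm (?p \<tau> w) * norm (of_real (2 / ?y \<tau> w * sin (A * ?y \<tau> w)) :: complex) \<le> (H * B) * (2 / (x - t) * 1)"
          unfolding norm_mult[of "h \<tau>"] using B(1) H[OF \<tau>] H0 t by (intro mult_mono) (auto simp del: of_real_mult of_real_divide of_real_power)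
        then show ?thesis by (simp only: norm_mult mult_1_right mult.assoc)
      qed
    qed
    show "((\<lambda>A. ?I A w) \<longlongrightarrow> 0) at_top" if w: "w \<in> {0..1} - {w \<in> {0..1}. \<alpha> w = 0}" for w
    proof -
      let ?r = "\<lambda>\<tau>. (t - \<tau>) ^ j * bes k (c w * (t - \<tau>)\<^sup>2) * (2 / ?y \<tau> w)"
      let ?d = "\<lambda>\<tau>. - (j * (t - \<tau>) ^ (j - 1) * bes k (c w * (t - \<tau>)\<^sup>2) +
          (t - \<tau>) ^ j * (bes (Suc k) (c w * (t - \<tau>)\<^sup>2) * (c w * (2 * (t - \<tau>)))))"
      let ?r' = "\<lambda>\<tau>. ?d \<tau> * (2 / ?y \<tau> w) + - (2 * \<alpha> w / (?y \<tau> w)\<^sup>2) * ((t - \<tau>) ^ j * bes k (c w * (t - \<tau>)\<^sup>2))"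
      have w01: "w \<in> {0..1}" using w by simp
      have r: "(?r has_real_derivative ?r' \<tau>) (at \<tau> within {0..t})" if "\<tau> \<in> {0..t}" for \<tau>
      proof (rule DERIV_mult)
        have s: "((\<lambda>\<tau>. c w * (t - \<tau>)\<^sup>2) has_real_derivative - (c w * (2 * (t - \<tau>)))) (at \<tau> within {0..t})"
          by (auto intro!: derivative_eq_intros simp: algebra_simps)
        show "((\<lambda>\<tau>. (t - \<tau>) ^ j * bes k (c w * (t - \<tau>)\<^sup>2)) has_real_derivative ?d \<tau>) (at \<tau> within {0..t})"
          by (rule derivative_eq_intros DERIV_bes_chain[OF s] refl | simp)+
        show "((\<lambda>\<tau>. 2 / ?y \<tau> w) has_real_derivative - (2 * \<alpha> w / (?y \<tau> w)\<^sup>2)) (at \<tau> within {0..t})"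
          using y0[OF that w01] by (auto intro!: derivative_eq_intros simp: power2_eq_square)
      qed
      let ?\<phi> = "\<lambda>\<tau>. h \<tau> * (q w * of_real (?r \<tau>))"
      let ?\<phi>' = "\<lambda>\<tau>. h \<tau> * (q w * of_real (?r' \<tau>)) + h' \<tau> * (q w * of_real (?r \<tau>))"
      have "((\<lambda>A. integral {0..t} (\<lambda>\<tau>. ?\<phi> \<tau> * of_real (sin (A * ((x - t * \<alpha> w) + \<alpha> w * \<tau>))))) \<longlongrightarrow> 0) at_top"
      proof (rule riemann_lebesgue_C1)
        show "(?\<phi> has_vector_derivative ?\<phi>' \<tau>) (at \<tau> within {0..t})" if "\<tau> \<in> {0..t}" for \<tau>
          by (intro has_vector_derivative_mult has_vector_derivative_mult_right has_vector_derivative_of_real h r that)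
        show "continuous_on {0..t} ?\<phi>'"
          using w01 by (intro continuous_intros ch ch') (auto simp: ynz)
      qed (use w t in auto)
      then show ?thesis
        by (simp add: algebra_simps)
    qed
  qed (use fin in auto)
  then have "((\<lambda>A. integral {0..1} (?I A)) \<longlongrightarrow> 0) at_top" by simp
  then show ?thesis
    by (rule Lim_transform_eventually) (auto intro!: eventually_at_top_linorderI[of 0] simp: eq)
qed

lemma propagator_source:
  assumes "propagator M N" and t: "0 \<le> t" "t < x"
    and h: "\<And>\<tau>. \<tau> \<in> {0..t} \<Longrightarrow> (h has_vector_derivative h' \<tau>) (at \<tau> within {0..t})"
    and ch': "continuous_on {0..t} h'"
  shows "((\<lambda>A. integral {-A..A} (\<lambda>\<xi>. cis (\<xi> * x) * integral {0..t} (\<lambda>\<tau>. h \<tau> * M \<xi> (t - \<tau>)))) \<longlongrightarrow> 0) at_top"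
  using assms(1)
proof (induction rule: propagator.induct)
  case (atom q c \<alpha> j k)
  then show ?case
    by (intro atom_source[OF _ _ _ _ _ t h ch'])
next
  case (add M N M' N')
  have ch: "continuous_on {0..t} h"
    by (rule continuous_on_vector_derivative[OF h])
  have ch2: "continuous_on (X \<times> {0..t}) (\<lambda>z. h (snd z))" for X :: "real set"
    by (rule continuous_on_compose2[OF ch]) (auto intro: continuous_intros)
  note c = continuous_on_propagator_compose[OF add.hyps(1)] continuous_on_propagator_compose[OF add.hyps(2)]
  have "integral {0..t} (\<lambda>\<tau>. h \<tau> * (M \<xi> (t - \<tau>) + M' \<xi> (t - \<tau>))) =
     integral {0..t} (\<lambda>\<tau>. h \<tau> * M \<xi> (t - \<tau>)) + integral {0..t} (\<lambda>\<tau>. h \<tau> * M' \<xi> (t - \<tau>))" for \<xi>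
    unfolding distrib_left
    by (intro integral_add integrable_continuous_interval continuous_intros c ch)
  then have "integral {-A..A} (\<lambda>\<xi>. cis (\<xi> * x) * integral {0..t} (\<lambda>\<tau>. h \<tau> * (M \<xi> (t - \<tau>) + M' \<xi> (t - \<tau>)))) =
     integral {-A..A} (\<lambda>\<xi>. cis (\<xi> * x) * integral {0..t} (\<lambda>\<tau>. h \<tau> * M \<xi> (t - \<tau>))) +
     integral {-A..A} (\<lambda>\<xi>. cis (\<xi> * x) * integral {0..t} (\<lambda>\<tau>. h \<tau> * M' \<xi> (t - \<tau>)))" for A
    by (simp only: distrib_left, intro integral_add integrable_continuous_interval continuous_intros continuous_on_integral_real)
       (auto simp: case_prod_unfold intro!: continuous_intros c ch2)
  then show ?case
    using tendsto_add[OF add.IH] by simp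
qed

section \<open>Rapid decay beyond the light cone\<close>

text \<open>Uniform rapid decrease in x for bounded times. Starting at x = T + 1 keeps the points at distance at least 1 from the
light cone x = t.\<close>

definition rapid :: "(real \<Rightarrow> real \<Rightarrow> complex) \<Rightarrow> bool" where
  "rapid u \<longleftrightarrow> (\<forall>T>0. \<forall>E::nat. \<exists>C. \<forall>x\<ge>T + 1. \<forall>t\<in>{0<..T}. x ^ E * norm (u x t) \<le> C)"

text \<open>Rapid decrease of u and of all its mixed derivatives up to order k on x > t. The derivatives are
existentially quantified functions on this open region, so that the values of u elsewhere do not matter and
sums, multiples and functions that agree beyond the light cone need no computation of derivatives.\<close>

primrec decays :: "nat \<Rightarrow> (real \<Rightarrow> real \<Rightarrow> complex) \<Rightarrow> bool" where
  "decays 0 u \<longleftrightarrow> rapid u"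
| "decays (Suc k) u \<longleftrightarrow> rapid u \<and> (\<exists>ux ut.
     (\<forall>x t. 0 < t \<longrightarrow> t < x \<longrightarrow>
        ((\<lambda>y. u y t) has_vector_derivative ux x t) (at x) \<and>
        ((\<lambda>s. u x s) has_vector_derivative ut x t) (at t)) \<and>
     decays k ux \<and> decays k ut)"

lemma decays_rapid: "decays k u \<Longrightarrow> rapid u"
  by (cases k) auto

lemma rapid_add: "rapid u \<Longrightarrow> rapid v \<Longrightarrow> rapid (\<lambda>x t. u x t + v x t)"
  unfolding rapid_def
proof (intro allI impI)
  fix T :: real and E :: nat
  assume u: "\<forall>T>0. \<forall>E::nat. \<exists>C. \<forall>x\<ge>T + 1. \<forall>t\<in>{0<..T}. x ^ E * norm (u x t) \<le> C"
    and v: "\<forall>T>0. \<forall>E::nat. \<exists>C. \<forall>x\<ge>T + 1. \<forall>t\<in>{0<..T}. x ^ E * norm (v x t) \<le> C" and T: "T > 0"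
  obtain C where C: "\<And>x t. x \<ge> T + 1 \<Longrightarrow> t \<in> {0<..T} \<Longrightarrow> x ^ E * norm (u x t) \<le> C"
    using u T by blast
  obtain D where D: "\<And>x t. x \<ge> T + 1 \<Longrightarrow> t \<in> {0<..T} \<Longrightarrow> x ^ E * norm (v x t) \<le> D"
    using v T by blast
  have "x ^ E * norm (u x t + v x t) \<le> C + D" if "x \<ge> T + 1" "t \<in> {0<..T}" for x t
  proof -
    have "x ^ E * norm (u x t + v x t) \<le> x ^ E * (norm (u x t) + norm (v x t))"
      using that T by (intro mult_left_mono norm_triangle_ineq) auto
    with C[OF that] D[OF that] show ?thesis
      by (simp add: distrib_left)
  qed
  then show "\<exists>C. \<forall>x\<ge>T + 1. \<forall>t\<in>{0<..T}. x ^ E * norm (u x t + v x t) \<le> C"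
    by blast
qed

lemma rapid_cmult: "rapid u \<Longrightarrow> rapid (\<lambda>x t. a * u x t)"
  unfolding rapid_def
proof (intro allI impI)
  fix T :: real and E :: nat
  assume u: "\<forall>T>0. \<forall>E::nat. \<exists>C. \<forall>x\<ge>T + 1. \<forall>t\<in>{0<..T}. x ^ E * norm (u x t) \<le> C" and T: "T > 0"
  obtain C where C: "\<And>x t. x \<ge> T + 1 \<Longrightarrow> t \<in> {0<..T} \<Longrightarrow> x ^ E * norm (u x t) \<le> C"
    using u T by blast
  have "x ^ E * norm (a * u x t) \<le> norm a * C" if "x \<ge> T + 1" "t \<in> {0<..T}" for x t
    using mult_left_mono[OF C[OF that] norm_ge_zero[of a]] by (simp add: norm_mult mult_ac)
  then show "\<exists>C. \<forall>x\<ge>T + 1. \<forall>t\<in>{0<..T}. x ^ E * norm (a * u x t) \<le> C"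
    by blast
qed

lemma decays_add: "decays k u \<Longrightarrow> decays k v \<Longrightarrow> decays k (\<lambda>x t. u x t + v x t)"
proof (induction k arbitrary: u v)
  case 0
  then show ?case by (simp add: rapid_add)
next
  case (Suc k)
  obtain ux ut where u: "\<And>x t. 0 < t \<Longrightarrow> t < x \<Longrightarrow> ((\<lambda>y. u y t) has_vector_derivative ux x t) (at x)"
      "\<And>x t. 0 < t \<Longrightarrow> t < x \<Longrightarrow> ((\<lambda>s. u x s) has_vector_derivative ut x t) (at t)"
      "decays k ux" "decays k ut"
    using Suc.prems(1) by auto
  obtain vx vt where v: "\<And>x t. 0 < t \<Longrightarrow> t < x \<Longrightarrow> ((\<lambda>y. v y t) has_vector_derivative vx x t) (at x)"
      "\<And>x t. 0 < t \<Longrightarrow> t < x \<Longrightarrow> ((\<lambda>s. v x s) has_vector_derivative vt x t) (at t)"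
      "decays k vx" "decays k vt"
    using Suc.prems(2) by auto
  show ?case
    unfolding decays.simps
    by (intro conjI exI[of _ "\<lambda>x t. ux x t + vx x t"] exI[of _ "\<lambda>x t. ut x t + vt x t"] allI impI
        has_vector_derivative_add u v Suc.IH rapid_add decays_rapid[OF Suc.prems(1)] decays_rapid[OF Suc.prems(2)])
qed

lemma decays_cmult: "decays k u \<Longrightarrow> decays k (\<lambda>x t. a * u x t)"
proof (induction k arbitrary: u)
  case 0
  then show ?case by (simp add: rapid_cmult)
next
  case (Suc k)
  obtain ux ut where u: "\<And>x t. 0 < t \<Longrightarrow> t < x \<Longrightarrow> ((\<lambda>y. u y t) has_vector_derivative ux x t) (at x)"
      "\<And>x t. 0 < t \<Longrightarrow> t < x \<Longrightarrow> ((\<lambda>s. u x s) has_vector_derivative ut x t) (at t)"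
      "decays k ux" "decays k ut"
    using Suc.prems by auto
  show ?case
    unfolding decays.simps
    by (intro conjI exI[of _ "\<lambda>x t. a * ux x t"] exI[of _ "\<lambda>x t. a * ut x t"] allI impI
        has_vector_derivative_mult_right u Suc.IH rapid_cmult decays_rapid[OF Suc.prems])
qed

lemma has_vector_derivative_cong_wedge:
  assumes eq: "\<And>x t. 0 < t \<Longrightarrow> t < x \<Longrightarrow> u x t = v x t" and t: "0 < t" "t < x"
  shows "((\<lambda>y. u y t) has_vector_derivative D) (at x) \<Longrightarrow> ((\<lambda>y. v y t) has_vector_derivative D) (at x)"
    and "((\<lambda>s. u x s) has_vector_derivative D') (at t) \<Longrightarrow> ((\<lambda>s. v x s) has_vector_derivative D') (at t)"
proof -
  assume "((\<lambda>y. u y t) has_vector_derivative D) (at x)"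
  then show "((\<lambda>y. v y t) has_vector_derivative D) (at x)"
    by (rule has_vector_derivative_transform_within_open[where S="{t<..}"]) (use t eq in auto)
next
  assume "((\<lambda>s. u x s) has_vector_derivative D') (at t)"
  then show "((\<lambda>s. v x s) has_vector_derivative D') (at t)"
    by (rule has_vector_derivative_transform_within_open[where S="{0<..<x}"]) (use t eq in auto)
qed

lemma decays_cong:
  assumes "decays k u" and eq: "\<And>x t. 0 < t \<Longrightarrow> t < x \<Longrightarrow> u x t = v x t"
  shows "decays k v"
proof -
  have r: "rapid v"
    unfolding rapid_def
  proof (intro allI impI)
    fix T :: real and E :: nat assume T: "T > 0"
    obtain C where C: "\<And>x t. x \<ge> T + 1 \<Longrightarrow> t \<in> {0<..T} \<Longrightarrow> x ^ E * norm (u x t) \<le> C"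
      using decays_rapid[OF assms(1)] T unfolding rapid_def by meson
    have "x ^ E * norm (v x t) \<le> C" if "x \<ge> T + 1" "t \<in> {0<..T}" for x t
      using C[OF that] eq[of t x] that by simp
    then show "\<exists>C. \<forall>x\<ge>T + 1. \<forall>t\<in>{0<..T}. x ^ E * norm (v x t) \<le> C"
      by blast
  qed
  show ?thesis
  proof (cases k)
    case 0
    with r show ?thesis by simp
  next
    case (Suc n)
    obtain ux ut where u: "\<And>x t. 0 < t \<Longrightarrow> t < x \<Longrightarrow> ((\<lambda>y. u y t) has_vector_derivative ux x t) (at x)"
      "\<And>x t. 0 < t \<Longrightarrow> t < x \<Longrightarrow> ((\<lambda>s. u x s) has_vector_derivative ut x t) (at t)"
      "decays n ux" "decays n ut"
      using assms(1) Suc by auto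
    show ?thesis
      unfolding Suc decays.simps
      using has_vector_derivative_cong_wedge[of u v, OF eq] u r by blast
  qed
qed

section \<open>Averages of rapidly decreasing families along rays\<close>

text \<open>A function on the closed quadrant together with all of its partial derivatives F n l. The family is part of
the data because differentiating an average of F n l produces averages of its neighbours F (n+1) l and F n (l+1).\<close>

definition schwartz_family :: "(nat \<Rightarrow> nat \<Rightarrow> real \<Rightarrow> real \<Rightarrow> complex) \<Rightarrow> bool" where
  "schwartz_family F \<longleftrightarrow> (\<forall>n l. continuous_on ({0..} \<times> {0..}) (\<lambda>(x, t). F n l x t) \<and>
     (\<forall>x\<ge>0. \<forall>t\<ge>0. ((\<lambda>y. F n l y t) has_vector_derivative F (Suc n) l x t) (at x within {0..}) \<and>
        ((\<lambda>s. F n l x s) has_vector_derivative F n (Suc l) x t) (at t within {0..})) \<and>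
     (\<forall>T>0. \<forall>E::nat. \<exists>C. \<forall>x>0. \<forall>t\<in>{0..T}. x ^ E * norm (F n l x t) \<le> C))"

lemma schwartz_family_continuous:
  assumes F: "schwartz_family F" and a: "continuous_on X a" "\<And>p. p \<in> X \<Longrightarrow> a p \<ge> 0"
    and b: "continuous_on X b" "\<And>p. p \<in> X \<Longrightarrow> b p \<ge> 0"
  shows "continuous_on X (\<lambda>p. F n l (a p) (b p))"
proof -
  have "continuous_on ({0..} \<times> {0..}) (\<lambda>(x, t). F n l x t)"
    using F by (auto simp: schwartz_family_def)
  from continuous_on_compose2[OF this continuous_on_Pair[OF a(1) b(1)]] show ?thesis
    using a(2) b(2) by auto
qed

text \<open>The chain rule along (x - sa, sb), a curve that may run in the boundary of the quadrant (b = 0), where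
only one-sided derivatives exist. The differentiability of F n l within the quadrant follows from its continuous
partial derivatives.\<close>

lemma schwartz_family_along_ray:
  assumes F: "schwartz_family F" and t: "0 < t" "t < x" and a: "\<bar>a\<bar> \<le> 1" "0 \<le> b"
  shows "((\<lambda>s. F n l (x - s * a) (s * b)) has_vector_derivative
     - of_real a * F (Suc n) l (x - t * a) (t * b) + of_real b * F n (Suc l) (x - t * a) (t * b)) (at t)"
proof -
  have D: "((\<lambda>y. F n l y t) has_vector_derivative F (Suc n) l x t) (at x within {0..})"
      "((\<lambda>s. F n l x s) has_vector_derivative F n (Suc l) x t) (at t within {0..})" if "x \<ge> 0" "t \<ge> 0" for x t n l
    using F that by (auto simp: schwartz_family_def)
  have C: "continuous_on ({0..} \<times> {0..}) (\<lambda>(x, t). F n l x t)" for n l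
    using F by (auto simp: schwartz_family_def)
  have ray: "x - s * a \<ge> 0" "s * b \<ge> 0" if "s \<in> {0..x}" for s
  proof -
    have "s * a \<le> s * 1" using that a by (intro mult_left_mono) auto
    then show "x - s * a \<ge> 0" using that by simp
  qed (use that a in auto)
  let ?x = "x - t * a" and ?y = "t * b"
  have xy: "?x \<ge> 0" "?y \<ge> 0" using ray[of t] t by auto
  have "((\<lambda>(x, y). F n l x y) has_derivative (\<lambda>(tx, ty). tx *\<^sub>R F (Suc n) l ?x ?y + blinfun_scaleR_left (F n (Suc l) ?x ?y) ty))
     (at (?x, ?y) within {0..} \<times> {0..})"
  proof (rule has_derivative_partialsI)
    show "((\<lambda>x. F n l x ?y) has_derivative (\<lambda>tx. tx *\<^sub>R F (Suc n) l ?x ?y)) (at ?x within {0..})"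
      using D(1)[OF xy] by (simp add: has_vector_derivative_def)
    show "((\<lambda>y. F n l x y) has_derivative blinfun_apply (blinfun_scaleR_left (F n (Suc l) x y))) (at y within {0..})"
      if "x \<in> {0..}" "y \<in> {0..}" for x y
      using D(2)[of x y] that by (simp add: has_vector_derivative_def)
    have "continuous_on ({0..} \<times> {0..}) (\<lambda>p. blinfun_scaleR_left (case p of (x, y) \<Rightarrow> F n (Suc l) x y))"
      by (intro bounded_linear.continuous_on[OF bounded_linear_blinfun_scaleR_left] C)
    then show "continuous (at (?x, ?y) within {0..} \<times> {0..}) (\<lambda>(x, y). blinfun_scaleR_left (F n (Suc l) x y))"
      using xy by (simp add: continuous_on_eq_continuous_within case_prod_unfold)
  qed (use xy in auto)
  then have "((\<lambda>(x, y). F n l x y) has_derivative (\<lambda>(tx, ty). tx *\<^sub>R F (Suc n) l ?x ?y + blinfun_scaleR_left (F n (Suc l) ?x ?y) ty))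
     (at (?x, ?y) within (\<lambda>s. (x - s * a, s * b)) ` {0..x})"
    by (rule has_derivative_subset) (use ray in auto)
  moreover have "((\<lambda>s. (x - s * a, s * b)) has_derivative (\<lambda>h. (- h * a, h * b))) (at t within {0..x})"
    by (auto intro!: derivative_eq_intros)
  ultimately have "((\<lambda>s. case (x - s * a, s * b) of (x, y) \<Rightarrow> F n l x y) has_derivative
      (\<lambda>h. case (- h * a, h * b) of (tx, ty) \<Rightarrow> tx *\<^sub>R F (Suc n) l ?x ?y + blinfun_scaleR_left (F n (Suc l) ?x ?y) ty)) (at t within {0..x})"
    by (rule has_derivative_in_compose[rotated])
  then have "((\<lambda>s. F n l (x - s * a) (s * b)) has_vector_derivative
     - of_real a * F (Suc n) l ?x ?y + of_real b * F n (Suc l) ?x ?y) (at t within {0..x})"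
    unfolding has_vector_derivative_def prod.case
    by (rule has_derivative_eq_rhs) (simp add: fun_eq_iff scaleR_conv_of_real algebra_simps)
  moreover have "at t within {0..x} = at t"
    using t by (intro at_within_interior) auto
  ultimately show ?thesis by simp
qed

text \<open>Averages over a square rather than over an interval, so that the superposition over the wave parameter w and the
integration over the emission time \<tau> = t\<sigma> of the forcing term have one common form.\<close>

definition spread ::
  "(nat \<Rightarrow> nat \<Rightarrow> real \<Rightarrow> real \<Rightarrow> complex) \<Rightarrow> (real \<times> real \<Rightarrow> complex) \<Rightarrow> nat \<Rightarrow> nat \<Rightarrow> (real \<times> real \<Rightarrow> real) \<Rightarrow>
     (real \<times> real \<Rightarrow> real) \<Rightarrow> (real \<times> real \<Rightarrow> real) \<Rightarrow> nat \<Rightarrow> nat \<Rightarrow> real \<Rightarrow> real \<Rightarrow> complex" where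
  "spread F q j k c \<alpha> \<beta> n l x t = integral (cbox (0, 0) (1, 1))
     (\<lambda>\<omega>. q \<omega> * of_real (t ^ j * bes k (c \<omega> * t\<^sup>2)) * F n l (x - t * \<alpha> \<omega>) (t * \<beta> \<omega>))"

context
  fixes F :: "nat \<Rightarrow> nat \<Rightarrow> real \<Rightarrow> real \<Rightarrow> complex" and \<alpha> \<beta> :: "real \<times> real \<Rightarrow> real" and Q :: "(real \<times> real) set"
  defines "Q \<equiv> cbox (0, 0) (1, 1)"
  assumes F: "schwartz_family F"
    and \<alpha>: "continuous_on Q \<alpha>" "\<And>\<omega>. \<omega> \<in> Q \<Longrightarrow> \<bar>\<alpha> \<omega>\<bar> \<le> 1"
    and \<beta>: "continuous_on Q \<beta>" "\<And>\<omega>. \<omega> \<in> Q \<Longrightarrow> \<beta> \<omega> \<in> {0..1}"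
begin

lemma ray_pos:
  assumes "0 \<le> t" "t < x" "\<omega> \<in> Q" shows "x - t * \<alpha> \<omega> > 0" "x - t * \<alpha> \<omega> \<ge> x - t" "t * \<beta> \<omega> \<in> {0..t}"
proof -
  have "t * \<alpha> \<omega> \<le> t * 1" using assms \<alpha>(2)[of \<omega>] by (intro mult_left_mono) auto
  then show "x - t * \<alpha> \<omega> > 0" "x - t * \<alpha> \<omega> \<ge> x - t" using assms by auto
  show "t * \<beta> \<omega> \<in> {0..t}" using assms \<beta>(2)[of \<omega>] by (auto simp: mult_left_le)
qed

lemma continuous_on_Q_snd:
  "continuous_on Q h \<Longrightarrow> X \<subseteq> UNIV \<times> Q \<Longrightarrow> continuous_on X (\<lambda>p. h (snd p))"
  by (rule continuous_on_compose2[of Q h]) (auto intro: continuous_intros)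

lemma continuous_on_spread_integrand:
  assumes q: "continuous_on Q q" and c: "continuous_on Q c"
    and X: "\<And>p. p \<in> X \<Longrightarrow> 0 \<le> b p \<and> b p < a p" and ab: "continuous_on X a" "continuous_on X b"
  shows "continuous_on (X \<times> Q) (\<lambda>p. q (snd p) * of_real (b (fst p) ^ j * bes k (c (snd p) * (b (fst p))\<^sup>2)) *
     F n l (a (fst p) - b (fst p) * \<alpha> (snd p)) (b (fst p) * \<beta> (snd p)))"
proof -
  have s: "X \<times> Q \<subseteq> UNIV \<times> Q" by auto
  have "continuous_on (X \<times> Q) (\<lambda>p. a (fst p))" "continuous_on (X \<times> Q) (\<lambda>p. b (fst p))"
    by (rule ab[THEN continuous_on_compose2]; auto intro: continuous_intros)+
  note ci = this continuous_on_Q_snd[OF q s] continuous_on_Q_snd[OF c s]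
    continuous_on_Q_snd[OF \<alpha>(1) s] continuous_on_Q_snd[OF \<beta>(1) s]
  have pos: "a (fst p) - b (fst p) * \<alpha> (snd p) \<ge> 0" "b (fst p) * \<beta> (snd p) \<ge> 0" if "p \<in> X \<times> Q" for p
    using ray_pos[of "b (fst p)" "a (fst p)" "snd p"] X[of "fst p"] that by auto
  have "continuous_on (X \<times> Q) (\<lambda>p. F n l (a (fst p) - b (fst p) * \<alpha> (snd p)) (b (fst p) * \<beta> (snd p)))"
    by (intro schwartz_family_continuous[OF F] continuous_intros ci pos)
  then show ?thesis
    by (intro continuous_intros ci)
qed

lemma spread_continuous:
  assumes "continuous_on Q q" "continuous_on Q c" "0 \<le> t" "t < x"
  shows "continuous_on Q (\<lambda>\<omega>. q \<omega> * of_real (t ^ j * bes k (c \<omega> * t\<^sup>2)) * F n l (x - t * \<alpha> \<omega>) (t * \<beta> \<omega>))"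
proof -
  have j1: "continuous_on ({0::real} \<times> Q) (\<lambda>p. q (snd p) * of_real (t ^ j * bes k (c (snd p) * t\<^sup>2)) *
     F n l (x - t * \<alpha> (snd p)) (t * \<beta> (snd p)))"
    using continuous_on_spread_integrand[of q c "{0::real}" "\<lambda>_. t" "\<lambda>_. x" j k n l] assms by simp
  have j2: "continuous_on Q (\<lambda>\<omega>. (0::real, \<omega>))" and j3: "(\<lambda>\<omega>. (0::real, \<omega>)) ` Q \<subseteq> {0} \<times> Q"
    by (auto intro: continuous_intros)
  show ?thesis
    using continuous_on_compose2[OF j1 j2 j3] by (simp only: fst_conv snd_conv)
qed

lemma spread_integrable:
  assumes "continuous_on Q q" "continuous_on Q c" "0 \<le> t" "t < x"
  shows "(\<lambda>\<omega>. q \<omega> * of_real (t ^ j * bes k (c \<omega> * t\<^sup>2)) * F n l (x - t * \<alpha> \<omega>) (t * \<beta> \<omega>)) integrable_on Q"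
  using spread_continuous[OF assms, of j k n l] unfolding Q_def by (rule integrable_continuous)

lemma spread_iterated:
  assumes "continuous_on Q q" "continuous_on Q c" "0 \<le> t" "t < x"
  shows "spread F q j k c \<alpha> \<beta> n l x t = integral {0..1} (\<lambda>\<sigma>. integral {0..1} (\<lambda>w.
     q (\<sigma>, w) * of_real (t ^ j * bes k (c (\<sigma>, w) * t\<^sup>2)) * F n l (x - t * \<alpha> (\<sigma>, w)) (t * \<beta> (\<sigma>, w))))"
  unfolding spread_def using integral_prod_continuous[OF spread_continuous[OF assms, of j k n l, unfolded Q_def]]
  by simp

text \<open>Points of the rays are at least x - T, and x \<le> (T + 1)(x - T) for x \<ge> T + 1, so decay at the ray point is
decay in x up to the factor (T + 1)^E.\<close>

lemma spread_rapid:
  assumes q: "continuous_on Q q" and c: "continuous_on Q c"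
  shows "rapid (spread F q j k c \<alpha> \<beta> n l)"
  unfolding rapid_def
proof (intro allI impI)
  fix T :: real and E :: nat assume T: "T > 0"
  obtain C where C: "\<And>x t. x > 0 \<Longrightarrow> t \<in> {0..T} \<Longrightarrow> x ^ E * norm (F n l x t) \<le> C"
    using F T unfolding schwartz_family_def by meson
  have C0: "C \<ge> 0" using C[of 1 0] T by (simp add: order_trans[OF norm_ge_zero])
  have "continuous_on ({0..T} \<times> Q) (\<lambda>p. q (snd p) * of_real (fst p ^ j * bes k (c (snd p) * (fst p)\<^sup>2)))"
    by (intro continuous_intros continuous_on_Q_snd q c) auto
  moreover have "compact ({0..T} \<times> Q)"
    unfolding Q_def by (intro compact_Times compact_Icc compact_cbox)
  ultimately obtain B where B: "B \<ge> 0" "\<And>p. p \<in> {0..T} \<times> Q \<Longrightarrow> norm (q (snd p) * of_real (fst p ^ j * bes k (c (snd p) * (fst p)\<^sup>2))) \<le> B"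
    using continuous_on_compact_bound by blast
  have "x ^ E * norm (spread F q j k c \<alpha> \<beta> n l x t) \<le> B * ((T + 1) ^ E * C)" if x: "x \<ge> T + 1" and t: "t \<in> {0<..T}" for x t
  proof -
    let ?f = "\<lambda>\<omega>. q \<omega> * of_real (t ^ j * bes k (c \<omega> * t\<^sup>2)) * F n l (x - t * \<alpha> \<omega>) (t * \<beta> \<omega>)"
    have x0: "0 < x" "0 \<le> t" "t < x" using x t T by auto
    have "norm (?f \<omega>) \<le> B * ((T + 1) ^ E * C) / x ^ E" if \<omega>: "\<omega> \<in> Q" for \<omega>
    proof -
      let ?y = "x - t * \<alpha> \<omega>"
      have y: "?y > 0" "?y \<ge> x - T" "t * \<beta> \<omega> \<in> {0..T}"
        using ray_pos[OF x0(2,3) \<omega>] t by (auto elim: order_trans[rotated])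
      \<comment> \<open>this is where x \<ge> T + 1 enters\<close>
      have "T * 1 \<le> T * (x - T)" using x T by (intro mult_left_mono) auto
      then have "x \<le> (T + 1) * (x - T)" by (simp add: algebra_simps)
      also have "\<dots> \<le> (T + 1) * ?y" using y T by (intro mult_left_mono) auto
      finally have "x ^ E \<le> ((T + 1) * ?y) ^ E" using x0 by (intro power_mono) auto
      then have "x ^ E * norm (F n l ?y (t * \<beta> \<omega>)) \<le> ((T + 1) * ?y) ^ E * norm (F n l ?y (t * \<beta> \<omega>))"
        by (intro mult_right_mono) auto
      also have "\<dots> = (T + 1) ^ E * (?y ^ E * norm (F n l ?y (t * \<beta> \<omega>)))"
        by (simp only: power_mult_distrib mult.assoc)
      also have "\<dots> \<le> (T + 1) ^ E * C"
        using C[OF y(1,3)] T by (intro mult_left_mono) auto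
      finally have "norm (F n l ?y (t * \<beta> \<omega>)) \<le> (T + 1) ^ E * C / x ^ E"
        using x0 by (simp add: field_simps)
      moreover have "norm (q \<omega> * of_real (t ^ j * bes k (c \<omega> * t\<^sup>2))) \<le> B"
        using B(2)[of "(t, \<omega>)"] \<omega> t by simp
      ultimately have "norm (q \<omega> * of_real (t ^ j * bes k (c \<omega> * t\<^sup>2))) * norm (F n l ?y (t * \<beta> \<omega>)) \<le> B * ((T + 1) ^ E * C / x ^ E)"
        using B(1) by (intro mult_mono) auto
      then show ?thesis
        by (simp only: norm_mult times_divide_eq_right)
    qed
    then have "norm (integral Q ?f) \<le> B * ((T + 1) ^ E * C) / x ^ E * measure lborel Q"
      unfolding Q_def
      by (rule has_integral_bound[rotated 2])
         (use B C0 T x0 spread_integrable[OF q c x0(2,3)] in \<open>auto simp: Q_def intro!: integrable_integral divide_nonneg_pos mult_nonneg_nonneg\<close>)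
    moreover have "measure lborel Q = 1" unfolding Q_def by (simp add: content_Pair)
    ultimately show ?thesis
      using x0 by (simp add: spread_def Q_def field_simps)
  qed
  then show "\<exists>C. \<forall>x\<ge>T + 1. \<forall>t\<in>{0<..T}. x ^ E * norm (spread F q j k c \<alpha> \<beta> n l x t) \<le> C"
    by blast
qed

lemma spread_dx:
  assumes q: "continuous_on Q q" and c: "continuous_on Q c" and t: "0 < t" "t < x"
  shows "((\<lambda>y. spread F q j k c \<alpha> \<beta> n l y t) has_vector_derivative spread F q j k c \<alpha> \<beta> (Suc n) l x t) (at x)"
proof -
  have "((\<lambda>y. spread F q j k c \<alpha> \<beta> n l y t) has_vector_derivative spread F q j k c \<alpha> \<beta> (Suc n) l x t) (at x within {t<..})"
    unfolding spread_def
  proof (rule leibniz_rule_vector_derivative)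
    fix y \<omega> assume y: "y \<in> {t<..}" and \<omega>: "\<omega> \<in> cbox (0::real, 0::real) (1, 1)"
    have p: "y - t * \<alpha> \<omega> > 0" "t * \<beta> \<omega> \<in> {0..t}" using ray_pos[of t y \<omega>] y \<omega> t by (auto simp: Q_def)
    have "((\<lambda>y. F n l y (t * \<beta> \<omega>)) has_vector_derivative F (Suc n) l (y - t * \<alpha> \<omega>) (t * \<beta> \<omega>)) (at (y - t * \<alpha> \<omega>) within {0..})"
      using F p by (auto simp: schwartz_family_def)
    moreover have "at (y - t * \<alpha> \<omega>) within {0..} = at (y - t * \<alpha> \<omega>)"
      using p by (intro at_within_open_subset[of _ "{0<..}"]) auto
    ultimately have "((\<lambda>y. F n l y (t * \<beta> \<omega>)) has_vector_derivative F (Suc n) l (y - t * \<alpha> \<omega>) (t * \<beta> \<omega>)) (at (y - t * \<alpha> \<omega>))"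
      by simp
    moreover have "((\<lambda>y. y - t * \<alpha> \<omega>) has_vector_derivative 1) (at y within {t<..})"
      by (auto intro!: derivative_eq_intros simp: has_real_derivative_iff_has_vector_derivative[symmetric])
    ultimately have "((\<lambda>y. F n l (y - t * \<alpha> \<omega>) (t * \<beta> \<omega>)) has_vector_derivative F (Suc n) l (y - t * \<alpha> \<omega>) (t * \<beta> \<omega>)) (at y within {t<..})"
      using vector_diff_chain_within[of "\<lambda>y. y - t * \<alpha> \<omega>" 1 y "{t<..}" "\<lambda>y. F n l y (t * \<beta> \<omega>)" "F (Suc n) l (y - t * \<alpha> \<omega>) (t * \<beta> \<omega>)"]
      by (simp add: o_def has_vector_derivative_at_within)
    then show "((\<lambda>y. q \<omega> * of_real (t ^ j * bes k (c \<omega> * t\<^sup>2)) * F n l (y - t * \<alpha> \<omega>) (t * \<beta> \<omega>)) has_vector_derivative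
        q \<omega> * of_real (t ^ j * bes k (c \<omega> * t\<^sup>2)) * F (Suc n) l (y - t * \<alpha> \<omega>) (t * \<beta> \<omega>)) (at y within {t<..})"
      by (rule has_vector_derivative_mult_right)
  next
    show "continuous_on ({t<..} \<times> cbox (0, 0) (1, 1)) (\<lambda>(y, \<omega>). q \<omega> * of_real (t ^ j * bes k (c \<omega> * t\<^sup>2)) *
        F (Suc n) l (y - t * \<alpha> \<omega>) (t * \<beta> \<omega>))"
      using continuous_on_spread_integrand[OF q c, of "{t<..}" "\<lambda>_. t" "\<lambda>y. y" j k "Suc n" l] t
      by (auto simp: Q_def case_prod_unfold intro: continuous_intros)
    show "(\<lambda>\<omega>. q \<omega> * of_real (t ^ j * bes k (c \<omega> * t\<^sup>2)) * F n l (y - t * \<alpha> \<omega>) (t * \<beta> \<omega>)) integrable_on cbox (0, 0) (1, 1)"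
      if "y \<in> {t<..}" for y
      using spread_integrable[OF q c, of t y j k n l] that t by (simp add: Q_def)
  qed (use t in auto)
  moreover have "at x within {t<..} = at x"
    using t by (intro at_within_open) auto
  ultimately show ?thesis by simp
qed

text \<open>Again an average of the same kind: the first two terms come from the weight, the last two from the moving
point.\<close>

lemma spread_dt:
  assumes q: "continuous_on Q q" and c: "continuous_on Q c" and t: "0 < t" "t < x"
  shows "((\<lambda>s. spread F q j k c \<alpha> \<beta> n l x s) has_vector_derivative
     spread F (\<lambda>\<omega>. of_nat j * q \<omega>) (j - 1) k c \<alpha> \<beta> n l x t
     + spread F (\<lambda>\<omega>. of_real (2 * c \<omega>) * q \<omega>) (Suc j) (Suc k) c \<alpha> \<beta> n l x t
     + (spread F (\<lambda>\<omega>. - of_real (\<alpha> \<omega>) * q \<omega>) j k c \<alpha> \<beta> (Suc n) l x t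
     + spread F (\<lambda>\<omega>. of_real (\<beta> \<omega>) * q \<omega>) j k c \<alpha> \<beta> n (Suc l) x t)) (at t)"
proof -
  let ?b = "\<lambda>s \<omega>. of_real (s ^ j * bes k (c \<omega> * s\<^sup>2)) :: complex"
  let ?t1 = "\<lambda>s \<omega>. of_nat j * q \<omega> * of_real (s ^ (j - 1) * bes k (c \<omega> * s\<^sup>2)) * F n l (x - s * \<alpha> \<omega>) (s * \<beta> \<omega>)"
  let ?t2 = "\<lambda>s \<omega>. of_real (2 * c \<omega>) * q \<omega> * of_real (s ^ Suc j * bes (Suc k) (c \<omega> * s\<^sup>2)) * F n l (x - s * \<alpha> \<omega>) (s * \<beta> \<omega>)"
  let ?t3 = "\<lambda>s \<omega>. - of_real (\<alpha> \<omega>) * q \<omega> * ?b s \<omega> * F (Suc n) l (x - s * \<alpha> \<omega>) (s * \<beta> \<omega>)"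
  let ?t4 = "\<lambda>s \<omega>. of_real (\<beta> \<omega>) * q \<omega> * ?b s \<omega> * F n (Suc l) (x - s * \<alpha> \<omega>) (s * \<beta> \<omega>)"
  let ?f' = "\<lambda>s \<omega>. ?t1 s \<omega> + ?t2 s \<omega> + (?t3 s \<omega> + ?t4 s \<omega>)"
  have cq: "continuous_on Q (\<lambda>\<omega>. of_nat j * q \<omega>)" "continuous_on Q (\<lambda>\<omega>. of_real (2 * c \<omega>) * q \<omega>)"
    "continuous_on Q (\<lambda>\<omega>. - of_real (\<alpha> \<omega>) * q \<omega>)" "continuous_on Q (\<lambda>\<omega>. of_real (\<beta> \<omega>) * q \<omega>)"
    by (intro continuous_intros q c \<alpha> \<beta>)+
  have "((\<lambda>s. spread F q j k c \<alpha> \<beta> n l x s) has_vector_derivative integral (cbox (0, 0) (1, 1)) (?f' t)) (at t within {0<..<x})"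
    unfolding spread_def
  proof (rule leibniz_rule_vector_derivative)
    fix s \<omega> assume s: "s \<in> {0<..<x}" and "\<omega> \<in> cbox (0::real, 0::real) (1, 1)"
    then have \<omega>: "\<omega> \<in> Q" by (simp add: Q_def)
    have b: "((\<lambda>s. s ^ j * bes k (c \<omega> * s\<^sup>2)) has_real_derivative
        (real j * s ^ (j - 1) * bes k (c \<omega> * s\<^sup>2) + s ^ j * (bes (Suc k) (c \<omega> * s\<^sup>2) * (2 * c \<omega> * s))))
        (at s within {0<..<x})"
      by (rule derivative_eq_intros DERIV_bes_chain refl | simp)+
    have r: "((\<lambda>s. F n l (x - s * \<alpha> \<omega>) (s * \<beta> \<omega>)) has_vector_derivative
     - of_real (\<alpha> \<omega>) * F (Suc n) l (x - s * \<alpha> \<omega>) (s * \<beta> \<omega>) + of_real (\<beta> \<omega>) * F n (Suc l) (x - s * \<alpha> \<omega>) (s * \<beta> \<omega>)) (at s within {0<..<x})"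
      using s \<omega> \<alpha>(2) \<beta>(2) by (intro has_vector_derivative_at_within[OF schwartz_family_along_ray[OF F]]) auto
    show "((\<lambda>s. q \<omega> * ?b s \<omega> * F n l (x - s * \<alpha> \<omega>) (s * \<beta> \<omega>)) has_vector_derivative ?f' s \<omega>) (at s within {0<..<x})"
      by (rule has_vector_derivative_eq_rhs[OF has_vector_derivative_mult[OF has_vector_derivative_mult_right[OF
            has_vector_derivative_of_real[OF b], of "q \<omega>"] r]])
         (simp add: algebra_simps)
  next
    show "(\<lambda>\<omega>. q \<omega> * ?b s \<omega> * F n l (x - s * \<alpha> \<omega>) (s * \<beta> \<omega>)) integrable_on cbox (0, 0) (1, 1)"
      if "s \<in> {0<..<x}" for s
      using spread_integrable[OF q c, of s x j k n l] that by (simp add: Q_def)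
    show "continuous_on ({0<..<x} \<times> cbox (0, 0) (1, 1)) (\<lambda>(s, \<omega>). ?f' s \<omega>)"
      unfolding case_prod_unfold Q_def[symmetric]
      by (intro continuous_on_add continuous_on_spread_integrand[where b="\<lambda>s. s" and a="\<lambda>_. x"] cq c continuous_intros) auto
  qed (use t in auto)
  moreover have "at t within {0<..<x} = at t"
    using t by (intro at_within_open) auto
  moreover have "integral (cbox (0, 0) (1, 1)) (?f' t) =
     spread F (\<lambda>\<omega>. of_nat j * q \<omega>) (j - 1) k c \<alpha> \<beta> n l x t
     + spread F (\<lambda>\<omega>. of_real (2 * c \<omega>) * q \<omega>) (Suc j) (Suc k) c \<alpha> \<beta> n l x t
     + (spread F (\<lambda>\<omega>. - of_real (\<alpha> \<omega>) * q \<omega>) j k c \<alpha> \<beta> (Suc n) l x t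
     + spread F (\<lambda>\<omega>. of_real (\<beta> \<omega>) * q \<omega>) j k c \<alpha> \<beta> n (Suc l) x t)"
    unfolding spread_def
    by (intro integral_unique has_integral_add integrable_integral spread_integrable[unfolded Q_def] cq[unfolded Q_def] c[unfolded Q_def])
       (use t in auto)
  ultimately show ?thesis by simp
qed

text \<open>Both partial derivatives of an average are sums of averages, so induction on the order of differentiation
reduces the claim to spread_rapid.\<close>

lemma spread_decays:
  assumes "continuous_on Q q" "continuous_on Q c"
  shows "decays K (spread F q j k c \<alpha> \<beta> n l)"
  using assms
proof (induction K arbitrary: q j k n l)
  case 0
  then show ?case by (simp add: spread_rapid)
next
  case (Suc K)
  have cq: "continuous_on Q (\<lambda>\<omega>. of_nat j * q \<omega>)" "continuous_on Q (\<lambda>\<omega>. of_real (2 * c \<omega>) * q \<omega>)"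
    "continuous_on Q (\<lambda>\<omega>. - of_real (\<alpha> \<omega>) * q \<omega>)" "continuous_on Q (\<lambda>\<omega>. of_real (\<beta> \<omega>) * q \<omega>)"
    by (intro continuous_intros Suc.prems \<alpha> \<beta>)+
  show ?case
    unfolding decays.simps
  proof (intro conjI exI allI impI)
    show "rapid (spread F q j k c \<alpha> \<beta> n l)"
      by (rule spread_rapid) (rule Suc.prems)+
    show "((\<lambda>y. spread F q j k c \<alpha> \<beta> n l y t) has_vector_derivative spread F q j k c \<alpha> \<beta> (Suc n) l x t) (at x)"
      if "0 < t" "t < x" for x t
      by (rule spread_dx[OF Suc.prems that])
    show "((\<lambda>s. spread F q j k c \<alpha> \<beta> n l x s) has_vector_derivative
     spread F (\<lambda>\<omega>. of_nat j * q \<omega>) (j - 1) k c \<alpha> \<beta> n l x t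
     + spread F (\<lambda>\<omega>. of_real (2 * c \<omega>) * q \<omega>) (Suc j) (Suc k) c \<alpha> \<beta> n l x t
     + (spread F (\<lambda>\<omega>. - of_real (\<alpha> \<omega>) * q \<omega>) j k c \<alpha> \<beta> (Suc n) l x t
     + spread F (\<lambda>\<omega>. of_real (\<beta> \<omega>) * q \<omega>) j k c \<alpha> \<beta> n (Suc l) x t)) (at t)"
      if "0 < t" "t < x" for x t
      by (rule spread_dt[OF Suc.prems that])
    show "decays K (spread F q j k c \<alpha> \<beta> (Suc n) l)"
      by (rule Suc.IH[OF Suc.prems])
    show "decays K (\<lambda>x t. spread F (\<lambda>\<omega>. of_nat j * q \<omega>) (j - 1) k c \<alpha> \<beta> n l x t
     + spread F (\<lambda>\<omega>. of_real (2 * c \<omega>) * q \<omega>) (Suc j) (Suc k) c \<alpha> \<beta> n l x t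
     + (spread F (\<lambda>\<omega>. - of_real (\<alpha> \<omega>) * q \<omega>) j k c \<alpha> \<beta> (Suc n) l x t
     + spread F (\<lambda>\<omega>. of_real (\<beta> \<omega>) * q \<omega>) j k c \<alpha> \<beta> n (Suc l) x t))"
      by (intro decays_add Suc.IH cq Suc.prems)
  qed
qed

end

text \<open>An average of initial data is an average over the square that is constant in the first variable, along rays
that stay at time 0.\<close>

lemma propagated_decays:
  assumes M: "propagator M N" and F: "schwartz_family F"
  shows "decays K (\<lambda>x t. N (\<lambda>y. F 0 0 y 0) t x)"
  using M
proof (induction rule: propagator.induct)
  case (atom q c \<alpha> j k)
  let ?Q = "cbox (0::real, 0::real) (1, 1)"
  have snd: "continuous_on ?Q (\<lambda>\<omega>. h (snd \<omega>))" if "continuous_on {0..1} h" for h :: "real \<Rightarrow> 'z::topological_space"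
    by (rule continuous_on_compose2[OF that]) (auto intro: continuous_intros simp: cbox_Pair_eq)
  note c = snd[OF atom(1)] snd[OF atom(2)] snd[OF atom(3)]
  have a: "\<bar>\<alpha> (snd \<omega>)\<bar> \<le> 1" if "\<omega> \<in> ?Q" for \<omega>
    using that atom(4) by (force simp: cbox_Pair_eq abs_le_iff)
  have b: "continuous_on ?Q (\<lambda>\<omega>. 0::real)" "\<And>\<omega>. \<omega> \<in> ?Q \<Longrightarrow> (0::real) \<in> {0..1}"
    by auto
  have "decays K (spread F (\<lambda>\<omega>. q (snd \<omega>)) j k (\<lambda>\<omega>. c (snd \<omega>)) (\<lambda>\<omega>. \<alpha> (snd \<omega>)) (\<lambda>\<omega>. 0) 0 0)"
    by (rule spread_decays[OF F c(3) a b c(1,2)])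
  then show ?case
  proof (rule decays_cong)
    fix x t :: real assume t: "0 < t" "t < x"
    have "spread F (\<lambda>\<omega>. q (snd \<omega>)) j k (\<lambda>\<omega>. c (snd \<omega>)) (\<lambda>\<omega>. \<alpha> (snd \<omega>)) (\<lambda>\<omega>. 0) 0 0 x t
      = integral {0..1::real} (\<lambda>\<sigma>. integral {0..1} (\<lambda>w. amp q j k c t w * F 0 0 (x - t * \<alpha> w) 0))"
      using spread_iterated[OF F c(3) a b c(1,2), where t=t and x=x and j=j and k=k and n=0 and l=0] t by simp
    then show "spread F (\<lambda>\<omega>. q (snd \<omega>)) j k (\<lambda>\<omega>. c (snd \<omega>)) (\<lambda>\<omega>. \<alpha> (snd \<omega>)) (\<lambda>\<omega>. 0) 0 0 x t
      = integral {0..1} (\<lambda>w. amp q j k c t w * F 0 0 (x - t * \<alpha> w) 0)"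
      by simp
  qed
next
  case (add M N M' N')
  then show ?case by (intro decays_add)
qed

lemma integral_stretch_unit:
  fixes f :: "real \<Rightarrow> complex"
  assumes "continuous_on {0..t} f" "t > 0"
  shows "integral {0..t} f = integral {0..1} (\<lambda>\<sigma>. of_real t * f (t * \<sigma>))"
proof -
  have "((\<lambda>x. f (t *\<^sub>R x + 0)) has_integral (1 / \<bar>t\<bar> ^ DIM(real)) *\<^sub>R integral {0..t} f)
      ((\<lambda>x. (1 / t) *\<^sub>R x + - ((1 / t) *\<^sub>R 0)) ` cbox 0 t)"
    using assms by (intro has_integral_affinity) (auto intro!: integrable_integral integrable_continuous_interval)
  moreover have "(\<lambda>x. (1 / t) *\<^sub>R x + - ((1 / t) *\<^sub>R 0)) ` cbox 0 t = {0..1}"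
    using assms by (simp add: image_mult_atLeastAtMost)
  ultimately have "((\<lambda>x. f (t * x)) has_integral integral {0..t} f / of_real t) {0..1}"
    using assms by (simp add: scaleR_conv_of_real divide_simps)
  from has_integral_mult_right[OF this, of "of_real t"] assms
  have "((\<lambda>\<sigma>. of_real t * f (t * \<sigma>)) has_integral integral {0..t} f) {0..1}"
    by simp
  then show ?thesis
    by (rule integral_unique[symmetric])
qed

lemma schwartz_family_continuous_swap:
  "schwartz_family F \<Longrightarrow> continuous_on ({0..t} \<times> {0<..}) (\<lambda>(\<tau>, y). F n l y \<tau>)"
  unfolding case_prod_unfold by (intro schwartz_family_continuous continuous_intros) auto

text \<open>The substitution \<tau> = t\<sigma> turns the integral over [0,t], whose domain moves with t, into an average over the fixed unit
square: the elapsed time is t(1 - \<sigma>), and its powers are split into powers of t and a weight in \<sigma>.\<close>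

lemma duhamel_decays:
  assumes M: "propagator M N" and F: "schwartz_family F"
  shows "decays K (\<lambda>x t. integral {0..t} (\<lambda>\<tau>. N (\<lambda>y. F 0 0 y \<tau>) (t - \<tau>) x))"
  using M
proof (induction rule: propagator.induct)
  case (atom q c \<alpha> j k)
  let ?Q = "cbox (0::real, 0::real) (1, 1)"
  note cL = schwartz_family_continuous_swap[OF F]
  have snd: "continuous_on ?Q (\<lambda>\<omega>. h (snd \<omega>))" if "continuous_on {0..1} h" for h :: "real \<Rightarrow> 'z::topological_space"
    by (rule continuous_on_compose2[OF that]) (auto intro: continuous_intros simp: cbox_Pair_eq)
  note s = snd[OF atom(1)] snd[OF atom(2)] snd[OF atom(3)]
  let ?q = "\<lambda>\<omega>. q (snd \<omega>) * of_real ((1 - fst \<omega>) ^ j)" and ?c = "\<lambda>\<omega>. c (snd \<omega>) * (1 - fst \<omega>)\<^sup>2"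
    and ?\<alpha> = "\<lambda>\<omega>. \<alpha> (snd \<omega>) * (1 - fst \<omega>)" and ?\<beta> = "\<lambda>\<omega>::real \<times> real. fst \<omega>"
  have c: "continuous_on ?Q ?q" "continuous_on ?Q ?c" "continuous_on ?Q ?\<alpha>" "continuous_on ?Q ?\<beta>"
    by (intro continuous_intros s)+
  have a: "\<bar>?\<alpha> \<omega>\<bar> \<le> 1" if "\<omega> \<in> ?Q" for \<omega>
  proof -
    have "\<bar>\<alpha> (snd \<omega>)\<bar> \<le> 1" "\<bar>1 - fst \<omega>\<bar> \<le> 1"
      using that atom(4) by (force simp: cbox_Pair_eq abs_le_iff)+
    then show ?thesis unfolding abs_mult by (rule mult_le_one[OF _ abs_ge_zero])
  qed
  have b: "?\<beta> \<omega> \<in> {0..1}" if "\<omega> \<in> ?Q" for \<omega>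
    using that by (auto simp: cbox_Pair_eq)
  have "decays K (spread F ?q (Suc j) k ?c ?\<alpha> ?\<beta> 0 0)"
    by (rule spread_decays[OF F c(3) a c(4) b c(1,2)])
  then show ?case
  proof (rule decays_cong)
    fix x t :: real assume t: "0 < t" "t < x"
    let ?\<phi> = "\<lambda>\<tau>. integral {0..1} (\<lambda>w. amp q j k c (t - \<tau>) w * F 0 0 (x - (t - \<tau>) * \<alpha> w) \<tau>)"
    have "spread F ?q (Suc j) k ?c ?\<alpha> ?\<beta> 0 0 x t
      = integral {0..1} (\<lambda>\<sigma>. integral {0..1} (\<lambda>w. q w * of_real ((1 - \<sigma>) ^ j) * of_real (t ^ Suc j * bes k (c w * (1 - \<sigma>)\<^sup>2 * t\<^sup>2))
          * F 0 0 (x - t * (\<alpha> w * (1 - \<sigma>))) (t * \<sigma>)))"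
      using spread_iterated[OF F c(3) a c(4) b c(1,2), where t=t and x=x and j="Suc j" and k=k and n=0 and l=0] t by simp
    also have "\<dots> = integral {0..1} (\<lambda>\<sigma>. of_real t * ?\<phi> (t * \<sigma>))"
    proof (rule integral_cong)
      fix \<sigma> :: real
      have e: "t - t * \<sigma> = t * (1 - \<sigma>)" by (simp add: algebra_simps)
      have "of_real t * ?\<phi> (t * \<sigma>) = integral {0..1} (\<lambda>w. of_real t * (amp q j k c (t - t * \<sigma>) w * F 0 0 (x - (t - t * \<sigma>) * \<alpha> w) (t * \<sigma>)))"
        by simp
      also have "\<dots> = integral {0..1} (\<lambda>w. q w * of_real ((1 - \<sigma>) ^ j) * of_real (t ^ Suc j * bes k (c w * (1 - \<sigma>)\<^sup>2 * t\<^sup>2))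
          * F 0 0 (x - t * (\<alpha> w * (1 - \<sigma>))) (t * \<sigma>))"
        unfolding e by (intro integral_cong) (simp add: power_mult_distrib mult_ac)
      finally show "integral {0..1} (\<lambda>w. q w * of_real ((1 - \<sigma>) ^ j) * of_real (t ^ Suc j * bes k (c w * (1 - \<sigma>)\<^sup>2 * t\<^sup>2))
          * F 0 0 (x - t * (\<alpha> w * (1 - \<sigma>))) (t * \<sigma>)) = of_real t * ?\<phi> (t * \<sigma>)" by simp
    qed
    also have "\<dots> = integral {0..t} ?\<phi>"
      using continuous_on_propagated[OF propagator.atom[OF atom] cL t(2), of j k] t
      by (intro integral_stretch_unit[symmetric]) auto
    finally show "spread F ?q (Suc j) k ?c ?\<alpha> ?\<beta> 0 0 x t = integral {0..t} ?\<phi>" .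
  qed
next
  case (add M N M' N')
  note cL = schwartz_family_continuous_swap[OF F]
  from decays_add[OF add.IH] show ?case
  proof (rule decays_cong)
    fix x t :: real assume t: "0 < t" "t < x"
    show "integral {0..t} (\<lambda>\<tau>. N (\<lambda>y. F 0 0 y \<tau>) (t - \<tau>) x) + integral {0..t} (\<lambda>\<tau>. N' (\<lambda>y. F 0 0 y \<tau>) (t - \<tau>) x)
       = integral {0..t} (\<lambda>\<tau>. N (\<lambda>y. F 0 0 y \<tau>) (t - \<tau>) x + N' (\<lambda>y. F 0 0 y \<tau>) (t - \<tau>) x)"
      by (intro integral_add[symmetric] integrable_continuous_interval
          continuous_on_propagated[OF add.hyps(1) cL t(2)] continuous_on_propagated[OF add.hyps(2) cL t(2)])
  qed
qed

section \<open>Smooth data as rapidly decreasing families\<close>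

lemma half_line_deriv_has_derivative:
  assumes "smooth_half_line g" "x \<ge> 0"
  shows "(half_line_deriv n g has_vector_derivative half_line_deriv (Suc n) g x) (at x within {0..})"
  using assms unfolding smooth_half_line_def
  by (auto simp: half_line_deriv_def vector_derivative_works[symmetric])

lemma continuous_on_half_line_deriv:
  assumes "smooth_half_line g" shows "continuous_on {0..} (half_line_deriv n g)"
  by (rule continuous_on_vector_derivative[OF half_line_deriv_has_derivative[OF assms]]) simp

lemma half_line_deriv_0: "half_line_deriv 0 g = g"
  by (simp add: half_line_deriv_def)

text \<open>Functions of x alone, regarded as independent of time.\<close>

lemma schwartz_family_half_line:
  assumes "schwartz_half_line g"
  shows "schwartz_family (\<lambda>n l x t. if l = 0 then half_line_deriv n g x else 0)"
proof -
  have g: "smooth_half_line g" using assms by (simp add: schwartz_half_line_def)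
  have "continuous_on ({0..} \<times> {0..}) (\<lambda>p. half_line_deriv n g (fst p))" for n
    by (rule continuous_on_compose2[OF continuous_on_half_line_deriv[OF g]]) (auto intro: continuous_intros)
  moreover have "\<exists>C. \<forall>x>0. \<forall>t\<in>{0..T}. x ^ E * norm (if l = 0 then half_line_deriv n g x else 0) \<le> C" for E n l and T :: real
  proof -
    have "bdd_above ((\<lambda>x. x ^ E * norm (half_line_deriv n g x)) ` {0..})"
      using assms by (simp add: schwartz_half_line_def)
    then obtain C where C: "\<And>x. x \<ge> 0 \<Longrightarrow> x ^ E * norm (half_line_deriv n g x) \<le> C"
      unfolding bdd_above_def by auto
    then have "x ^ E * norm (if l = 0 then half_line_deriv n g x else 0) \<le> max C 0" if "x > 0" for x
      using that by (auto intro: max.coboundedI1)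
    then show ?thesis by blast
  qed
  moreover have "continuous_on ({0..} \<times> {0..}) (\<lambda>(x::real, t::real). if l = 0 then half_line_deriv n g x else 0)" for n l :: nat
    using calculation(1) by (cases "l = 0") (auto simp: case_prod_unfold)
  moreover have "((\<lambda>y. if l = 0 then half_line_deriv n g y else 0) has_vector_derivative
      (if l = 0 then half_line_deriv (Suc n) g x else 0)) (at x within {0..})" if "x \<ge> 0" for x and n l :: nat
    using half_line_deriv_has_derivative[OF g that] by (cases "l = 0") auto
  moreover have "((\<lambda>s::real. if l = 0 then half_line_deriv n g x else 0) has_vector_derivative
      (if Suc l = 0 then half_line_deriv n g x else 0)) (at t within {0..})" for x t and n l :: nat
    by simp
  ultimately show ?thesis
    unfolding schwartz_family_def by blast
qed

text \<open>Symmetry of second derivatives up to the boundary of the quadrant. Writing u(y,s) = u(y,0) + \<integral> u_t(y,r) dr over [0,s] and differentiating under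
the integral gives u_x(x,s) = u_x(x,0) + \<integral> u_tx(x,r) dr, and this is differentiable in s.\<close>

lemma mixed_partial_commute:
  fixes u ux ut utx :: "real \<Rightarrow> real \<Rightarrow> complex"
  assumes ux: "\<And>x t. x \<ge> 0 \<Longrightarrow> t \<ge> 0 \<Longrightarrow> ((\<lambda>y. u y t) has_vector_derivative ux x t) (at x within {0..})"
    and ut: "\<And>x t. x \<ge> 0 \<Longrightarrow> t \<ge> 0 \<Longrightarrow> ((\<lambda>s. u x s) has_vector_derivative ut x t) (at t within {0..})"
    and utx: "\<And>x t. x \<ge> 0 \<Longrightarrow> t \<ge> 0 \<Longrightarrow> ((\<lambda>y. ut y t) has_vector_derivative utx x t) (at x within {0..})"
    and cont: "continuous_on ({0..} \<times> {0..}) (\<lambda>(x, t). utx x t)"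
    and x: "x \<ge> 0" and t: "t \<ge> 0"
  shows "((\<lambda>s. ux x s) has_vector_derivative utx x t) (at t within {0..})"
proof -
  have ftc: "(ut y has_integral u y s - u y 0) {0..s}" if "y \<ge> 0" "s \<ge> 0" for y s
    by (rule fundamental_theorem_of_calculus)
       (use that ut in \<open>auto intro: has_vector_derivative_within_subset[of _ _ _ "{0..}"]\<close>)
  \<comment> \<open>differentiation under the integral, compared with ux by uniqueness of one-sided derivatives\<close>
  have ux_eq: "ux x s = ux x 0 + integral {0..s} (utx x)" if s: "s \<ge> 0" for s
  proof -
    have "((\<lambda>y. integral (cbox 0 s) (ut y)) has_vector_derivative integral (cbox 0 s) (utx x)) (at x within {0..})"
    proof (rule leibniz_rule_vector_derivative)
      show "((\<lambda>y. ut y r) has_vector_derivative utx y r) (at y within {0..})" if "y \<in> {0..}" "r \<in> cbox 0 s" for y r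
        using that by (intro utx) auto
      show "ut y integrable_on cbox 0 s" if "y \<in> {0..}" for y
        using ftc[of y s] that s by auto
      show "continuous_on ({0..} \<times> cbox 0 s) (\<lambda>(y, r). utx y r)"
        by (rule continuous_on_subset[OF cont]) auto
    qed (use x in auto)
    then have "((\<lambda>y. u y 0 + integral (cbox 0 s) (ut y)) has_vector_derivative ux x 0 + integral {0..s} (utx x)) (at x within {0..})"
      using has_vector_derivative_add[OF ux[OF x order_refl]] by simp
    then have "((\<lambda>y. u y s) has_vector_derivative ux x 0 + integral {0..s} (utx x)) (at x within {0..})"
      by (rule has_vector_derivative_transform[rotated 2])
         (use x s integral_unique[OF ftc] in auto)
    from has_vector_derivative_within_subset[OF this, of "cbox 0 (x + 1)"]
      has_vector_derivative_within_subset[OF ux[OF x s], of "cbox 0 (x + 1)"]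
    show ?thesis
      using vector_derivative_unique_within_closed_interval[of 0 "x + 1" x] x by simp
  qed
  have "continuous_on {0..t + 1} (\<lambda>s. (x, s))" "(\<lambda>s. (x, s)) ` {0..t + 1} \<subseteq> {0..} \<times> {0..}"
    using x by (auto intro: continuous_intros)
  from continuous_on_compose2[OF cont this] have "continuous_on {0..t + 1} (utx x)"
    by simp
  then have "((\<lambda>s. integral {0..s} (utx x)) has_vector_derivative utx x t) (at t within {0..t + 1})"
    by (rule integral_has_vector_derivative) (use t in auto)
  from has_vector_derivative_add[OF has_vector_derivative_const[of "ux x 0"] this]
  have "((\<lambda>s. ux x 0 + integral {0..s} (utx x)) has_vector_derivative utx x t) (at t within {0..t + 1})"
    by simp
  then have "((\<lambda>s. ux x s) has_vector_derivative utx x t) (at t within {0..t + 1})"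
    by (rule has_vector_derivative_transform[rotated 2]) (use t in simp, rule ux_eq, simp)
  moreover have "at t within {0..t + 1} = at t within {0..}"
    by (rule at_within_nhd[of _ "{..<t + 1}"]) auto
  ultimately show ?thesis by simp
qed

text \<open>In mixed_partial the derivatives in t are taken first. That differentiating in t once more leads to the next member
of the family is therefore a commutation statement, proved by induction on the number of x-derivatives.\<close>

lemma schwartz_family_mixed_partial:
  assumes f: "smooth_on closed_quadrant f"
    and bound: "\<And>T n l E. T > 0 \<Longrightarrow>
       bdd_above ((\<lambda>(x, t). x ^ E * norm (mixed_partial closed_quadrant n l f x t)) ` ({0<..} \<times> {0..T}))"
  shows "schwartz_family (\<lambda>n l. mixed_partial closed_quadrant n l f)"
proof -
  let ?m = "\<lambda>n l. mixed_partial closed_quadrant n l f"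
  have sec: "{y. (y, t) \<in> closed_quadrant} = {0..}" "{s. (t, s) \<in> closed_quadrant} = {0..}" if "t \<ge> 0" for t
    using that by (auto simp: closed_quadrant_def)
  have cont: "continuous_on ({0..} \<times> {0..}) (\<lambda>(x, t). ?m n l x t)" for n l
    using f by (auto simp: smooth_on_def closed_quadrant_def)
  have diff: "partially_differentiable closed_quadrant (?m n l) x t" if "x \<ge> 0" "t \<ge> 0" for n l x t
    using f that by (auto simp: smooth_on_def closed_quadrant_def)
  have dx: "((\<lambda>y. ?m n l y t) has_vector_derivative ?m (Suc n) l x t) (at x within {0..})" if "x \<ge> 0" "t \<ge> 0" for n l x t
    using diff[OF that, of n l] that
    by (simp add: partially_differentiable_def sec mixed_partial_def partial_x_def vector_derivative_works)
  have dt: "((\<lambda>s. ?m n l x s) has_vector_derivative ?m n (Suc l) x t) (at t within {0..})" if "x \<ge> 0" "t \<ge> 0" for n l x t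
    using that
  proof (induction n arbitrary: l x t)
    case 0
    then show ?case
      using diff[OF 0, of 0 l]
      by (simp add: partially_differentiable_def sec mixed_partial_def partial_t_def vector_derivative_works)
  next
    case (Suc n)
    show ?case
      by (rule mixed_partial_commute[OF dx Suc.IH dx cont Suc.prems])
  qed
  have "\<exists>C. \<forall>x>0. \<forall>t\<in>{0..T}. x ^ E * norm (?m n l x t) \<le> C" if "T > 0" for T E n l
    using bound[OF that, of E n l] unfolding bdd_above_def by (fastforce simp: image_iff)
  with cont dx dt show ?thesis
    unfolding schwartz_family_def by blast
qed

section \<open>Partial derivatives beyond the light cone\<close>

lemma wedge_at_within:
  assumes "0 < t" "t < x"
  shows "at x within {y. (y, t) \<in> Psi_domain} = at x" "at t within {s. (x, s) \<in> Psi_domain} = at t"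
proof -
  show "at x within {y. (y, t) \<in> Psi_domain} = at x"
    by (rule at_within_open_subset[of _ "{t<..}"]) (use assms in \<open>auto simp: Psi_domain_def\<close>)
  show "at t within {s. (x, s) \<in> Psi_domain} = at t"
    by (rule at_within_open_subset[of _ "{0<..<x}"]) (use assms in \<open>auto simp: Psi_domain_def\<close>)
qed

lemma decays_partial:
  assumes "decays (Suc k) u" and eq: "\<And>x t. 0 < t \<Longrightarrow> t < x \<Longrightarrow> u x t = v x t"
  shows "\<exists>w. decays k w \<and> (\<forall>x t. 0 < t \<longrightarrow> t < x \<longrightarrow> w x t = partial_x Psi_domain v x t)"
    and "\<exists>w. decays k w \<and> (\<forall>x t. 0 < t \<longrightarrow> t < x \<longrightarrow> w x t = partial_t Psi_domain v x t)"
proof -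
  obtain ux ut where u: "\<And>x t. 0 < t \<Longrightarrow> t < x \<Longrightarrow> ((\<lambda>y. u y t) has_vector_derivative ux x t) (at x)"
      "\<And>x t. 0 < t \<Longrightarrow> t < x \<Longrightarrow> ((\<lambda>s. u x s) has_vector_derivative ut x t) (at t)"
      "decays k ux" "decays k ut"
    using assms(1) by auto
  have "ux x t = partial_x Psi_domain v x t" "ut x t = partial_t Psi_domain v x t" if t: "0 < t" "t < x" for x t
    unfolding partial_x_def partial_t_def wedge_at_within[OF t]
    by (rule vector_derivative_at[symmetric], rule has_vector_derivative_cong_wedge(1)[of u v, OF eq t u(1)[OF t]],
        assumption, assumption)
       (rule vector_derivative_at[symmetric], rule has_vector_derivative_cong_wedge(2)[of u v, OF eq t u(2)[OF t]],
        assumption, assumption)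
  with u(3,4) show "\<exists>w. decays k w \<and> (\<forall>x t. 0 < t \<longrightarrow> t < x \<longrightarrow> w x t = partial_x Psi_domain v x t)"
    "\<exists>w. decays k w \<and> (\<forall>x t. 0 < t \<longrightarrow> t < x \<longrightarrow> w x t = partial_t Psi_domain v x t)"
    by blast+
qed

text \<open>Partial derivatives on the full domain of \<Psi> agree beyond the light cone with those provided by decays, since that region is
open.\<close>

lemma decays_mixed_partial:
  assumes "decays (k + n + l) u"
  shows "\<exists>w. decays k w \<and> (\<forall>x t. 0 < t \<longrightarrow> t < x \<longrightarrow> w x t = mixed_partial Psi_domain n l u x t)"
proof -
  have t: "\<exists>w. decays k w \<and> (\<forall>x t. 0 < t \<longrightarrow> t < x \<longrightarrow> w x t = (partial_t Psi_domain ^^ l) u x t)" if "decays (k + l) u" for k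
    using that
  proof (induction l arbitrary: k)
    case (Suc l)
    then obtain w where "decays (Suc k) w" "\<And>x t. 0 < t \<Longrightarrow> t < x \<Longrightarrow> w x t = (partial_t Psi_domain ^^ l) u x t"
      using Suc.IH[of "Suc k"] by auto
    from decays_partial(2)[OF this] show ?case by simp
  qed auto
  have "\<exists>w. decays k w \<and> (\<forall>x t. 0 < t \<longrightarrow> t < x \<longrightarrow> w x t = (partial_x Psi_domain ^^ n) ((partial_t Psi_domain ^^ l) u) x t)"
    if "decays (k + n + l) u" for k
    using that
  proof (induction n arbitrary: k)
    case 0
    then show ?case using t[of k] by simp
  next
    case (Suc n)
    then obtain w where "decays (Suc k) w" "\<And>x t. 0 < t \<Longrightarrow> t < x \<Longrightarrow> w x t = (partial_x Psi_domain ^^ n) ((partial_t Psi_domain ^^ l) u) x t"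
      using Suc.IH[of "Suc k"] by auto
    from decays_partial(1)[OF this] show ?case by simp
  qed
  with assms show ?thesis
    unfolding mixed_partial_def by blast
qed

lemma decays_imp_limit:
  assumes "\<And>K. decays K u" and T: "T > 0"
  shows "(\<forall>\<^sub>F x in at_top. \<forall>t\<in>{0<..T}. partially_differentiable Psi_domain (mixed_partial Psi_domain n l u) x t) \<and>
     uniform_limit {0<..T} (\<lambda>x t. of_real (x ^ E) * mixed_partial Psi_domain n l u x t) (\<lambda>t. 0) at_top"
proof -
  let ?v = "mixed_partial Psi_domain n l u"
  obtain w where w: "decays (Suc 0) w" "\<And>x t. 0 < t \<Longrightarrow> t < x \<Longrightarrow> w x t = ?v x t"
    using decays_mixed_partial[of "Suc 0" n l u] assms by blast
  obtain wx wt where d: "\<And>x t. 0 < t \<Longrightarrow> t < x \<Longrightarrow> ((\<lambda>y. w y t) has_vector_derivative wx x t) (at x)"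
      "\<And>x t. 0 < t \<Longrightarrow> t < x \<Longrightarrow> ((\<lambda>s. w x s) has_vector_derivative wt x t) (at t)"
    using w(1) by auto
  have "partially_differentiable Psi_domain ?v x t" if t: "0 < t" "t < x" for x t
    using has_vector_derivative_cong_wedge[of w ?v, OF w(2) t] d[OF t]
    unfolding partially_differentiable_def wedge_at_within[OF t]
    by (blast intro: differentiableI_vector)
  then have "\<forall>\<^sub>F x in at_top. \<forall>t\<in>{0<..T}. partially_differentiable Psi_domain ?v x t"
    by (intro eventually_at_top_linorderI[of "T + 1"]) auto
  moreover have "uniform_limit {0<..T} (\<lambda>x t. of_real (x ^ E) * ?v x t) (\<lambda>t. 0) at_top"
  proof (rule uniform_limitI)
    fix e :: real assume e: "e > 0"
    obtain C where C: "\<And>x t. x \<ge> T + 1 \<Longrightarrow> t \<in> {0<..T} \<Longrightarrow> x ^ Suc E * norm (w x t) \<le> C"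
      using decays_rapid[OF w(1)] T unfolding rapid_def by meson
    show "\<forall>\<^sub>F x in at_top. \<forall>t\<in>{0<..T}. dist (of_real (x ^ E) * ?v x t) 0 < e"
    proof (rule eventually_at_top_linorderI[of "max (T + 1) (\<bar>C\<bar> / e + 1)"], intro ballI)
      fix x t assume x: "x \<ge> max (T + 1) (\<bar>C\<bar> / e + 1)" and t: "t \<in> {0<..T}"
      have x0: "x > 0" "x > \<bar>C\<bar> / e" using x T by auto
      have "x * (x ^ E * norm (w x t)) \<le> C" using C[of x t] x t by simp
      also have "C < e * x" using x0(2) e by (simp add: field_simps)
      finally have "x ^ E * norm (w x t) < e"
        using x0(1) by (simp add: mult.commute[of e])
      then show "dist (of_real (x ^ E) * ?v x t) 0 < e"
        using w(2)[of t x] x t x0 by (simp add: norm_mult norm_power)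
    qed
  qed
  ultimately show ?thesis ..
qed

section \<open>Improper integrals over the frequency line\<close>

text \<open>Local integrability is included because otherwise the limits below could not be added or recombined.\<close>

definition half_conv :: "(real \<Rightarrow> complex) \<Rightarrow> bool" where
  "half_conv F \<longleftrightarrow> (\<forall>A. set_integrable lborel {0..A} F) \<and> (\<exists>l. ((\<lambda>A. LBINT \<xi>:{0..A}. F \<xi>) \<longlongrightarrow> l) at_top)"

definition conv_integral :: "(real \<Rightarrow> complex) \<Rightarrow> bool" where
  "conv_integral F \<longleftrightarrow> half_conv F \<and> half_conv (\<lambda>\<xi>. F (- \<xi>))"

text \<open>Symmetric truncation is the form in which Fourier inversion yields its limit.\<close>

definition sym_integral :: "(real \<Rightarrow> complex) \<Rightarrow> complex \<Rightarrow> bool" where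
  "sym_integral F I \<longleftrightarrow> (\<forall>A. set_integrable lborel {-A..A} F) \<and> ((\<lambda>A. LBINT \<xi>:{-A..A}. F \<xi>) \<longlongrightarrow> I) at_top"

lemma half_conv_add: "half_conv F \<Longrightarrow> half_conv G \<Longrightarrow> half_conv (\<lambda>\<xi>. F \<xi> + G \<xi>)"
  unfolding half_conv_def by (auto simp: set_integral_add intro: tendsto_add)

lemma half_conv_cmult: "half_conv F \<Longrightarrow> half_conv (\<lambda>\<xi>. a * F \<xi>)"
  unfolding half_conv_def by (auto intro: tendsto_mult_left)

lemma conv_integral_add: "conv_integral F \<Longrightarrow> conv_integral G \<Longrightarrow> conv_integral (\<lambda>\<xi>. F \<xi> + G \<xi>)"
  by (simp add: conv_integral_def half_conv_add)

lemma conv_integral_cmult: "conv_integral F \<Longrightarrow> conv_integral (\<lambda>\<xi>. a * F \<xi>)"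
  by (simp add: conv_integral_def half_conv_cmult)

lemma set_integrable_reflect:
  fixes F :: "real \<Rightarrow> complex"
  assumes "set_integrable lborel {0..A} (\<lambda>\<xi>. F (- \<xi>))"
  shows "set_integrable lborel {-A..0} F"
proof -
  have "integrable lborel (\<lambda>x. indicator {0..A} (0 + (-1) * x) *\<^sub>R F (- (0 + (-1) * x)))"
    using assms unfolding set_integrable_def by (intro lborel_integrable_real_affine) auto
  moreover have "(\<lambda>x. indicator {0..A} (0 + (-1) * x) *\<^sub>R F (- (0 + (-1) * x))) = (\<lambda>x. indicator {-A..0} x *\<^sub>R F x)"
    by (auto simp: fun_eq_iff split: split_indicator)
  ultimately show ?thesis
    by (simp add: set_integrable_def)
qed

text \<open>The two half-line limits that define the generalized integral exist separately, so their sum is the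
symmetric limit.\<close>

lemma gen_integral_symmetric:
  assumes "conv_integral F" shows "sym_integral F (gen_integral F)"
proof -
  have i0: "set_integrable lborel {0..A} F" "set_integrable lborel {-A..0} F" for A
    using assms set_integrable_reflect by (auto simp: conv_integral_def half_conv_def)
  have i: "set_integrable lborel {-A..A} F" for A
    by (rule set_integrable_subset[OF set_integrable_Un[OF i0(2)[of A] i0(1)[of A]]]) auto
  have refl: "(LBINT \<xi>:{-A..0}. F \<xi>) = (LBINT \<xi>:{0..A}. F (- \<xi>))" for A
    using set_integral_reflect[of "{-A..0}" F] by (simp add: atLeastAtMost_def atLeast_def atMost_def Collect_conj_eq[symmetric] conj_commute)
  obtain l r where lim: "((\<lambda>A. LBINT \<xi>:{0..A}. F \<xi>) \<longlongrightarrow> r) at_top" "((\<lambda>A. LBINT \<xi>:{-A..0}. F \<xi>) \<longlongrightarrow> l) at_top"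
    using assms unfolding conv_integral_def half_conv_def refl by blast
  have "gen_integral F = r + l"
    unfolding gen_integral_def using lim[THEN tendsto_Lim[OF trivial_limit_at_top_linorder]] by simp
  moreover have "((\<lambda>A. LBINT \<xi>:{-A..A}. F \<xi>) \<longlongrightarrow> r + l) at_top"
  proof (rule Lim_transform_eventually[OF tendsto_add[OF lim]], rule eventually_at_top_linorderI)
    fix A :: real assume "A \<ge> 0"
    then show "(LBINT \<xi>:{0..A}. F \<xi>) + (LBINT \<xi>:{-A..0}. F \<xi>) = (LBINT \<xi>:{-A..A}. F \<xi>)"
      using Henstock_Kurzweil_Integration.integral_combine[of "-A" 0 A F] i[of A] i0[of A]
      by (simp add: set_borel_integral_eq_integral add.commute)
  qed
  ultimately show ?thesis
    unfolding sym_integral_def using i by simp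
qed

lemma sym_integral_add: "sym_integral F I \<Longrightarrow> sym_integral G J \<Longrightarrow> sym_integral (\<lambda>\<xi>. F \<xi> + G \<xi>) (I + J)"
  unfolding sym_integral_def by (auto simp: set_integral_add intro: tendsto_add)

lemma sym_integral_cmult: "sym_integral F I \<Longrightarrow> sym_integral (\<lambda>\<xi>. a * F \<xi>) (a * I)"
  unfolding sym_integral_def by (auto intro: tendsto_mult_left)

lemma sym_integral_diff: "sym_integral F I \<Longrightarrow> sym_integral G J \<Longrightarrow> sym_integral (\<lambda>\<xi>. F \<xi> - G \<xi>) (I - J)"
  using sym_integral_add[of F I "\<lambda>\<xi>. (-1) * G \<xi>" "(-1) * J"] sym_integral_cmult[of G J "-1"] by simp

lemma sym_integral_unique: "sym_integral F I \<Longrightarrow> sym_integral F J \<Longrightarrow> I = J"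
  unfolding sym_integral_def using tendsto_unique[OF trivial_limit_at_top_linorder] by blast

text \<open>The frequency 0 is excluded since the symbols with denominator \<rho> have no meaning there when m = 0.\<close>

lemma sym_integral_cong:
  assumes "sym_integral F I" "\<And>\<xi>. \<xi> \<noteq> 0 \<Longrightarrow> F \<xi> = G \<xi>"
  shows "sym_integral G I"
proof -
  have "integrable lborel (\<lambda>\<xi>. indicator {-A..A} \<xi> *\<^sub>R F \<xi>) = integrable lborel (\<lambda>\<xi>. indicator {-A..A} \<xi> *\<^sub>R G \<xi>)" for A
    by (rule integrable_discrete_difference[of "{0}"]) (use assms(2) in auto)
  moreover have "(LBINT \<xi>. indicator {-A..A} \<xi> *\<^sub>R F \<xi>) = (LBINT \<xi>. indicator {-A..A} \<xi> *\<^sub>R G \<xi>)" for A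
    by (rule integral_discrete_difference[of "{0}"]) (use assms(2) in auto)
  ultimately show ?thesis
    using assms(1) by (simp add: sym_integral_def set_integrable_def set_lebesgue_integral_def)
qed

lemma sym_integral_integrable:
  assumes "integrable lborel F" shows "sym_integral F (LBINT \<xi>. F \<xi>)"
  unfolding sym_integral_def
proof
  have u: "set_integrable lborel UNIV F"
    using assms by (simp add: set_integrable_def)
  show "\<forall>A. set_integrable lborel {-A..A} F"
    by (auto intro: set_integrable_subset[OF u])
  show "((\<lambda>A. LBINT \<xi>:{-A..A}. F \<xi>) \<longlongrightarrow> (LBINT \<xi>. F \<xi>)) at_top"
    unfolding set_lebesgue_integral_def
  proof (rule integral_dominated_convergence_at_top)
    show "F \<in> borel_measurable lborel" "\<And>A. (\<lambda>\<xi>. indicator {-A..A} \<xi> *\<^sub>R F \<xi>) \<in> borel_measurable lborel"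
      using assms by auto
    show "integrable lborel (\<lambda>\<xi>. norm (F \<xi>))"
      using assms by auto
    show "\<forall>\<^sub>F A in at_top. AE \<xi> in lborel. norm (indicator {-A..A} \<xi> *\<^sub>R F \<xi>) \<le> norm (F \<xi>)"
      by (auto split: split_indicator)
    show "AE \<xi> in lborel. ((\<lambda>A. indicator {-A..A} \<xi> *\<^sub>R F \<xi>) \<longlongrightarrow> F \<xi>) at_top"
    proof (rule AE_I2)
      fix \<xi> :: real
      show "((\<lambda>A. indicator {-A..A} \<xi> *\<^sub>R F \<xi>) \<longlongrightarrow> F \<xi>) at_top"
        by (rule tendsto_eventually, rule eventually_at_top_linorderI[of "\<bar>\<xi>\<bar>"]) (auto split: split_indicator)
    qed
  qed
qed

lemma sym_integral_continuous:
  assumes "continuous_on UNIV F" "((\<lambda>A. integral {-A..A} F) \<longlongrightarrow> I) at_top"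
  shows "sym_integral F I"
proof -
  have "set_integrable lborel {-A..A} F" for A
    by (intro borel_integrable_atLeastAtMost' continuous_on_subset[OF assms(1)]) auto
  then show ?thesis
    using assms(2) by (simp add: sym_integral_def set_borel_integral_eq_integral)
qed

section \<open>Oscillatory integrals\<close>

text \<open>Integration by parts turns the conditionally convergent integral into an absolutely convergent one. The
denominator 1 + \<xi> has the behaviour of \<xi> at infinity without its zero.\<close>

lemma half_conv_oscillation:
  assumes "d \<noteq> 0" shows "half_conv (\<lambda>\<xi>. cis (\<xi> * d) / of_real (1 + \<xi>))"
  unfolding half_conv_def
proof (intro conjI allI exI)
  have c: "continuous_on {0..A} (\<lambda>\<xi>. cis (\<xi> * d) / of_real (1 + \<xi>))" for A
  proof -
    have "complex_of_real (1 + \<xi>) \<noteq> 0" if "\<xi> \<in> {0..A}" for \<xi>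
      using that unfolding of_real_eq_0_iff by simp
    then show ?thesis by (intro continuous_intros) auto
  qed
  then show "set_integrable lborel {0..A} (\<lambda>\<xi>. cis (\<xi> * d) / of_real (1 + \<xi>))" for A
    by (rule borel_integrable_atLeastAtMost')
  \<comment> \<open>?P is the boundary term of the integration by parts, and ?r the remaining integrand\<close>
  let ?r = "\<lambda>\<xi>. cis (\<xi> * d) * of_real (inverse ((1 + \<xi>)\<^sup>2)) / (\<i> * of_real d)"
  let ?P = "\<lambda>\<xi>. cis (\<xi> * d) * of_real (inverse (1 + \<xi>)) / (\<i> * of_real d)"
  have r: "decay2 (1 / \<bar>d\<bar>) ?r"
    unfolding decay2_def
  proof (intro conjI allI impI)
    show "continuous_on {0..} ?r"
      using assms by (intro continuous_intros) auto
    fix y :: real assume "y \<ge> 0"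
    then have "1 + y\<^sup>2 \<le> (1 + y)\<^sup>2" by (simp add: power2_sum)
    moreover have "0 < 1 + y\<^sup>2" by (simp add: add_pos_nonneg)
    ultimately have "inverse ((1 + y)\<^sup>2) \<le> 1 / (1 + y\<^sup>2)"
      by (simp add: inverse_eq_divide frac_le)
    then have "inverse ((1 + y)\<^sup>2) / \<bar>d\<bar> \<le> 1 / (1 + y\<^sup>2) / \<bar>d\<bar>"
      by (intro divide_right_mono) auto
    then show "norm (?r y) \<le> 1 / \<bar>d\<bar> / (1 + y\<^sup>2)"
      unfolding norm_mult norm_divide norm_cis norm_of_real norm_ii mult_1 by (simp add: mult.commute)
  qed
  have ftc: "integral {0..A} (\<lambda>\<xi>. cis (\<xi> * d) / of_real (1 + \<xi>)) = ?P A - ?P 0 + integral {0..A} ?r" if "A \<ge> 0" for A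
  proof -
    have "((\<lambda>\<xi>. cis (\<xi> * d) / of_real (1 + \<xi>) - ?r \<xi>) has_integral ?P A - ?P 0) {0..A}"
    proof (rule fundamental_theorem_of_calculus[OF that])
      fix \<xi> assume \<xi>: "\<xi> \<in> {0..A}"
      have 1: "((\<lambda>\<xi>. cis (\<xi> * d)) has_vector_derivative \<i> * of_real d * cis (\<xi> * d)) (at \<xi> within {0..A})"
        by (rule has_vector_derivative_cis) (auto intro!: derivative_eq_intros)
      have "((\<lambda>\<xi>. inverse (1 + \<xi>)) has_real_derivative - inverse ((1 + \<xi>)\<^sup>2)) (at \<xi> within {0..A})"
        using \<xi> by (auto intro!: derivative_eq_intros simp: power2_eq_square)
      from has_vector_derivative_divide[OF has_vector_derivative_mult[OF 1 has_vector_derivative_of_real[OF this]], of "\<i> * of_real d"]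
      show "(?P has_vector_derivative cis (\<xi> * d) / of_real (1 + \<xi>) - ?r \<xi>) (at \<xi> within {0..A})"
      proof (rule has_vector_derivative_eq_rhs)
        have "(c * - Y + \<i> * D * c * X) / (\<i> * D) = c * X - c * Y / (\<i> * D)" if "D \<noteq> 0" for c D X Y :: complex
          using that by (simp add: field_simps)
        note aux = this
        show "(cis (\<xi> * d) * of_real (- inverse ((1 + \<xi>)\<^sup>2)) + \<i> * of_real d * cis (\<xi> * d) * of_real (inverse (1 + \<xi>))) / (\<i> * of_real d)
          = cis (\<xi> * d) / of_real (1 + \<xi>) - ?r \<xi>"
          unfolding of_real_minus of_real_inverse divide_inverse[of "cis (\<xi> * d)" "of_real (1 + \<xi>)"]
          by (rule aux) (use assms in simp)
      qed
    qed
    moreover have "(\<lambda>\<xi>. cis (\<xi> * d) / of_real (1 + \<xi>)) integrable_on {0..A}" "?r integrable_on {0..A}"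
      using c r by (auto intro!: integrable_continuous_interval simp: decay2_def intro: continuous_on_subset)
    ultimately show ?thesis
      using Henstock_Kurzweil_Integration.integral_diff[of "\<lambda>\<xi>. cis (\<xi> * d) / of_real (1 + \<xi>)" "{0..A}" ?r]
      by (simp add: integral_unique)
  qed
  have "((\<lambda>A. 1 / (1 + A) / \<bar>d\<bar>) \<longlongrightarrow> 0) at_top"
    using assms by real_asymp
  then have "(?P \<longlongrightarrow> 0) at_top"
  proof (rule Lim_null_comparison[rotated], intro eventually_at_top_linorderI[of 0])
    show "norm (?P A) \<le> 1 / (1 + A) / \<bar>d\<bar>" if "A \<ge> 0" for A
      unfolding norm_divide norm_mult norm_cis norm_of_real norm_ii using that by (simp add: inverse_eq_divide)
  qed
  then have "((\<lambda>A. ?P A - ?P 0 + integral {0..A} ?r) \<longlongrightarrow> 0 - ?P 0 + (LBINT \<xi>:{0..}. ?r \<xi>)) at_top"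
    by (intro tendsto_intros decay2_tendsto(1)[OF r])
  then show "((\<lambda>A. LBINT \<xi>:{0..A}. cis (\<xi> * d) / of_real (1 + \<xi>)) \<longlongrightarrow> 0 - ?P 0 + (LBINT \<xi>:{0..}. ?r \<xi>)) at_top"
  proof (rule Lim_transform_eventually, intro eventually_at_top_linorderI[of 0])
    fix A :: real assume A: "A \<ge> 0"
    have "(LBINT \<xi>:{0..A}. cis (\<xi> * d) / of_real (1 + \<xi>)) = integral {0..A} (\<lambda>\<xi>. cis (\<xi> * d) / of_real (1 + \<xi>))"
      by (intro set_borel_integral_eq_integral borel_integrable_atLeastAtMost' c)
    then show "?P A - ?P 0 + integral {0..A} ?r = (LBINT \<xi>:{0..A}. cis (\<xi> * d) / of_real (1 + \<xi>))"
      by (simp only: ftc[OF A])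
  qed
qed

lemma half_conv_dominated:
  assumes m: "R \<in> borel_measurable borel" and b: "\<And>\<xi>. \<xi> \<ge> 0 \<Longrightarrow> norm (R \<xi>) \<le> C / (1 + \<xi>\<^sup>2)"
  shows "half_conv R"
proof -
  have i: "set_integrable lborel {0..} R"
    unfolding set_integrable_def
  proof (rule Bochner_Integration.integrable_bound)
    show "integrable lborel (\<lambda>y. indicator {0..} y *\<^sub>R (C / (1 + y\<^sup>2)))"
      using inverse_square_integrable by (simp add: set_integrable_def)
    show "(\<lambda>y. indicator {0..} y *\<^sub>R R y) \<in> borel_measurable lborel"
      using m by simp
    show "AE y in lborel. norm (indicator {0..} y *\<^sub>R R y) \<le> norm (indicator {0..} y *\<^sub>R (C / (1 + y\<^sup>2)))"
    proof (rule AE_I2)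
      fix y :: real
      have "C / (1 + y\<^sup>2) \<le> \<bar>C\<bar> / (1 + y\<^sup>2)"
        by (intro divide_right_mono) auto
      then show "norm (indicator {0..} y *\<^sub>R R y) \<le> norm (indicator {0..} y *\<^sub>R (C / (1 + y\<^sup>2)))"
        using order_trans[OF b[of y]] by (auto split: split_indicator)
    qed
  qed
  show ?thesis
    unfolding half_conv_def
  proof (intro conjI allI exI)
    show "set_integrable lborel {0..A} R" for A
      by (rule set_integrable_subset[OF i]) auto
    show "((\<lambda>A. LBINT \<xi>:{0..A}. R \<xi>) \<longlongrightarrow> (LBINT \<xi>:{0..}. R \<xi>)) at_top"
      by (intro tendsto_set_lebesgue_integral_at_top i) auto
  qed
qed

text \<open>Equality up to O(1/\<xi>) with a bounded leading term. Boundedness makes the relation compatible with products.\<close>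

definition asy :: "(real \<Rightarrow> complex) \<Rightarrow> (real \<Rightarrow> complex) \<Rightarrow> bool" where
  "asy f g \<longleftrightarrow> (\<exists>C. \<forall>\<xi>\<ge>1. norm (f \<xi> - g \<xi>) \<le> C / \<xi>) \<and> (\<exists>B. \<forall>\<xi>\<ge>1. norm (g \<xi>) \<le> B)"

lemma asyI: "(\<And>\<xi>. \<xi> \<ge> 1 \<Longrightarrow> norm (f \<xi> - g \<xi>) \<le> C / \<xi>) \<Longrightarrow> (\<And>\<xi>. \<xi> \<ge> 1 \<Longrightarrow> norm (g \<xi>) \<le> B) \<Longrightarrow> asy f g"
  unfolding asy_def by blast

lemma asy_const: "asy (\<lambda>\<xi>. a) (\<lambda>\<xi>. a)"
  by (rule asyI[of _ _ 0 "norm a"]) auto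

lemma asy_add: "asy f g \<Longrightarrow> asy f' g' \<Longrightarrow> asy (\<lambda>\<xi>. f \<xi> + f' \<xi>) (\<lambda>\<xi>. g \<xi> + g' \<xi>)"
proof -
  assume "asy f g" "asy f' g'"
  then obtain C B C' B' where *: "\<And>\<xi>. \<xi> \<ge> 1 \<Longrightarrow> norm (f \<xi> - g \<xi>) \<le> C / \<xi>" "\<And>\<xi>. \<xi> \<ge> 1 \<Longrightarrow> norm (g \<xi>) \<le> B"
     "\<And>\<xi>. \<xi> \<ge> 1 \<Longrightarrow> norm (f' \<xi> - g' \<xi>) \<le> C' / \<xi>" "\<And>\<xi>. \<xi> \<ge> 1 \<Longrightarrow> norm (g' \<xi>) \<le> B'"
    unfolding asy_def by metis
  show ?thesis
  proof (rule asyI)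
    fix \<xi> :: real assume \<xi>: "\<xi> \<ge> 1"
    have "norm (f \<xi> + f' \<xi> - (g \<xi> + g' \<xi>)) \<le> norm (f \<xi> - g \<xi>) + norm (f' \<xi> - g' \<xi>)"
      by (rule norm_diff_triangle_ineq)
    also have "\<dots> \<le> (C + C') / \<xi>"
      using add_mono[OF *(1,3)[OF \<xi>]] by (simp add: add_divide_distrib)
    finally show "norm (f \<xi> + f' \<xi> - (g \<xi> + g' \<xi>)) \<le> (C + C') / \<xi>" .
    show "norm (g \<xi> + g' \<xi>) \<le> B + B'"
      using *(2,4)[OF \<xi>] by (rule norm_triangle_mono)
  qed
qed

lemma asy_mult: "asy f g \<Longrightarrow> asy f' g' \<Longrightarrow> asy (\<lambda>\<xi>. f \<xi> * f' \<xi>) (\<lambda>\<xi>. g \<xi> * g' \<xi>)"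
proof -
  assume "asy f g" "asy f' g'"
  then obtain C B C' B' where *: "\<And>\<xi>. \<xi> \<ge> 1 \<Longrightarrow> norm (f \<xi> - g \<xi>) \<le> C / \<xi>" "\<And>\<xi>. \<xi> \<ge> 1 \<Longrightarrow> norm (g \<xi>) \<le> B"
     "\<And>\<xi>. \<xi> \<ge> 1 \<Longrightarrow> norm (f' \<xi> - g' \<xi>) \<le> C' / \<xi>" "\<And>\<xi>. \<xi> \<ge> 1 \<Longrightarrow> norm (g' \<xi>) \<le> B'"
    unfolding asy_def by metis
  have nn: "C \<ge> 0" "B \<ge> 0" "C' \<ge> 0" "B' \<ge> 0"
    using *(1)[of 1] *(2)[of 1] *(3)[of 1] *(4)[of 1] by (auto intro: order_trans[OF norm_ge_zero])
  show ?thesis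
  proof (rule asyI)
    fix \<xi> :: real assume \<xi>: "\<xi> \<ge> 1"
    have "C / \<xi> \<le> C" using \<xi> nn by (simp add: divide_le_eq mult_left_le mult_le_cancel_left1)
    have "norm (f \<xi> * f' \<xi> - g \<xi> * g' \<xi>) = norm ((f \<xi> - g \<xi>) * (f' \<xi> - g' \<xi>) + (f \<xi> - g \<xi>) * g' \<xi> + g \<xi> * (f' \<xi> - g' \<xi>))"
      by (simp add: algebra_simps)
    also have "\<dots> \<le> norm (f \<xi> - g \<xi>) * norm (f' \<xi> - g' \<xi>) + norm (f \<xi> - g \<xi>) * norm (g' \<xi>) + norm (g \<xi>) * norm (f' \<xi> - g' \<xi>)"
      by (metis (no_types, lifting) norm_mult norm_triangle_mono order_refl)
    also have "\<dots> \<le> C * (C' / \<xi>) + (C / \<xi>) * B' + B * (C' / \<xi>)"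
      using *[OF \<xi>] nn \<xi> \<open>C / \<xi> \<le> C\<close> by (intro add_mono mult_mono) (auto intro: order_trans)
    also have "\<dots> = (C * C' + C * B' + B * C') / \<xi>"
      by (simp add: add_divide_distrib)
    finally show "norm (f \<xi> * f' \<xi> - g \<xi> * g' \<xi>) \<le> (C * C' + C * B' + B * C') / \<xi>" .
    show "norm (g \<xi> * g' \<xi>) \<le> B * B'"
      unfolding norm_mult using *(2,4)[OF \<xi>] nn by (intro mult_mono) auto
  qed
qed

text \<open>Two oscillating terms of order 1/\<xi> converge conditionally, and the rest is O(1/\<xi>^2). Two frequencies are needed since an
integration over [0,t] leaves one contribution from each endpoint.\<close>

lemma half_conv_asy:
  assumes m: "F \<in> borel_measurable borel" and b: "\<And>\<xi>. \<xi> \<ge> 0 \<Longrightarrow> norm (F \<xi>) \<le> B"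
    and a: "asy (\<lambda>\<xi>. of_real \<xi> * F \<xi>) (\<lambda>\<xi>. a * cis (\<xi> * d) + a' * cis (\<xi> * d'))" and d: "d \<noteq> 0" "d' \<noteq> 0"
  shows "half_conv F"
proof -
  let ?g = "\<lambda>\<xi>. a * cis (\<xi> * d) + a' * cis (\<xi> * d')"
  let ?K = "norm a + norm a'"
  have g: "norm (?g \<xi>) \<le> ?K" for \<xi>
    by (rule order_trans[OF norm_triangle_ineq]) (simp add: norm_mult)
  obtain C where C: "\<And>\<xi>. \<xi> \<ge> 1 \<Longrightarrow> norm (of_real \<xi> * F \<xi> - ?g \<xi>) \<le> C / \<xi>"
    using a unfolding asy_def by blast
  have C0: "C \<ge> 0" using C[of 1] by (auto intro: order_trans[OF norm_ge_zero])
  have B0: "B \<ge> 0" using b[of 0] by (auto intro: order_trans[OF norm_ge_zero])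
  \<comment> \<open>the remainder after the leading term, with 1 + \<xi> in place of \<xi> to avoid the pole at 0\<close>
  let ?R = "\<lambda>\<xi>. F \<xi> - ?g \<xi> / of_real (1 + \<xi>)"
  have "half_conv ?R"
  proof (rule half_conv_dominated)
    show "?R \<in> borel_measurable borel"
    proof -
      have "?g \<in> borel_measurable borel" "(\<lambda>\<xi>. complex_of_real (1 + \<xi>)) \<in> borel_measurable borel"
        by (auto intro!: borel_measurable_continuous_onI continuous_intros)
      with m show ?thesis by measurable
    qed
    fix \<xi> :: real assume \<xi>: "\<xi> \<ge> 0"
    have pos: "0 < 1 + \<xi>\<^sup>2" by (simp add: add_pos_nonneg)
    show "norm (?R \<xi>) \<le> (2 * (B + ?K) + 2 * (C + ?K)) / (1 + \<xi>\<^sup>2)"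
    proof (cases "\<xi> \<ge> 1")
      case False
      have "norm (?g \<xi> / of_real (1 + \<xi>)) \<le> ?K / 1"
        unfolding norm_divide norm_of_real using g[of \<xi>] \<xi> by (intro frac_le) auto
      then have "norm (?R \<xi>) \<le> B + ?K"
        using order_trans[OF norm_triangle_ineq4 add_mono[OF b[OF \<xi>]]] by simp
      moreover have "(B + ?K) * (1 + \<xi>\<^sup>2) \<le> (B + ?K) * 2"
        using B0 False \<xi> by (intro mult_left_mono) (auto simp: power_le_one)
      ultimately have "norm (?R \<xi>) * (1 + \<xi>\<^sup>2) \<le> 2 * (B + ?K)"
        using mult_right_mono[of "norm (?R \<xi>)" "B + ?K" "1 + \<xi>\<^sup>2"] pos by linarith
      moreover have "0 \<le> 2 * (C + ?K)" using C0 by simp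
      ultimately have "norm (?R \<xi>) * (1 + \<xi>\<^sup>2) \<le> 2 * (B + ?K) + 2 * (C + ?K)" by linarith
      then show ?thesis using pos by (simp add: pos_le_divide_eq)
    next
      case True
      then have \<xi>0: "\<xi> > 0" by simp
      have "?R \<xi> = (of_real \<xi> * F \<xi> - ?g \<xi>) / of_real \<xi> + ?g \<xi> / of_real (\<xi> * (1 + \<xi>))"
      proof -
        have nz: "of_real \<xi> \<noteq> (0::complex)" "of_real (1 + \<xi>) \<noteq> (0::complex)"
          using \<xi>0 unfolding of_real_eq_0_iff by auto
        have "(z * f - g) / z + g / (z * y) = f - g / y" if "z \<noteq> 0" "y \<noteq> 0" "y = 1 + z" for z f g y :: complex
        proof -
          have "g / z - g / y = g * (y - z) / (z * y)"
            using that(1,2) by (simp add: diff_frac_eq right_diff_distrib)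
          also have "y - z = 1"
            using that(3) by simp
          finally have "g / (z * y) = g / z - g / y"
            by simp
          moreover have "(z * f - g) / z = f - g / z"
            using that(1) by (simp add: diff_divide_distrib)
          ultimately show ?thesis by simp
        qed
        note aux = this
        show ?thesis
          unfolding of_real_mult by (rule aux[symmetric]) (use nz in auto)
      qed
      also have "norm \<dots> \<le> C / \<xi> / \<xi> + ?K / (\<xi> * (1 + \<xi>))"
        using \<xi>0 by (intro order_trans[OF norm_triangle_ineq], unfold norm_divide norm_of_real)
           (simp only: abs_of_pos abs_mult add_pos_pos zero_less_one,
             intro add_mono divide_right_mono C[OF True] g; simp)
      also have "?K / (\<xi> * (1 + \<xi>)) \<le> ?K / (\<xi> * \<xi>)"
        using \<xi>0 by (intro divide_left_mono mult_left_mono) auto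
      also have "C / \<xi> / \<xi> + ?K / (\<xi> * \<xi>) = (C + ?K) / \<xi>\<^sup>2"
        by (simp add: power2_eq_square add_divide_distrib)
      finally have le: "norm (?R \<xi>) \<le> (C + ?K) / \<xi>\<^sup>2" by simp
      have aux: "y \<le> 2 * b + 2 * k" if "x * s \<le> k" "y \<le> x * (2 * s)" "0 \<le> 2 * b" for x y s k b :: real
        using that by simp
      from le have "norm (?R \<xi>) * \<xi>\<^sup>2 \<le> C + ?K"
        using \<xi>0 by (simp add: pos_le_divide_eq)
      moreover have "norm (?R \<xi>) * (1 + \<xi>\<^sup>2) \<le> norm (?R \<xi>) * (2 * \<xi>\<^sup>2)"
        using True by (intro mult_left_mono) auto
      moreover have "0 \<le> 2 * (B + ?K)" using B0 by simp
      ultimately have "norm (?R \<xi>) * (1 + \<xi>\<^sup>2) \<le> 2 * (B + ?K) + 2 * (C + ?K)" by (rule aux)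
      then show ?thesis using pos by (simp add: pos_le_divide_eq)
    qed
  qed
  from half_conv_add[OF this half_conv_add[OF half_conv_cmult[OF half_conv_oscillation[OF d(1)], of a]
      half_conv_cmult[OF half_conv_oscillation[OF d(2)], of a']]]
  show ?thesis
    by (simp add: add_divide_distrib)
qed

section \<open>Convergence of the data and boundary integrals\<close>

lemma rho_even: "rho m (- \<xi>) = rho m \<xi>"
  by (simp add: rho_def)

lemma rho_nonneg: "rho m \<xi> \<ge> 0"
  by (simp add: rho_def)

lemma rho_ge: "\<bar>\<xi>\<bar> \<le> rho m \<xi>" "\<bar>m\<bar> \<le> rho m \<xi>"
  by (auto simp: rho_def intro: real_le_rsqrt)

lemma rho_diff: "\<xi> \<ge> 1 \<Longrightarrow> rho m \<xi> - \<xi> \<le> m\<^sup>2 / \<xi>"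
proof -
  assume \<xi>: "\<xi> \<ge> 1"
  have "(rho m \<xi> - \<xi>) * \<xi> \<le> (rho m \<xi> - \<xi>) * (rho m \<xi> + \<xi>)"
    using rho_ge(1)[of \<xi> m] \<xi> by (intro mult_left_mono) auto
  also have "\<dots> = m\<^sup>2"
    using rho_sq[of m \<xi>] by (simp add: power2_eq_square algebra_simps)
  finally show ?thesis
    using \<xi> by (simp add: pos_le_divide_eq)
qed

lemma continuous_on_rho [continuous_intros]: "continuous_on A f \<Longrightarrow> continuous_on A (\<lambda>x. rho m (f x))"
  unfolding rho_def by (intro continuous_intros)

lemma norm_cis_diff: "norm (cis a - cis b) \<le> \<bar>a - b\<bar>"
proof -
  have "norm (cis a - cis b) = norm (cis b) * norm (cis (a - b) - 1)"
    unfolding norm_mult[symmetric] right_diff_distrib cis_mult by simp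
  also have "\<dots> = 2 * \<bar>sin ((a - b) / 2)\<bar>"
    using dist_exp_i_1[of "a - b"] by (simp add: cis_conv_exp)
  also have "\<dots> \<le> \<bar>a - b\<bar>"
    using abs_sin_x_le_abs_x[of "(a - b) / 2"] by simp
  finally show ?thesis .
qed

text \<open>As \<rho> - \<xi> = O(1/\<xi>), the phase is asymptotically that of the massless wave, with frequency x - \<sigma>t. It does not
vanish away from the light cone.\<close>

lemma asy_phase: "asy (\<lambda>\<xi>. cis (\<xi> * x - \<sigma> * rho m \<xi> * t)) (\<lambda>\<xi>. cis (\<xi> * (x - \<sigma> * t)))"
proof (rule asyI)
  fix \<xi> :: real assume \<xi>: "\<xi> \<ge> 1"
  have "norm (cis (\<xi> * x - \<sigma> * rho m \<xi> * t) - cis (\<xi> * (x - \<sigma> * t))) \<le> \<bar>(\<xi> - rho m \<xi>) * (\<sigma> * t)\<bar>"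
    using norm_cis_diff[of "\<xi> * x - \<sigma> * rho m \<xi> * t" "\<xi> * (x - \<sigma> * t)"] by (simp add: algebra_simps)
  also have "\<dots> = (rho m \<xi> - \<xi>) * \<bar>\<sigma> * t\<bar>"
    using rho_ge(1)[of \<xi> m] \<xi> by (simp add: abs_mult)
  also have "\<dots> \<le> m\<^sup>2 / \<xi> * \<bar>\<sigma> * t\<bar>"
    by (intro mult_right_mono rho_diff \<xi>) auto
  finally show "norm (cis (\<xi> * x - \<sigma> * rho m \<xi> * t) - cis (\<xi> * (x - \<sigma> * t))) \<le> m\<^sup>2 * \<bar>\<sigma> * t\<bar> / \<xi>"
    by simp
  show "norm (cis (\<xi> * (x - \<sigma> * t))) \<le> 1"
    by simp
qed

text \<open>The two symbols \<xi>/\<rho> and (\<plusminus>\<rho> + m)/\<rho>: bounded, with limits at both infinities attained at rate 1/\<xi>.\<close>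

definition coefficient :: "(real \<Rightarrow> complex) \<Rightarrow> bool" where
  "coefficient a \<longleftrightarrow> a \<in> borel_measurable borel \<and> (\<forall>\<xi>. norm (a \<xi>) \<le> 2) \<and> (\<exists>a0. asy a (\<lambda>\<xi>. a0)) \<and> (\<exists>a0. asy (\<lambda>\<xi>. a (- \<xi>)) (\<lambda>\<xi>. a0))"

lemma asy_momentum: "asy (\<lambda>\<xi>. of_real (\<xi> / rho m \<xi>)) (\<lambda>\<xi>. 1)"
proof (rule asyI)
  fix \<xi> :: real assume \<xi>: "\<xi> \<ge> 1"
  have r: "rho m \<xi> \<ge> \<xi>" "rho m \<xi> > 0" using rho_ge(1)[of \<xi> m] \<xi> by auto
  have "norm (of_real (\<xi> / rho m \<xi>) - 1 :: complex) = \<bar>\<xi> / rho m \<xi> - 1\<bar>"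
    by (metis norm_of_real of_real_1 of_real_diff)
  also have "\<dots> = (rho m \<xi> - \<xi>) / rho m \<xi>"
    using r by (simp add: abs_if diff_divide_distrib)
  also have "\<dots> \<le> (m\<^sup>2 / \<xi>) / 1"
    using r \<xi> rho_diff[OF \<xi>] by (intro frac_le) auto
  finally show "norm (of_real (\<xi> / rho m \<xi>) - 1 :: complex) \<le> m\<^sup>2 / \<xi>" by simp
qed (rule order_refl)

lemma coefficient_momentum: "coefficient (\<lambda>\<xi>. of_real (\<xi> / rho m \<xi>))"
  unfolding coefficient_def
proof (intro conjI allI exI)
  show "(\<lambda>\<xi>. complex_of_real (\<xi> / rho m \<xi>)) \<in> borel_measurable borel"
    unfolding rho_def by measurable
  show "norm (complex_of_real (\<xi> / rho m \<xi>)) \<le> 2" for \<xi>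
    unfolding norm_of_real using rho_ge(1)[of \<xi> m] by (cases "rho m \<xi> = 0") (auto simp: abs_divide divide_le_eq)
  show "asy (\<lambda>\<xi>. of_real (\<xi> / rho m \<xi>)) (\<lambda>\<xi>. 1)"
    by (rule asy_momentum)
  show "asy (\<lambda>\<xi>. of_real (- \<xi> / rho m (- \<xi>))) (\<lambda>\<xi>. -1 * 1)"
    using asy_mult[OF asy_const[of "-1"] asy_momentum[of m]] by (simp add: rho_even)
qed

lemma coefficient_energy:
  assumes "m \<ge> 0" "e \<in> {-1, 1}"
  shows "coefficient (\<lambda>\<xi>. of_real ((e * rho m \<xi> + m) / rho m \<xi>))"
proof -
  have a: "asy (\<lambda>\<xi>. of_real ((e * rho m \<xi> + m) / rho m \<xi>)) (\<lambda>\<xi>. of_real e)"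
  proof (rule asyI)
    fix \<xi> :: real assume \<xi>: "\<xi> \<ge> 1"
    have r: "rho m \<xi> \<ge> \<xi>" "rho m \<xi> > 0" using rho_ge(1)[of \<xi> m] \<xi> by auto
    have "norm (of_real ((e * rho m \<xi> + m) / rho m \<xi>) - of_real e :: complex) = m / rho m \<xi>"
      unfolding of_real_diff[symmetric] norm_of_real using r assms by (simp add: add_divide_distrib)
    also have "\<dots> \<le> m / \<xi>"
      using r \<xi> assms by (intro divide_left_mono) auto
    finally show "norm (of_real ((e * rho m \<xi> + m) / rho m \<xi>) - of_real e :: complex) \<le> m / \<xi>" .
  qed (rule order_refl)
  show ?thesis
    unfolding coefficient_def rho_even
  proof (intro conjI allI exI)
    show "(\<lambda>\<xi>. complex_of_real ((e * rho m \<xi> + m) / rho m \<xi>)) \<in> borel_measurable borel"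
      unfolding rho_def by measurable
    show "norm (complex_of_real ((e * rho m \<xi> + m) / rho m \<xi>)) \<le> 2" for \<xi>
    proof (cases "rho m \<xi> = 0")
      case False
      then have r: "rho m \<xi> > 0" using rho_nonneg[of m \<xi>] by linarith
      have "\<bar>e * rho m \<xi> + m\<bar> \<le> \<bar>e * rho m \<xi>\<bar> + \<bar>m\<bar>" by (rule abs_triangle_ineq)
      also have "\<dots> \<le> 2 * rho m \<xi>"
        using rho_ge(2)[of m \<xi>] assms(2) r by (auto simp: abs_mult)
      finally show ?thesis
        unfolding norm_of_real abs_divide using r by (simp add: pos_divide_le_eq)
    qed simp
  qed (rule a)+
qed

text \<open>One integration by parts isolates the jump g(0) of the extended function, and the second shows that the remainder is smaller by a
factor 1/\<xi>.\<close>

lemma asy_half_ft: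
  assumes g: "decay2_C1 C g g'" and g': "decay2_C1 C' g' g''" and e: "e \<in> {-1, 1}"
  shows "asy (\<lambda>\<xi>. of_real \<xi> * half_ft g (e * \<xi>)) (\<lambda>\<xi>. g 0 / (\<i> * of_real e))"
proof (rule asyI)
  fix \<xi> :: real assume \<xi>: "\<xi> \<ge> 1"
  then have "of_real \<xi> * half_ft g (e * \<xi>) = (g 0 + half_ft g' (e * \<xi>)) / (\<i> * of_real e)"
    using half_ft_parts[OF g, of "e * \<xi>"] e by auto
  then have "of_real \<xi> * half_ft g (e * \<xi>) - g 0 / (\<i> * of_real e) = half_ft g' (e * \<xi>) / (\<i> * of_real e)"
    by (simp add: add_divide_distrib)
  then have "norm (of_real \<xi> * half_ft g (e * \<xi>) - g 0 / (\<i> * of_real e)) = norm (half_ft g' (e * \<xi>))"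
    using e by (auto simp: norm_divide)
  also have "\<dots> \<le> 3 * C' / \<xi>"
    using half_ft_bound_inverse[OF g', of "e * \<xi>"] \<xi> e by (auto simp: abs_mult)
  finally show "norm (of_real \<xi> * half_ft g (e * \<xi>) - g 0 / (\<i> * of_real e)) \<le> 3 * C' / \<xi>" .
qed auto

lemma conv_integral_initial:
  assumes a: "coefficient a" and g: "decay2_C1 C g g'" and g': "decay2_C1 C' g' g''" and e: "e \<in> {-1, 1}"
    and s: "\<sigma> \<in> {-1, 1}" and xt: "x \<noteq> t" "x \<noteq> - t"
  shows "conv_integral (\<lambda>\<xi>. cis (\<xi> * x - \<sigma> * rho m \<xi> * t) * a \<xi> * half_ft g (e * \<xi>))"
proof -
  have gd: "decay2 C g" using g by (simp add: decay2_C1_def)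
  have "half_conv (\<lambda>\<xi>. cis (\<xi> * x - \<sigma> * rho m \<xi> * t) * a \<xi> * half_ft g (e * \<xi>))"
    if am: "a \<in> borel_measurable borel" and ab: "\<And>\<xi>. norm (a \<xi>) \<le> 2" and aa: "asy a (\<lambda>\<xi>. a0)"
     and e: "e \<in> {-1, 1}" and xt: "x \<noteq> \<sigma> * t" for a a0 e x
  proof (rule half_conv_asy)
    have "(\<lambda>\<xi>. cis (\<xi> * x - \<sigma> * rho m \<xi> * t)) \<in> borel_measurable borel"
      by (intro borel_measurable_continuous_onI continuous_intros)
    moreover have "(\<lambda>\<xi>. half_ft g (e * \<xi>)) \<in> borel_measurable borel"
      by (intro borel_measurable_continuous_onI continuous_on_compose2[OF continuous_on_half_ft_UNIV[OF gd]] continuous_intros) auto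
    ultimately show "(\<lambda>\<xi>. cis (\<xi> * x - \<sigma> * rho m \<xi> * t) * a \<xi> * half_ft g (e * \<xi>)) \<in> borel_measurable borel"
      using am by measurable
    show "norm (cis (\<xi> * x - \<sigma> * rho m \<xi> * t) * a \<xi> * half_ft g (e * \<xi>)) \<le> 2 * (2 * C)" for \<xi>
      unfolding norm_mult norm_cis mult_1 by (intro mult_mono ab half_ft_bound[OF gd]) auto
    \<comment> \<open>there is only one oscillation; the second one has coefficient 0 and an arbitrary nonzero frequency\<close>
    show "asy (\<lambda>\<xi>. of_real \<xi> * (cis (\<xi> * x - \<sigma> * rho m \<xi> * t) * a \<xi> * half_ft g (e * \<xi>)))
        (\<lambda>\<xi>. (a0 * (g 0 / (\<i> * of_real e))) * cis (\<xi> * (x - \<sigma> * t)) + 0 * cis (\<xi> * 1))"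
      using asy_mult[OF asy_mult[OF asy_phase[of x \<sigma> m t] aa] asy_half_ft[OF g g' e]] by (simp add: mult_ac)
  qed (use xt in auto)
  note H = this
  have "half_conv (\<lambda>\<xi>. cis (\<xi> * x - \<sigma> * rho m \<xi> * t) * a \<xi> * half_ft g (e * \<xi>))"
  proof -
    obtain a0 where "asy a (\<lambda>\<xi>. a0)" using a unfolding coefficient_def by blast
    then show ?thesis
      using a e s xt unfolding coefficient_def by (intro H) auto
  qed
  moreover have "half_conv (\<lambda>\<xi>. cis (\<xi> * (- x) - \<sigma> * rho m \<xi> * t) * a (- \<xi>) * half_ft g ((- e) * \<xi>))"
  proof -
    obtain a0 where "asy (\<lambda>\<xi>. a (- \<xi>)) (\<lambda>\<xi>. a0)" using a unfolding coefficient_def by blast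
    then show ?thesis
      using a e s xt unfolding coefficient_def by (intro H) auto
  qed
  ultimately show ?thesis
    by (simp add: conv_integral_def rho_even)
qed

lemma time_parts:
  assumes h: "\<And>\<tau>. \<tau> \<in> {0..t} \<Longrightarrow> (h has_vector_derivative h' \<tau>) (at \<tau> within {0..t})"
    and ch': "continuous_on {0..t} h'" and r: "r \<noteq> 0" and t: "0 \<le> t"
  shows "integral {0..t} (\<lambda>\<tau>. h \<tau> * cis (r * \<tau>)) =
    (h t * cis (r * t) - h 0 - integral {0..t} (\<lambda>\<tau>. h' \<tau> * cis (r * \<tau>))) / (\<i> * of_real r)"
proof -
  have ch: "continuous_on {0..t} h"
    by (rule continuous_on_vector_derivative[OF h])
  have FI: "((\<lambda>\<tau>. h \<tau> * (\<i> * of_real r * cis (r * \<tau>)) + h' \<tau> * cis (r * \<tau>)) has_integral h t * cis (r * t) - h 0 * cis (r * 0)) {0..t}"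
  proof (rule fundamental_theorem_of_calculus[OF t])
    fix \<tau> assume \<tau>: "\<tau> \<in> {0..t}"
    have "((\<lambda>\<tau>. cis (r * \<tau>)) has_vector_derivative \<i> * of_real r * cis (r * \<tau>)) (at \<tau> within {0..t})"
      by (rule has_vector_derivative_cis) (auto intro!: derivative_eq_intros)
    from has_vector_derivative_mult[OF h[OF \<tau>] this]
    show "((\<lambda>\<tau>. h \<tau> * cis (r * \<tau>)) has_vector_derivative h \<tau> * (\<i> * of_real r * cis (r * \<tau>)) + h' \<tau> * cis (r * \<tau>)) (at \<tau> within {0..t})" .
  qed
  have FJ: "((\<lambda>\<tau>. h \<tau> * (\<i> * of_real r * cis (r * \<tau>)) + h' \<tau> * cis (r * \<tau>)) has_integral
      \<i> * of_real r * integral {0..t} (\<lambda>\<tau>. h \<tau> * cis (r * \<tau>)) + integral {0..t} (\<lambda>\<tau>. h' \<tau> * cis (r * \<tau>))) {0..t}"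
  proof (rule has_integral_add)
    have "((\<lambda>\<tau>. \<i> * of_real r * (h \<tau> * cis (r * \<tau>))) has_integral \<i> * of_real r * integral {0..t} (\<lambda>\<tau>. h \<tau> * cis (r * \<tau>))) {0..t}"
      by (intro has_integral_mult_right integrable_integral integrable_continuous_interval continuous_intros ch)
    then show "((\<lambda>\<tau>. h \<tau> * (\<i> * of_real r * cis (r * \<tau>))) has_integral \<i> * of_real r * integral {0..t} (\<lambda>\<tau>. h \<tau> * cis (r * \<tau>))) {0..t}"
      by (simp only: mult_ac)
    show "((\<lambda>\<tau>. h' \<tau> * cis (r * \<tau>)) has_integral integral {0..t} (\<lambda>\<tau>. h' \<tau> * cis (r * \<tau>))) {0..t}"
      by (intro integrable_integral integrable_continuous_interval continuous_intros ch')
  qed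
  have "\<i> * of_real r * integral {0..t} (\<lambda>\<tau>. h \<tau> * cis (r * \<tau>)) + integral {0..t} (\<lambda>\<tau>. h' \<tau> * cis (r * \<tau>))
     = h t * cis (r * t) - h 0"
    using has_integral_unique[OF FJ FI] by simp
  then show ?thesis
    using r by (simp add: field_simps)
qed

lemma time_integral_bound:
  assumes "continuous_on {0..t} h" "0 \<le> t"
  shows "\<exists>B\<ge>0. \<forall>r. norm (integral {0..t} (\<lambda>\<tau>. h \<tau> * cis (r * \<tau>))) \<le> B"
proof -
  obtain H where H: "H \<ge> 0" "\<And>\<tau>. \<tau> \<in> {0..t} \<Longrightarrow> norm (h \<tau>) \<le> H"
    using continuous_on_compact_bound[OF compact_Icc assms(1)] by metis
  have "norm (integral {0..t} (\<lambda>\<tau>. h \<tau> * cis (r * \<tau>))) \<le> H * (t - 0)" for r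
    by (rule integral_bound[OF assms(2)]) (auto intro!: continuous_intros assms(1) H(2)[simplified] simp: norm_mult)
  then show ?thesis
    using H(1) assms(2) by (intro exI[of _ "H * (t - 0)"]) auto
qed

lemma time_integral_decay:
  assumes h: "\<And>\<tau>. \<tau> \<in> {0..t} \<Longrightarrow> (h has_vector_derivative h' \<tau>) (at \<tau> within {0..t})"
    and ch': "continuous_on {0..t} h'" and t: "0 \<le> t"
  shows "\<exists>B\<ge>0. \<forall>r. r \<noteq> 0 \<longrightarrow> norm (integral {0..t} (\<lambda>\<tau>. h \<tau> * cis (r * \<tau>))) \<le> B / \<bar>r\<bar>"
proof -
  obtain B where B: "B \<ge> 0" "\<And>r. norm (integral {0..t} (\<lambda>\<tau>. h' \<tau> * cis (r * \<tau>))) \<le> B"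
    using time_integral_bound[OF ch' t] by blast
  have "norm (integral {0..t} (\<lambda>\<tau>. h \<tau> * cis (r * \<tau>))) \<le> (norm (h t) + norm (h 0) + B) / \<bar>r\<bar>" if "r \<noteq> 0" for r
  proof -
    have "norm (h t * cis (r * t) - h 0 - integral {0..t} (\<lambda>\<tau>. h' \<tau> * cis (r * \<tau>)))
      \<le> norm (h t * cis (r * t)) + norm (h 0) + norm (integral {0..t} (\<lambda>\<tau>. h' \<tau> * cis (r * \<tau>)))"
      by (intro order_trans[OF norm_triangle_ineq4] add_mono norm_triangle_ineq4 order_refl)
    also have "\<dots> \<le> norm (h t) + norm (h 0) + B"
      using B(2)[of r] by (simp add: norm_mult)
    finally have "norm (h t * cis (r * t) - h 0 - integral {0..t} (\<lambda>\<tau>. h' \<tau> * cis (r * \<tau>))) \<le> norm (h t) + norm (h 0) + B" .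
    moreover have "integral {0..t} (\<lambda>\<tau>. h \<tau> * cis (r * \<tau>)) =
        (h t * cis (r * t) - h 0 - integral {0..t} (\<lambda>\<tau>. h' \<tau> * cis (r * \<tau>))) / (\<i> * of_real r)"
      by (rule time_parts[OF h ch' that t])
    ultimately show ?thesis
      by (simp add: norm_divide norm_mult divide_right_mono)
  qed
  then show ?thesis
    using B(1) by (intro exI[of _ "norm (h t) + norm (h 0) + B"]) auto
qed

text \<open>The time integral has endpoint contributions at \<tau> = t and \<tau> = 0, with frequencies x and x - \<sigma>t. Neither vanishes
for x > t, so both integrals over the half-lines converge.\<close>

lemma conv_integral_boundary:
  assumes a: "coefficient a" and s: "\<sigma> \<in> {-1, 1}" and xt: "0 \<le> t" "t < x"
    and h: "\<And>\<tau>. \<tau> \<in> {0..t} \<Longrightarrow> (h has_vector_derivative h' \<tau>) (at \<tau> within {0..t})"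
    and h': "\<And>\<tau>. \<tau> \<in> {0..t} \<Longrightarrow> (h' has_vector_derivative h'' \<tau>) (at \<tau> within {0..t})"
    and ch'': "continuous_on {0..t} h''"
  shows "conv_integral (\<lambda>\<xi>. cis (\<xi> * x - \<sigma> * rho m \<xi> * t) * a \<xi> * integral {0..t} (\<lambda>\<tau>. h \<tau> * cis (\<sigma> * rho m \<xi> * \<tau>)))"
proof -
  let ?E = "\<lambda>h \<xi>. integral {0..t} (\<lambda>\<tau>. h \<tau> * cis (\<sigma> * rho m \<xi> * \<tau>))"
  have ch': "continuous_on {0..t} h'" and ch: "continuous_on {0..t} h"
    by (rule continuous_on_vector_derivative[OF h'], assumption) (rule continuous_on_vector_derivative[OF h])
  obtain B where B: "B \<ge> 0" "\<And>r. norm (integral {0..t} (\<lambda>\<tau>. h \<tau> * cis (r * \<tau>))) \<le> B"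
    using time_integral_bound[OF ch xt(1)] by blast
  obtain D where D: "D \<ge> 0" "\<And>r. r \<noteq> 0 \<Longrightarrow> norm (integral {0..t} (\<lambda>\<tau>. h' \<tau> * cis (r * \<tau>))) \<le> D / \<bar>r\<bar>"
    using time_integral_decay[OF h' ch'' xt(1)] by blast
  have E': "asy (?E h') (\<lambda>\<xi>. 0)"
  proof (rule asyI)
    fix \<xi> :: real assume \<xi>: "\<xi> \<ge> 1"
    have r: "rho m \<xi> \<ge> \<xi>" "\<sigma> * rho m \<xi> \<noteq> 0" using rho_ge(1)[of \<xi> m] \<xi> s by auto
    have "norm (?E h' \<xi>) \<le> D / \<bar>\<sigma> * rho m \<xi>\<bar>"
      by (rule D(2)[OF r(2)])
    also have "\<dots> \<le> D / \<xi>"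
      using r \<xi> s D(1) by (intro divide_left_mono) (auto simp: abs_mult)
    finally show "norm (?E h' \<xi> - 0) \<le> D / \<xi>" by simp
  qed (rule order_refl)
  \<comment> \<open>one integration by parts; the endpoint \<tau> = t cancels the time part of the phase\<close>
  have E: "of_real \<xi> * ?E h \<xi> * cis (\<xi> * x - \<sigma> * rho m \<xi> * t) = of_real (\<xi> / rho m \<xi>) *
      (h t / (\<i> * of_real \<sigma>) * cis (\<xi> * x - \<sigma> * rho m \<xi> * 0) +
       (- h 0 / (\<i> * of_real \<sigma>)) * cis (\<xi> * x - \<sigma> * rho m \<xi> * t) +
       (- 1 / (\<i> * of_real \<sigma>)) * (cis (\<xi> * x - \<sigma> * rho m \<xi> * t) * ?E h' \<xi>))" if "\<xi> \<ge> 1" for \<xi> x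
  proof -
    have r: "rho m \<xi> > 0" "\<sigma> \<noteq> 0" using rho_ge(1)[of \<xi> m] that s by auto
    have c: "cis (\<sigma> * rho m \<xi> * t) * cis (\<xi> * x - \<sigma> * rho m \<xi> * t) = cis (\<xi> * x - \<sigma> * rho m \<xi> * 0)"
      by (simp add: cis_mult)
    have "of_real \<xi> * ?E h \<xi> * cis (\<xi> * x - \<sigma> * rho m \<xi> * t) = of_real (\<xi> / rho m \<xi>) *
       ((h t * cis (\<sigma> * rho m \<xi> * t) - h 0 - ?E h' \<xi>) * cis (\<xi> * x - \<sigma> * rho m \<xi> * t) / (\<i> * of_real \<sigma>))"
      using r by (subst time_parts[OF h ch' _ xt(1)]) (auto simp: field_simps)
    also have "(h t * cis (\<sigma> * rho m \<xi> * t) - h 0 - ?E h' \<xi>) * cis (\<xi> * x - \<sigma> * rho m \<xi> * t) =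
       h t * cis (\<xi> * x - \<sigma> * rho m \<xi> * 0) - h 0 * cis (\<xi> * x - \<sigma> * rho m \<xi> * t) - cis (\<xi> * x - \<sigma> * rho m \<xi> * t) * ?E h' \<xi>"
      unfolding c[symmetric] by (simp add: algebra_simps)
    finally show ?thesis by (simp add: diff_divide_distrib add_divide_distrib)
  qed
  have asyE: "asy (\<lambda>\<xi>. of_real \<xi> * ?E h \<xi> * cis (\<xi> * x - \<sigma> * rho m \<xi> * t))
      (\<lambda>\<xi>. 1 * (h t / (\<i> * of_real \<sigma>) * cis (\<xi> * (x - \<sigma> * 0)) +
       (- h 0 / (\<i> * of_real \<sigma>)) * cis (\<xi> * (x - \<sigma> * t)) + (- 1 / (\<i> * of_real \<sigma>)) * (cis (\<xi> * (x - \<sigma> * t)) * 0)))" for x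
  proof -
    have "asy (\<lambda>\<xi>. of_real (\<xi> / rho m \<xi>) *
      (h t / (\<i> * of_real \<sigma>) * cis (\<xi> * x - \<sigma> * rho m \<xi> * 0) +
       (- h 0 / (\<i> * of_real \<sigma>)) * cis (\<xi> * x - \<sigma> * rho m \<xi> * t) +
       (- 1 / (\<i> * of_real \<sigma>)) * (cis (\<xi> * x - \<sigma> * rho m \<xi> * t) * ?E h' \<xi>)))
      (\<lambda>\<xi>. 1 * (h t / (\<i> * of_real \<sigma>) * cis (\<xi> * (x - \<sigma> * 0)) +
       (- h 0 / (\<i> * of_real \<sigma>)) * cis (\<xi> * (x - \<sigma> * t)) + (- 1 / (\<i> * of_real \<sigma>)) * (cis (\<xi> * (x - \<sigma> * t)) * 0)))"
      by (intro asy_mult asy_add asy_const asy_momentum asy_phase E')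
    then show ?thesis
      unfolding asy_def by (simp only: E cong: conj_cong imp_cong)
  qed
  have cE: "continuous_on UNIV (?E h)"
    by (rule continuous_on_integral_real, unfold case_prod_unfold)
       (intro continuous_intros continuous_on_compose2[OF ch], auto)
  have "half_conv (\<lambda>\<xi>. cis (\<xi> * x - \<sigma> * rho m \<xi> * t) * a \<xi> * ?E h \<xi>)"
    if am: "a \<in> borel_measurable borel" and ab: "\<And>\<xi>. norm (a \<xi>) \<le> 2" and aa: "asy a (\<lambda>\<xi>. a0)"
     and x: "x \<noteq> \<sigma> * t" "x \<noteq> 0" for a a0 x
  proof (rule half_conv_asy)
    have "(\<lambda>\<xi>. cis (\<xi> * x - \<sigma> * rho m \<xi> * t)) \<in> borel_measurable borel" "?E h \<in> borel_measurable borel"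
      by (intro borel_measurable_continuous_onI continuous_intros cE)+
    then show "(\<lambda>\<xi>. cis (\<xi> * x - \<sigma> * rho m \<xi> * t) * a \<xi> * ?E h \<xi>) \<in> borel_measurable borel"
      using am by measurable
    show "norm (cis (\<xi> * x - \<sigma> * rho m \<xi> * t) * a \<xi> * ?E h \<xi>) \<le> 2 * B" for \<xi>
      unfolding norm_mult norm_cis mult_1 using B by (intro mult_mono ab) auto
    show "asy (\<lambda>\<xi>. of_real \<xi> * (cis (\<xi> * x - \<sigma> * rho m \<xi> * t) * a \<xi> * ?E h \<xi>))
        (\<lambda>\<xi>. (a0 * (h t / (\<i> * of_real \<sigma>))) * cis (\<xi> * x) + (a0 * (- h 0 / (\<i> * of_real \<sigma>))) * cis (\<xi> * (x - \<sigma> * t)))"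
      using asy_mult[OF aa asyE[of x]] by (simp add: algebra_simps)
  qed (use x in auto)
  note H = this
  have "half_conv (\<lambda>\<xi>. cis (\<xi> * x - \<sigma> * rho m \<xi> * t) * a \<xi> * ?E h \<xi>)"
  proof -
    obtain a0 where "asy a (\<lambda>\<xi>. a0)" using a unfolding coefficient_def by blast
    then show ?thesis
      using a s xt unfolding coefficient_def by (intro H) auto
  qed
  moreover have "half_conv (\<lambda>\<xi>. cis (\<xi> * (- x) - \<sigma> * rho m \<xi> * t) * a (- \<xi>) * ?E h \<xi>)"
  proof -
    obtain a0 where "asy (\<lambda>\<xi>. a (- \<xi>)) (\<lambda>\<xi>. a0)" using a unfolding coefficient_def by blast
    then show ?thesis
      using a s xt unfolding coefficient_def by (intro H) auto
  qed
  ultimately show ?thesis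
    by (simp add: conv_integral_def rho_even)
qed

section \<open>Absolute convergence of the forcing integrals\<close>

text \<open>Boundedness of F and of x^2 F together give the weight 1/(1 + y^2), uniformly over the slices.\<close>

lemma schwartz_family_slices:
  assumes F: "schwartz_family F" and T: "T > 0"
  shows "\<exists>C. \<forall>\<tau>\<in>{0..T}. decay2_C1 C (\<lambda>y. F n l y \<tau>) (\<lambda>y. F (Suc n) l y \<tau>)"
proof -
  have cont: "continuous_on {0..} (\<lambda>y. F n l y \<tau>)" if "\<tau> \<ge> 0" for n l \<tau>
    using that by (intro schwartz_family_continuous[OF F] continuous_intros) auto
  have "\<exists>C. \<forall>\<tau>\<in>{0..T}. \<forall>y\<ge>0. norm (F n l y \<tau>) \<le> C / (1 + y\<^sup>2)" for n l
  proof -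
    obtain C0 where C0: "\<And>x t. x > 0 \<Longrightarrow> t \<in> {0..T} \<Longrightarrow> x ^ 0 * norm (F n l x t) \<le> C0"
      using F T unfolding schwartz_family_def by meson
    obtain C2 where C2: "\<And>x t. x > 0 \<Longrightarrow> t \<in> {0..T} \<Longrightarrow> x ^ 2 * norm (F n l x t) \<le> C2"
      using F T unfolding schwartz_family_def by meson
    have pos: "(1 + y\<^sup>2) * norm (F n l y \<tau>) \<le> C0 + C2" if "y > 0" "\<tau> \<in> {0..T}" for y \<tau>
      using C0[OF that] C2[OF that] by (simp add: distrib_right)
    have "(1 + y\<^sup>2) * norm (F n l y \<tau>) \<le> C0 + C2" if "y \<ge> 0" "\<tau> \<in> {0..T}" for y \<tau>
    \<comment> \<open>the decay bound is given for y > 0 and extends to y = 0 by continuity\<close>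
    proof (cases "y = 0")
      case True
      have "((\<lambda>y. F n l y \<tau>) \<longlongrightarrow> F n l 0 \<tau>) (at 0 within {0..})"
        using cont[of \<tau> n l] that by (auto simp: continuous_on_def)
      then have "((\<lambda>y. F n l y \<tau>) \<longlongrightarrow> F n l 0 \<tau>) (at_right 0)"
        by (rule tendsto_mono[rotated]) (auto intro!: at_le)
      then have "((\<lambda>y. (1 + y\<^sup>2) * norm (F n l y \<tau>)) \<longlongrightarrow> (1 + 0\<^sup>2) * norm (F n l 0 \<tau>)) (at_right 0)"
        by (intro tendsto_intros)
      moreover have "\<forall>\<^sub>F y in at_right 0. (1 + y\<^sup>2) * norm (F n l y \<tau>) \<le> C0 + C2"
        using pos that(2) by (auto simp: eventually_at_filter)
      ultimately have "(1 + 0\<^sup>2) * norm (F n l 0 \<tau>) \<le> C0 + C2"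
        by (rule tendsto_upperbound) (rule trivial_limit_at_right_real)
      then show ?thesis
        using True by simp
    qed (use pos that in auto)
    then have "norm (F n l y \<tau>) \<le> (C0 + C2) / (1 + y\<^sup>2)" if "y \<ge> 0" "\<tau> \<in> {0..T}" for y \<tau>
      using that by (simp add: pos_le_divide_eq add_pos_nonneg mult.commute)
    then show ?thesis by blast
  qed
  from this[of n l] this[of "Suc n" l] obtain C C' where
    C: "\<And>y \<tau>. \<tau> \<in> {0..T} \<Longrightarrow> y \<ge> 0 \<Longrightarrow> norm (F n l y \<tau>) \<le> C / (1 + y\<^sup>2)"
      "\<And>y \<tau>. \<tau> \<in> {0..T} \<Longrightarrow> y \<ge> 0 \<Longrightarrow> norm (F (Suc n) l y \<tau>) \<le> C' / (1 + y\<^sup>2)"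
    by blast
  have "C / (1 + y\<^sup>2) \<le> max C C' / (1 + y\<^sup>2)" "C' / (1 + y\<^sup>2) \<le> max C C' / (1 + y\<^sup>2)" for y :: real
    by (intro divide_right_mono; simp)+
  then have "norm (F n l y \<tau>) \<le> max C C' / (1 + y\<^sup>2)" "norm (F (Suc n) l y \<tau>) \<le> max C C' / (1 + y\<^sup>2)"
    if "\<tau> \<in> {0..T}" "y \<ge> 0" for y \<tau>
    using C[OF that] order_trans by blast+
  then have "decay2_C1 (max C C') (\<lambda>y. F n l y \<tau>) (\<lambda>y. F (Suc n) l y \<tau>)" if "\<tau> \<in> {0..T}" for \<tau>
    using that cont F unfolding decay2_C1_def decay2_def schwartz_family_def by auto
  then show ?thesis by blast
qed

lemma schwartz_family_half_ft_continuous: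
  assumes F: "schwartz_family F"
  shows "continuous_on (UNIV \<times> {0..T}) (\<lambda>(\<xi>, \<tau>). half_ft (\<lambda>y. F n l y \<tau>) \<xi>)"
proof (cases "T > 0")
  case True
  obtain C where "\<And>\<tau>. \<tau> \<in> {0..T} \<Longrightarrow> decay2_C1 C (\<lambda>y. F n l y \<tau>) (\<lambda>y. F (Suc n) l y \<tau>)"
    using schwartz_family_slices[OF F True] by blast
  then have d: "\<And>\<tau>. \<tau> \<in> {0..T} \<Longrightarrow> decay2 C (\<lambda>y. F n l y \<tau>)"
    by (simp add: decay2_C1_def)
  have "continuous_on {0..T} (\<lambda>\<tau>. F n l y \<tau>)" if "y \<ge> 0" for y
    using that by (intro schwartz_family_continuous[OF F] continuous_intros) auto
  then show ?thesis
    by (intro continuous_on_half_ft[OF d])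
next
  case False
  obtain C where "\<And>\<tau>. \<tau> \<in> {0..1} \<Longrightarrow> decay2_C1 C (\<lambda>y. F n l y \<tau>) (\<lambda>y. F (Suc n) l y \<tau>)"
    using schwartz_family_slices[OF F zero_less_one] by blast
  then have d: "decay2 C (\<lambda>y. F n l y 0)"
    by (simp add: decay2_C1_def)
  have "continuous_on (UNIV \<times> {0::real}) (\<lambda>(\<xi>, \<tau>). half_ft (\<lambda>y. F n l y 0) \<xi>)"
    unfolding case_prod_unfold
    by (intro continuous_on_compose2[OF continuous_on_half_ft_UNIV[OF d]] continuous_intros) auto
  then have "continuous_on (UNIV \<times> {0::real}) (\<lambda>(\<xi>, \<tau>). half_ft (\<lambda>y. F n l y \<tau>) \<xi>)"
    by (rule continuous_on_eq) auto
  then show ?thesis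
    by (rule continuous_on_subset) (use False in auto)
qed

lemma schwartz_family_half_ft_compose:
  assumes F: "schwartz_family F" and ab: "continuous_on X a" "continuous_on X b" "b ` X \<subseteq> {0..T}"
  shows "continuous_on X (\<lambda>p. half_ft (\<lambda>y. F n l y (b p)) (a p))"
  using continuous_on_compose2[OF schwartz_family_half_ft_continuous[OF F] continuous_on_Pair[OF ab(1,2)], of T n l] ab(3)
  by auto

lemma time_ft_integral:
  assumes F: "schwartz_family F"
  shows "time_ft (F n l) \<eta> (\<i> * of_real r) t = integral {0..t} (\<lambda>\<tau>. cis (r * \<tau>) * half_ft (\<lambda>y. F n l y \<tau>) \<eta>)"
proof -
  have c: "continuous_on {0..t} (\<lambda>\<tau>. half_ft (\<lambda>y. F n l y \<tau>) \<eta>)"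
    by (intro schwartz_family_half_ft_compose[OF F, where T=t] continuous_intros) auto
  have "time_ft (F n l) \<eta> (\<i> * of_real r) t = (LBINT \<tau>:{0..t}. cis (r * \<tau>) * half_ft (\<lambda>y. F n l y \<tau>) \<eta>)"
    by (simp add: time_ft_def cis_conv_exp mult.assoc)
  also have "\<dots> = integral {0..t} (\<lambda>\<tau>. cis (r * \<tau>) * half_ft (\<lambda>y. F n l y \<tau>) \<eta>)"
    by (intro set_borel_integral_eq_integral borel_integrable_atLeastAtMost' continuous_intros c)
  finally show ?thesis .
qed

text \<open>Taking the time integral inside makes it possible to integrate by parts in time pointwise in y, without differentiating a
half-line transform in its parameter.\<close>

lemma time_ft_swap:
  assumes F: "schwartz_family F" and t: "t > 0"
  shows "time_ft (F n l) \<eta> (\<i> * of_real r) t =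
      (LBINT y:{0..}. cis (- (\<eta> * y)) * integral {0..t} (\<lambda>\<tau>. F n l y \<tau> * cis (r * \<tau>)))"
proof -
  obtain C where "\<And>\<tau>. \<tau> \<in> {0..t} \<Longrightarrow> decay2_C1 C (\<lambda>y. F n l y \<tau>) (\<lambda>y. F (Suc n) l y \<tau>)"
    using schwartz_family_slices[OF F t] by blast
  then have d: "\<And>\<tau>. \<tau> \<in> {0..t} \<Longrightarrow> decay2 C (\<lambda>y. F n l y \<tau>)"
    by (simp add: decay2_C1_def)
  have c: "continuous_on ({0..t} \<times> {0..}) (\<lambda>p. F n l (snd p) (fst p))"
    by (intro schwartz_family_continuous[OF F] continuous_intros) auto
  have "time_ft (F n l) \<eta> (\<i> * of_real r) t =
      integral {0..t} (\<lambda>\<tau>. LBINT y:{0..}. cis (r * \<tau>) * (cis (- (\<eta> * y)) * F n l y \<tau>))"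
    unfolding time_ft_integral[OF F] half_ft_cis by simp
  also have "\<dots> = (LBINT y:{0..}. integral {0..t} (\<lambda>\<tau>. cis (r * \<tau>) * (cis (- (\<eta> * y)) * F n l y \<tau>)))"
  proof (rule integral_decay2_swap)
    show "decay2 (1 * C) (\<lambda>y. cis (r * \<tau>) * (cis (- (\<eta> * y)) * F n l y \<tau>))" if "\<tau> \<in> {0..t}" for \<tau>
      by (rule decay2_mult[OF decay2_cis[OF d[OF that]]]) (auto intro: continuous_intros)
    show "continuous_on ({0..t} \<times> {0..}) (\<lambda>(\<tau>, y). cis (r * \<tau>) * (cis (- (\<eta> * y)) * F n l y \<tau>))"
      unfolding case_prod_unfold by (intro continuous_intros c)
  qed
  also have "\<dots> = (LBINT y:{0..}. cis (- (\<eta> * y)) * integral {0..t} (\<lambda>\<tau>. F n l y \<tau> * cis (r * \<tau>)))"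
    by (intro set_lebesgue_integral_cong) (auto simp: mult_ac simp flip: integral_mult_right)
  finally show ?thesis .
qed

lemma time_ft_parts:
  assumes F: "schwartz_family F" and t: "t > 0" and r: "r \<noteq> 0"
  shows "time_ft (F n l) \<eta> (\<i> * of_real r) t =
     (cis (r * t) * half_ft (\<lambda>y. F n l y t) \<eta> - half_ft (\<lambda>y. F n l y 0) \<eta> - time_ft (F n (Suc l)) \<eta> (\<i> * of_real r) t) / (\<i> * of_real r)"
proof -
  obtain C where "\<And>\<tau>. \<tau> \<in> {0..t} \<Longrightarrow> decay2_C1 C (\<lambda>y. F n l y \<tau>) (\<lambda>y. F (Suc n) l y \<tau>)"
    using schwartz_family_slices[OF F t] by blast
  then have d: "\<And>\<tau>. \<tau> \<in> {0..t} \<Longrightarrow> decay2 C (\<lambda>y. F n l y \<tau>)"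
    by (simp add: decay2_C1_def)
  obtain C' where "\<And>\<tau>. \<tau> \<in> {0..t} \<Longrightarrow> decay2_C1 C' (\<lambda>y. F n (Suc l) y \<tau>) (\<lambda>y. F (Suc n) (Suc l) y \<tau>)"
    using schwartz_family_slices[OF F t] by blast
  then have d': "\<And>\<tau>. \<tau> \<in> {0..t} \<Longrightarrow> decay2 C' (\<lambda>y. F n (Suc l) y \<tau>)"
    by (simp add: decay2_C1_def)
  have ct: "continuous_on {0..t} (\<lambda>\<tau>. F n l y \<tau>)" if "y \<ge> 0" for n l y
    using that by (intro schwartz_family_continuous[OF F] continuous_intros) auto
  have parts: "integral {0..t} (\<lambda>\<tau>. F n l y \<tau> * cis (r * \<tau>)) =
     (F n l y t * cis (r * t) - F n l y 0 - integral {0..t} (\<lambda>\<tau>. F n (Suc l) y \<tau> * cis (r * \<tau>))) / (\<i> * of_real r)" if "y \<ge> 0" for y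
  proof (rule time_parts[OF _ ct[OF that] r])
    show "((\<lambda>\<tau>. F n l y \<tau>) has_vector_derivative F n (Suc l) y \<tau>) (at \<tau> within {0..t})" if "\<tau> \<in> {0..t}" for \<tau>
      using F that \<open>y \<ge> 0\<close> unfolding schwartz_family_def
      by (auto intro!: has_vector_derivative_within_subset[of _ _ _ "{0..}" "{0..t}"])
  qed (use t in auto)
  have i: "set_integrable lborel {0..} (\<lambda>y. cis (- (\<eta> * y)) * F n l y \<tau>)" if "\<tau> \<in> {0..t}" for \<tau>
    by (rule decay2_integrable[OF decay2_cis[OF d[OF that]]])
  let ?I = "\<lambda>y. cis (- (\<eta> * y)) * integral {0..t} (\<lambda>\<tau>. F n (Suc l) y \<tau> * cis (r * \<tau>))"
  have i': "set_integrable lborel {0..} ?I"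
  proof (rule decay2_integrable, rule decay2_cis)
    show "decay2 (C' * t) (\<lambda>y. integral {0..t} (\<lambda>\<tau>. F n (Suc l) y \<tau> * cis (r * \<tau>)))"
      unfolding decay2_def
    proof (intro conjI allI impI)
      have "continuous_on ({0..} \<times> {0..t}) (\<lambda>p. F n (Suc l) (fst p) (snd p))"
        by (intro schwartz_family_continuous[OF F] continuous_intros) auto
      then show "continuous_on {0..} (\<lambda>y. integral {0..t} (\<lambda>\<tau>. F n (Suc l) y \<tau> * cis (r * \<tau>)))"
        by (intro continuous_on_integral_real, unfold case_prod_unfold) (intro continuous_intros)
      fix y :: real assume y: "y \<ge> 0"
      have "norm (integral {0..t} (\<lambda>\<tau>. F n (Suc l) y \<tau> * cis (r * \<tau>))) \<le> C' / (1 + y\<^sup>2) * (t - 0)"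
        by (rule integral_bound) (use t y d' in \<open>auto simp: norm_mult decay2_def intro!: continuous_intros ct\<close>)
      then show "norm (integral {0..t} (\<lambda>\<tau>. F n (Suc l) y \<tau> * cis (r * \<tau>))) \<le> C' * t / (1 + y\<^sup>2)"
        by simp
    qed
  qed
  have "time_ft (F n l) \<eta> (\<i> * of_real r) t =
     (LBINT y:{0..}. (cis (r * t) * (cis (- (\<eta> * y)) * F n l y t) - cis (- (\<eta> * y)) * F n l y 0 - ?I y) / (\<i> * of_real r))"
    unfolding time_ft_swap[OF F t]
  proof (intro set_lebesgue_integral_cong allI impI)
    fix y :: real assume "y \<in> {0..}"
    then have y: "y \<ge> 0" by simp
    show "cis (- (\<eta> * y)) * integral {0..t} (\<lambda>\<tau>. F n l y \<tau> * cis (r * \<tau>)) =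
      (cis (r * t) * (cis (- (\<eta> * y)) * F n l y t) - cis (- (\<eta> * y)) * F n l y 0 - ?I y) / (\<i> * of_real r)"
      unfolding parts[OF y] times_divide_eq_right right_diff_distrib by (simp only: mult_ac)
  qed simp
  also have "\<dots> = (LBINT y:{0..}. cis (r * t) * (cis (- (\<eta> * y)) * F n l y t) - cis (- (\<eta> * y)) * F n l y 0 - ?I y) / (\<i> * of_real r)"
    by (rule set_integral_divide_zero)
  also have "(LBINT y:{0..}. cis (r * t) * (cis (- (\<eta> * y)) * F n l y t) - cis (- (\<eta> * y)) * F n l y 0 - ?I y) =
     cis (r * t) * half_ft (\<lambda>y. F n l y t) \<eta> - half_ft (\<lambda>y. F n l y 0) \<eta> - time_ft (F n (Suc l)) \<eta> (\<i> * of_real r) t"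
    unfolding time_ft_swap[OF F t] half_ft_cis using t
    by (simp add: set_integral_diff i i' set_integrable_mult_right)
  finally show ?thesis .
qed

lemma time_ft_bound:
  assumes F: "schwartz_family F" and t: "t > 0"
  shows "\<exists>C\<ge>0. \<forall>\<eta> r. norm (time_ft (F n l) \<eta> (\<i> * of_real r) t) \<le> C \<and>
     (\<eta> \<noteq> 0 \<longrightarrow> norm (time_ft (F n l) \<eta> (\<i> * of_real r) t) \<le> C / \<bar>\<eta>\<bar>)"
proof -
  obtain C where C: "\<And>\<tau>. \<tau> \<in> {0..t} \<Longrightarrow> decay2_C1 C (\<lambda>y. F n l y \<tau>) (\<lambda>y. F (Suc n) l y \<tau>)"
    using schwartz_family_slices[OF F t] by blast
  then have d: "\<And>\<tau>. \<tau> \<in> {0..t} \<Longrightarrow> decay2 C (\<lambda>y. F n l y \<tau>)"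
    by (simp add: decay2_C1_def)
  have C0: "C \<ge> 0" using decay2_nonneg[OF d[of 0]] t by simp
  have c: "continuous_on {0..t} (\<lambda>\<tau>. half_ft (\<lambda>y. F n l y \<tau>) \<eta>)" for \<eta>
    by (intro schwartz_family_half_ft_compose[OF F, where T=t] continuous_intros) auto
  have b: "norm (time_ft (F n l) \<eta> (\<i> * of_real r) t) \<le> K * (t - 0)"
    if "\<And>\<tau>. \<tau> \<in> {0..t} \<Longrightarrow> norm (half_ft (\<lambda>y. F n l y \<tau>) \<eta>) \<le> K" for \<eta> r K
    unfolding time_ft_integral[OF F]
    by (rule integral_bound) (use t that in \<open>auto intro!: continuous_intros c simp: norm_mult\<close>)
  have "norm (time_ft (F n l) \<eta> (\<i> * of_real r) t) \<le> 3 * C * t" for \<eta> r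
  proof -
    have "norm (half_ft (\<lambda>y. F n l y \<tau>) \<eta>) \<le> 3 * C" if "\<tau> \<in> {0..t}" for \<tau>
      using half_ft_bound[OF d[OF that], of \<eta>] C0 by linarith
    from b[OF this] show ?thesis by simp
  qed
  moreover have "norm (time_ft (F n l) \<eta> (\<i> * of_real r) t) \<le> 3 * C * t / \<bar>\<eta>\<bar>" if "\<eta> \<noteq> 0" for \<eta> r
    using b[OF half_ft_bound_inverse[OF C that]] by simp
  ultimately show ?thesis
    using C0 t by (intro exI[of _ "3 * C * t"]) auto
qed

text \<open>Integration by parts in time gains a factor 1/\<rho>, and integration by parts in space a factor 1/\<xi>; together with boundedness near
0 this gives an integrable majorant.\<close>

lemma forcing_integrable:
  assumes a: "coefficient a" and F: "schwartz_family F" and s: "\<sigma> \<in> {-1, 1}" and e: "e \<in> {-1, 1}" and t: "t > 0"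
  shows "integrable lborel (\<lambda>\<xi>. cis (\<xi> * x - \<sigma> * rho m \<xi> * t) * a \<xi> * time_ft (F n l) (e * \<xi>) (\<i> * of_real (\<sigma> * rho m \<xi>)) t)"
    (is "integrable lborel ?G")
proof -
  let ?\<Phi> = "\<lambda>\<xi>. time_ft (F n l) (e * \<xi>) (\<i> * of_real (\<sigma> * rho m \<xi>)) t"
  obtain C where C: "\<And>\<tau>. \<tau> \<in> {0..t} \<Longrightarrow> decay2_C1 C (\<lambda>y. F n l y \<tau>) (\<lambda>y. F (Suc n) l y \<tau>)"
    using schwartz_family_slices[OF F t] by blast
  then have d: "\<And>\<tau>. \<tau> \<in> {0..t} \<Longrightarrow> decay2 C (\<lambda>y. F n l y \<tau>)"
    by (simp add: decay2_C1_def)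
  have C0: "C \<ge> 0" using decay2_nonneg[OF d[of 0]] t by simp
  obtain D where D: "D \<ge> 0" "\<And>\<eta> r. norm (time_ft (F n l) \<eta> (\<i> * of_real r) t) \<le> D"
    using time_ft_bound[OF F t] by blast
  obtain D' where D': "D' \<ge> 0" "\<And>\<eta> r. \<eta> \<noteq> 0 \<Longrightarrow> norm (time_ft (F n (Suc l)) \<eta> (\<i> * of_real r) t) \<le> D' / \<bar>\<eta>\<bar>"
    using time_ft_bound[OF F t] by blast
  let ?K = "6 * C + D'"
  \<comment> \<open>the two endpoint terms are half-line transforms, and the third is a time transform of the t-derivative; all are O(1/\<xi>)\<close>
  have far: "norm (?\<Phi> \<xi>) * \<xi>\<^sup>2 \<le> ?K" if "\<xi> \<noteq> 0" for \<xi>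
  proof -
    have r: "\<sigma> * rho m \<xi> \<noteq> 0" "\<bar>\<sigma> * rho m \<xi>\<bar> = rho m \<xi>" "e * \<xi> \<noteq> 0" "\<bar>e * \<xi>\<bar> = \<bar>\<xi>\<bar>"
      using rho_pos[OF that, of m] s e that by (auto simp: abs_mult)
    let ?r = "\<sigma> * rho m \<xi>"
    let ?A = "cis (?r * t) * half_ft (\<lambda>y. F n l y t) (e * \<xi>)" and ?B = "half_ft (\<lambda>y. F n l y 0) (e * \<xi>)"
      and ?D = "time_ft (F n (Suc l)) (e * \<xi>) (\<i> * of_real ?r) t"
    have "norm (?A - ?B - ?D) \<le> norm ?A + norm ?B + norm ?D"
      by (intro order_trans[OF norm_triangle_ineq4] add_mono norm_triangle_ineq4 order_refl)
    also have "\<dots> \<le> 3 * C / \<bar>\<xi>\<bar> + 3 * C / \<bar>\<xi>\<bar> + D' / \<bar>\<xi>\<bar>"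
    proof (intro add_mono)
      show "norm ?A \<le> 3 * C / \<bar>\<xi>\<bar>" "norm ?B \<le> 3 * C / \<bar>\<xi>\<bar>" "norm ?D \<le> D' / \<bar>\<xi>\<bar>"
        using half_ft_bound_inverse[OF C r(3), of t] half_ft_bound_inverse[OF C r(3), of 0] D'(2)[OF r(3), of ?r] t
        unfolding norm_mult norm_cis mult_1 r(4) by auto
    qed
    also have "\<dots> = ?K / \<bar>\<xi>\<bar>" by (simp add: add_divide_distrib)
    finally have X: "norm (?A - ?B - ?D) \<le> ?K / \<bar>\<xi>\<bar>" .
    have "norm (?A - ?B - ?D) / rho m \<xi> \<le> ?K / \<bar>\<xi>\<bar> / \<bar>\<xi>\<bar>"
      by (rule frac_le[OF order_trans[OF norm_ge_zero X] X _ rho_ge(1)]) (use that in simp)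
    moreover have "norm (?\<Phi> \<xi>) = norm (?A - ?B - ?D) / rho m \<xi>"
      unfolding time_ft_parts[OF F t r(1), of n l] norm_divide norm_mult[of \<i>] norm_of_real r(2) by simp
    ultimately have "norm (?\<Phi> \<xi>) \<le> ?K / \<bar>\<xi>\<bar> / \<bar>\<xi>\<bar>"
      by (simp only:)
    then show ?thesis
      using that pos_le_divide_eq[of "\<xi> * \<xi>" "norm (?\<Phi> \<xi>)" ?K]
      by (simp add: power2_eq_square zero_less_mult_iff linorder_neq_iff[symmetric] del: of_real_mult)
  qed
  have bound: "norm (?G \<xi>) \<le> 2 * (D + ?K) / (1 + \<xi>\<^sup>2)" for \<xi>
  proof -
    have "norm (?\<Phi> \<xi>) * (1 + \<xi>\<^sup>2) \<le> D + ?K"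
      unfolding distrib_left mult_1_right
      by (intro add_mono D(2), cases "\<xi> = 0") (use far C0 D' in auto)
    then have "norm (a \<xi>) * (norm (?\<Phi> \<xi>) * (1 + \<xi>\<^sup>2)) \<le> 2 * (D + ?K)"
      using a unfolding coefficient_def by (intro mult_mono) (auto simp: add_nonneg_nonneg)
    then show ?thesis
      unfolding norm_mult norm_cis mult_1 by (simp add: pos_le_divide_eq add_pos_nonneg mult.assoc)
  qed
  have "continuous_on UNIV ?\<Phi>"
    unfolding time_ft_integral[OF F]
    by (intro continuous_on_integral_real, unfold case_prod_unfold)
       (intro continuous_intros schwartz_family_half_ft_compose[OF F, where T=t], auto)
  then have "?\<Phi> \<in> borel_measurable borel"
    by (rule borel_measurable_continuous_onI)
  moreover have "(\<lambda>\<xi>. cis (\<xi> * x - \<sigma> * rho m \<xi> * t)) \<in> borel_measurable borel"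
    by (intro borel_measurable_continuous_onI continuous_intros)
  ultimately have m: "?G \<in> borel_measurable lborel"
    using a unfolding coefficient_def by auto
  have i: "integrable lborel (\<lambda>\<xi>::real. 2 * (D + ?K) / (1 + \<xi>\<^sup>2))"
  proof -
    have 1: "set_integrable lborel {0..} (\<lambda>\<xi>::real. 2 * (D + ?K) / (1 + \<xi>\<^sup>2))"
      by (rule inverse_square_integrable)
    have "integrable lborel (\<lambda>\<xi>::real. indicator {0..} (0 + (-1) * \<xi>) *\<^sub>R (2 * (D + ?K) / (1 + (0 + (-1) * \<xi>)\<^sup>2)))"
      using 1 unfolding set_integrable_def by (intro lborel_integrable_real_affine) auto
    moreover have "(\<lambda>\<xi>::real. indicator {0..} (0 + (-1) * \<xi>) *\<^sub>R (2 * (D + ?K) / (1 + (0 + (-1) * \<xi>)\<^sup>2))) = (\<lambda>\<xi>. indicator {..0} \<xi> *\<^sub>R (2 * (D + ?K) / (1 + \<xi>\<^sup>2)))"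
      by (auto simp: fun_eq_iff split: split_indicator)
    ultimately have 2: "set_integrable lborel {..0} (\<lambda>\<xi>::real. 2 * (D + ?K) / (1 + \<xi>\<^sup>2))"
      by (simp add: set_integrable_def)
    have "set_integrable lborel ({0..} \<union> {..0}) (\<lambda>\<xi>::real. 2 * (D + ?K) / (1 + \<xi>\<^sup>2))"
      by (rule set_integrable_Un[OF 1 2]) auto
    moreover have "{0..} \<union> {..0} = (UNIV :: real set)" by auto
    ultimately show ?thesis by (simp add: set_integrable_def)
  qed
  show ?thesis
    by (rule Bochner_Integration.integrable_bound[OF i m]) (use bound C0 D D' in auto)
qed

section \<open>The pairs of integrals as averages of the data\<close>

text \<open>The symbol \<xi>/\<rho> is the same for both phases, so the difference of the phases is -2i \<xi> sin(\<rho>s)/\<rho>.\<close>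

lemma propagator_momentum:
  "\<exists>M N. propagator M N \<and> (\<forall>\<xi> s. \<xi> \<noteq> 0 \<longrightarrow>
     M \<xi> s = of_real (\<xi> / rho m \<xi>) * cis (- (rho m \<xi> * s)) - of_real (\<xi> / rho m \<xi>) * cis (rho m \<xi> * s))"
proof -
  obtain M N where M: "propagator M N" "\<And>\<xi> s. \<xi> \<noteq> 0 \<Longrightarrow> M \<xi> s = of_real (\<xi> * sin (rho m \<xi> * s) / rho m \<xi>)"
    using propagator_xi_sinc by blast
  obtain N' where "propagator (\<lambda>\<xi> s. - 2 * \<i> * M \<xi> s) N'"
    using propagator_cmult[OF M(1)] by blast
  moreover have "- 2 * \<i> * M \<xi> s = of_real (\<xi> / rho m \<xi>) * cis (- (rho m \<xi> * s)) - of_real (\<xi> / rho m \<xi>) * cis (rho m \<xi> * s)"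
    if "\<xi> \<noteq> 0" for \<xi> s
    unfolding M(2)[OF that] right_diff_distrib[symmetric] cis_minus by simp
  ultimately show ?thesis by blast
qed

text \<open>The symbol (\<kappa>\<rho> + m)/\<rho> changes the sign of \<kappa> with that of the phase. Its even part m/\<rho> pairs to sin(\<rho>s)/\<rho>, and
its odd part to cos(\<rho>s).\<close>

lemma propagator_energy:
  "\<exists>M N. propagator M N \<and> (\<forall>\<xi> s. \<xi> \<noteq> 0 \<longrightarrow>
     M \<xi> s = of_real ((\<kappa> * rho m \<xi> + m) / rho m \<xi>) * cis (- (rho m \<xi> * s))
       - of_real ((- \<kappa> * rho m \<xi> + m) / rho m \<xi>) * cis (rho m \<xi> * s))"
proof -
  obtain C NC where C: "propagator C NC" "\<And>\<xi> s. \<xi> \<noteq> 0 \<Longrightarrow> C \<xi> s = of_real (cos (rho m \<xi> * s))"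
    using propagator_cos by blast
  obtain S NS where S: "propagator S NS" "\<And>\<xi> s. \<xi> \<noteq> 0 \<Longrightarrow> S \<xi> s = of_real (sin (rho m \<xi> * s) / rho m \<xi>)"
    using propagator_sinc by blast
  have "\<exists>N. propagator (\<lambda>\<xi> s. of_real (2 * \<kappa>) * C \<xi> s + - 2 * \<i> * of_real m * S \<xi> s) N"
    by (intro propagator_add propagator_cmult[OF C(1)] propagator_cmult[OF S(1)])
  moreover have "of_real (2 * \<kappa>) * C \<xi> s + - 2 * \<i> * of_real m * S \<xi> s =
     of_real ((\<kappa> * rho m \<xi> + m) / rho m \<xi>) * cis (- (rho m \<xi> * s))
       - of_real ((- \<kappa> * rho m \<xi> + m) / rho m \<xi>) * cis (rho m \<xi> * s)" if "\<xi> \<noteq> 0" for \<xi> s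
    unfolding C(2)[OF that] S(2)[OF that] using rho_pos[OF that, of m]
    by (simp add: complex_eq_iff field_simps)
  ultimately show ?thesis by blast
qed

text \<open>What Fourier inversion at positive points makes of the transform evaluated at e\<xi>, where e = -1 stands
for the reflected function.\<close>

definition recovered :: "real \<Rightarrow> (real \<Rightarrow> complex) \<Rightarrow> real \<Rightarrow> complex" where
  "recovered e g = (\<lambda>y. if e = 1 then of_real (2 * pi) * g y else 0)"

lemma inverts_recovered:
  "\<exists>K. \<forall>C g g' e. decay2_C1 C g g' \<longrightarrow> e \<in> {-1, 1} \<longrightarrow> inverts (K * C) (\<lambda>\<xi>. half_ft g (e * \<xi>)) (recovered e g)"
proof -
  obtain K where "\<forall>C g g'. decay2_C1 C g g' \<longrightarrow>
     inverts (K * C) (half_ft g) (\<lambda>y. of_real (2 * pi) * g y) \<and> inverts (K * C) (\<lambda>\<xi>. half_ft g (- \<xi>)) (\<lambda>y. 0)"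
    using inverts_half_ft by blast
  then have "decay2_C1 C g g' \<longrightarrow> e \<in> {-1, 1} \<longrightarrow> inverts (K * C) (\<lambda>\<xi>. half_ft g (e * \<xi>)) (recovered e g)" for C g g' e
    by (auto simp: recovered_def)
  then show ?thesis by blast
qed

lemma schwartz_half_line_decay2:
  assumes "schwartz_half_line g"
  shows "\<exists>C. decay2_C1 C (half_line_deriv n g) (half_line_deriv (Suc n) g)"
proof -
  obtain C where "\<forall>\<tau>\<in>{0..1::real}. decay2_C1 C (\<lambda>y. if (0::nat) = 0 then half_line_deriv n g y else 0)
     (\<lambda>y. if (0::nat) = 0 then half_line_deriv (Suc n) g y else 0)"
    using schwartz_family_slices[OF schwartz_family_half_line[OF assms] zero_less_one, where n=n and l=0] by blast
  then have "decay2_C1 C (half_line_deriv n g) (half_line_deriv (Suc n) g)"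
    by (drule_tac bspec[of _ _ 0]) simp_all
  then show ?thesis by blast
qed

text \<open>The difference of the two phases, with their symbols, is exp(i\<xi>x) times a multiplier that propagates, except possibly at
\<xi> = 0.\<close>

lemma initial_block:
  assumes g: "schwartz_half_line g" and M: "propagator M N" and e: "e \<in> {-1, 1}" and t: "0 < t" "t < x"
    and Meq: "\<And>\<xi> s. \<xi> \<noteq> 0 \<Longrightarrow> M \<xi> s = a \<xi> * cis (- (rho m \<xi> * s)) - a' \<xi> * cis (rho m \<xi> * s)"
  shows "sym_integral (\<lambda>\<xi>. cis (\<xi> * x - 1 * rho m \<xi> * t) * a \<xi> * half_ft g (e * \<xi>)
     - cis (\<xi> * x - (- 1) * rho m \<xi> * t) * a' \<xi> * half_ft g (e * \<xi>)) (N (recovered e g) t x)"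
proof -
  obtain C where "decay2_C1 C (half_line_deriv 0 g) (half_line_deriv (Suc 0) g)"
    using schwartz_half_line_decay2[OF g] by blast
  then have "decay2_C1 C g (half_line_deriv (Suc 0) g)" by (simp only: half_line_deriv_0)
  with inverts_recovered e obtain K where K: "inverts K (\<lambda>\<xi>. half_ft g (e * \<xi>)) (recovered e g)"
    by blast
  have "sym_integral (\<lambda>\<xi>. cis (\<xi> * x) * (M \<xi> t * half_ft g (e * \<xi>))) (N (recovered e g) t x)"
  proof (rule sym_integral_continuous)
    have "continuous_on UNIV (\<lambda>\<xi>. half_ft g (e * \<xi>))"
      using K by (simp add: inverts_def)
    then show "continuous_on UNIV (\<lambda>\<xi>. cis (\<xi> * x) * (M \<xi> t * half_ft g (e * \<xi>)))"
      by (intro continuous_intros continuous_on_propagator_compose[OF M])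
    show "((\<lambda>A. integral {-A..A} (\<lambda>\<xi>. cis (\<xi> * x) * (M \<xi> t * half_ft g (e * \<xi>)))) \<longlongrightarrow> N (recovered e g) t x) at_top"
      by (rule propagator_limit(1)[OF M K]) (use t in auto)
  qed
  then show ?thesis
  proof (rule sym_integral_cong)
    fix \<xi> :: real assume "\<xi> \<noteq> 0"
    have "cis (\<xi> * x - 1 * rho m \<xi> * t) = cis (\<xi> * x) * cis (- (rho m \<xi> * t))"
      "cis (\<xi> * x - (- 1) * rho m \<xi> * t) = cis (\<xi> * x) * cis (rho m \<xi> * t)"
      by (simp_all add: cis_mult)
    then show "cis (\<xi> * x) * (M \<xi> t * half_ft g (e * \<xi>)) = cis (\<xi> * x - 1 * rho m \<xi> * t) * a \<xi> * half_ft g (e * \<xi>)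
     - cis (\<xi> * x - (- 1) * rho m \<xi> * t) * a' \<xi> * half_ft g (e * \<xi>)"
      unfolding Meq[OF \<open>\<xi> \<noteq> 0\<close>] by (simp only: left_diff_distrib right_diff_distrib mult_ac)
  qed
qed

text \<open>The boundary value contributes through exp(i\<rho>\<tau>), which combines with the phase at t to the multiplier at the elapsed
time t - \<tau>.\<close>

lemma boundary_block:
  assumes h: "smooth_half_line h" and M: "propagator M N" and t: "0 < t" "t < x"
    and Meq: "\<And>\<xi> s. \<xi> \<noteq> 0 \<Longrightarrow> M \<xi> s = a \<xi> * cis (- (rho m \<xi> * s)) - a' \<xi> * cis (rho m \<xi> * s)"
  shows "sym_integral (\<lambda>\<xi>. cis (\<xi> * x - 1 * rho m \<xi> * t) * a \<xi> * integral {0..t} (\<lambda>\<tau>. h \<tau> * cis (1 * rho m \<xi> * \<tau>))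
     - cis (\<xi> * x - (- 1) * rho m \<xi> * t) * a' \<xi> * integral {0..t} (\<lambda>\<tau>. h \<tau> * cis ((- 1) * rho m \<xi> * \<tau>))) 0"
proof -
  have hd: "(h has_vector_derivative half_line_deriv (Suc 0) h \<tau>) (at \<tau> within {0..t})" if "\<tau> \<in> {0..t}" for \<tau>
    using half_line_deriv_has_derivative[OF h, of \<tau> 0] that
    by (auto simp: half_line_deriv_0 intro: has_vector_derivative_within_subset)
  have ch': "continuous_on {0..t} (half_line_deriv (Suc 0) h)" and ch: "continuous_on {0..t} h"
    using continuous_on_subset[OF continuous_on_half_line_deriv[OF h], of "{0..t}"] half_line_deriv_0[of h]
    by (auto simp: subset_iff) (metis Icc_subset_Ici_iff order_refl)
  have "sym_integral (\<lambda>\<xi>. cis (\<xi> * x) * integral {0..t} (\<lambda>\<tau>. h \<tau> * M \<xi> (t - \<tau>))) 0"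
  proof (rule sym_integral_continuous)
    show "continuous_on UNIV (\<lambda>\<xi>. cis (\<xi> * x) * integral {0..t} (\<lambda>\<tau>. h \<tau> * M \<xi> (t - \<tau>)))"
      by (intro continuous_intros continuous_on_integral_real, unfold case_prod_unfold)
         (intro continuous_intros continuous_on_propagator_compose[OF M] continuous_on_compose2[OF ch], auto)
    show "((\<lambda>A. integral {-A..A} (\<lambda>\<xi>. cis (\<xi> * x) * integral {0..t} (\<lambda>\<tau>. h \<tau> * M \<xi> (t - \<tau>)))) \<longlongrightarrow> 0) at_top"
      by (rule propagator_source[OF M _ t(2) hd ch']) (use t in auto)
  qed
  then show ?thesis
  proof (rule sym_integral_cong)
    fix \<xi> :: real assume "\<xi> \<noteq> 0"
    have c: "cis (\<xi> * x) * (h \<tau> * M \<xi> (t - \<tau>)) =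
       cis (\<xi> * x - 1 * rho m \<xi> * t) * a \<xi> * (h \<tau> * cis (1 * rho m \<xi> * \<tau>))
       - cis (\<xi> * x - (- 1) * rho m \<xi> * t) * a' \<xi> * (h \<tau> * cis ((- 1) * rho m \<xi> * \<tau>))" for \<tau>
    proof -
      have "cis (\<xi> * x - 1 * rho m \<xi> * t) * cis (1 * rho m \<xi> * \<tau>) = cis (\<xi> * x) * cis (- (rho m \<xi> * (t - \<tau>)))"
        "cis (\<xi> * x - (- 1) * rho m \<xi> * t) * cis ((- 1) * rho m \<xi> * \<tau>) = cis (\<xi> * x) * cis (rho m \<xi> * (t - \<tau>))"
        by (simp_all add: cis_mult algebra_simps)
      then show ?thesis
        unfolding Meq[OF \<open>\<xi> \<noteq> 0\<close>] by algebra
    qed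
    have i: "(\<lambda>\<tau>. cis (\<xi> * x - 1 * rho m \<xi> * t) * a \<xi> * (h \<tau> * cis (1 * rho m \<xi> * \<tau>))) integrable_on {0..t}"
      "(\<lambda>\<tau>. cis (\<xi> * x - (- 1) * rho m \<xi> * t) * a' \<xi> * (h \<tau> * cis ((- 1) * rho m \<xi> * \<tau>))) integrable_on {0..t}"
      by (intro integrable_continuous_interval continuous_intros ch)+
    have "cis (\<xi> * x) * integral {0..t} (\<lambda>\<tau>. h \<tau> * M \<xi> (t - \<tau>)) = integral {0..t} (\<lambda>\<tau>. cis (\<xi> * x) * (h \<tau> * M \<xi> (t - \<tau>)))"
      by simp
    also have "\<dots> = integral {0..t} (\<lambda>\<tau>. cis (\<xi> * x - 1 * rho m \<xi> * t) * a \<xi> * (h \<tau> * cis (1 * rho m \<xi> * \<tau>)))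
       - integral {0..t} (\<lambda>\<tau>. cis (\<xi> * x - (- 1) * rho m \<xi> * t) * a' \<xi> * (h \<tau> * cis ((- 1) * rho m \<xi> * \<tau>)))"
      unfolding c by (rule Henstock_Kurzweil_Integration.integral_diff[OF i])
    finally show "cis (\<xi> * x) * integral {0..t} (\<lambda>\<tau>. h \<tau> * M \<xi> (t - \<tau>)) =
       cis (\<xi> * x - 1 * rho m \<xi> * t) * a \<xi> * integral {0..t} (\<lambda>\<tau>. h \<tau> * cis (1 * rho m \<xi> * \<tau>))
     - cis (\<xi> * x - (- 1) * rho m \<xi> * t) * a' \<xi> * integral {0..t} (\<lambda>\<tau>. h \<tau> * cis ((- 1) * rho m \<xi> * \<tau>))"
      by simp
  qed
qed

lemma forcing_block:
  assumes F: "schwartz_family F" and M: "propagator M N" and e: "e \<in> {-1, 1}" and t: "0 < t" "t < x"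
    and Meq: "\<And>\<xi> s. \<xi> \<noteq> 0 \<Longrightarrow> M \<xi> s = a \<xi> * cis (- (rho m \<xi> * s)) - a' \<xi> * cis (rho m \<xi> * s)"
  shows "sym_integral (\<lambda>\<xi>. cis (\<xi> * x - 1 * rho m \<xi> * t) * a \<xi> * time_ft (F 0 0) (e * \<xi>) (\<i> * of_real (1 * rho m \<xi>)) t
     - cis (\<xi> * x - (- 1) * rho m \<xi> * t) * a' \<xi> * time_ft (F 0 0) (e * \<xi>) (\<i> * of_real ((- 1) * rho m \<xi>)) t)
     (integral {0..t} (\<lambda>\<tau>. N (recovered e (\<lambda>y. F 0 0 y \<tau>)) (t - \<tau>) x))"
proof -
  let ?h = "\<lambda>\<tau> \<xi>. half_ft (\<lambda>y. F 0 0 y \<tau>) (e * \<xi>)"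
  obtain C where C: "\<And>\<tau>. \<tau> \<in> {0..t} \<Longrightarrow> decay2_C1 C (\<lambda>y. F 0 0 y \<tau>) (\<lambda>y. F (Suc 0) 0 y \<tau>)"
    using schwartz_family_slices[OF F t(1)] by blast
  with inverts_recovered e obtain K where
    K: "\<And>\<tau>. \<tau> \<in> {0..t} \<Longrightarrow> inverts (K * C) (?h \<tau>) (recovered e (\<lambda>y. F 0 0 y \<tau>))"
    by blast
  have ch': "continuous_on (UNIV \<times> {0..t}) (\<lambda>p. ?h (snd p) (fst p))"
    by (intro schwartz_family_half_ft_compose[OF F, where T=t] continuous_intros) auto
  then have ch: "continuous_on (UNIV \<times> {0..t}) (\<lambda>(\<xi>, \<tau>). ?h \<tau> \<xi>)"
    by (simp add: case_prod_unfold)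
  have cL: "continuous_on ({0..t} \<times> {0<..}) (\<lambda>(\<tau>, y). recovered e (\<lambda>y. F 0 0 y \<tau>) y)"
    using schwartz_family_continuous_swap[OF F, of t 0 0] unfolding recovered_def case_prod_unfold
    by (cases "e = 1") (auto intro: continuous_intros)
  have chs: "continuous_on {0..t} (\<lambda>\<tau>. ?h \<tau> \<xi>)" for \<xi>
    by (intro schwartz_family_half_ft_compose[OF F, where T=t] continuous_intros) auto
  have "sym_integral (\<lambda>\<xi>. cis (\<xi> * x) * integral {0..t} (\<lambda>\<tau>. M \<xi> (t - \<tau>) * ?h \<tau> \<xi>))
     (integral {0..t} (\<lambda>\<tau>. N (recovered e (\<lambda>y. F 0 0 y \<tau>)) (t - \<tau>) x))"
  proof (rule sym_integral_continuous)
    show "continuous_on UNIV (\<lambda>\<xi>. cis (\<xi> * x) * integral {0..t} (\<lambda>\<tau>. M \<xi> (t - \<tau>) * ?h \<tau> \<xi>))"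
      by (intro continuous_intros continuous_on_integral_real, unfold case_prod_unfold)
         (intro continuous_intros continuous_on_propagator_compose[OF M] ch')
    show "((\<lambda>A. integral {-A..A} (\<lambda>\<xi>. cis (\<xi> * x) * integral {0..t} (\<lambda>\<tau>. M \<xi> (t - \<tau>) * ?h \<tau> \<xi>))) \<longlongrightarrow>
        integral {0..t} (\<lambda>\<tau>. N (recovered e (\<lambda>y. F 0 0 y \<tau>)) (t - \<tau>) x)) at_top"
      by (rule propagator_duhamel[OF M _ t(2) K ch cL]) (use t in auto)
  qed
  then show ?thesis
  proof (rule sym_integral_cong)
    fix \<xi> :: real assume "\<xi> \<noteq> 0"
    have c: "cis (\<xi> * x) * (M \<xi> (t - \<tau>) * ?h \<tau> \<xi>) =
       cis (\<xi> * x - 1 * rho m \<xi> * t) * a \<xi> * (cis (1 * rho m \<xi> * \<tau>) * ?h \<tau> \<xi>)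
       - cis (\<xi> * x - (- 1) * rho m \<xi> * t) * a' \<xi> * (cis ((- 1) * rho m \<xi> * \<tau>) * ?h \<tau> \<xi>)" for \<tau>
    proof -
      have "cis (\<xi> * x - 1 * rho m \<xi> * t) * cis (1 * rho m \<xi> * \<tau>) = cis (\<xi> * x) * cis (- (rho m \<xi> * (t - \<tau>)))"
        "cis (\<xi> * x - (- 1) * rho m \<xi> * t) * cis ((- 1) * rho m \<xi> * \<tau>) = cis (\<xi> * x) * cis (rho m \<xi> * (t - \<tau>))"
        by (simp_all add: cis_mult algebra_simps)
      then show ?thesis
        unfolding Meq[OF \<open>\<xi> \<noteq> 0\<close>] by algebra
    qed
    have i: "(\<lambda>\<tau>. cis (\<xi> * x - 1 * rho m \<xi> * t) * a \<xi> * (cis (1 * rho m \<xi> * \<tau>) * ?h \<tau> \<xi>)) integrable_on {0..t}"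
      "(\<lambda>\<tau>. cis (\<xi> * x - (- 1) * rho m \<xi> * t) * a' \<xi> * (cis ((- 1) * rho m \<xi> * \<tau>) * ?h \<tau> \<xi>)) integrable_on {0..t}"
      by (intro integrable_continuous_interval continuous_intros chs)+
    have "cis (\<xi> * x) * integral {0..t} (\<lambda>\<tau>. M \<xi> (t - \<tau>) * ?h \<tau> \<xi>) = integral {0..t} (\<lambda>\<tau>. cis (\<xi> * x) * (M \<xi> (t - \<tau>) * ?h \<tau> \<xi>))"
      by simp
    also have "\<dots> = integral {0..t} (\<lambda>\<tau>. cis (\<xi> * x - 1 * rho m \<xi> * t) * a \<xi> * (cis (1 * rho m \<xi> * \<tau>) * ?h \<tau> \<xi>))
       - integral {0..t} (\<lambda>\<tau>. cis (\<xi> * x - (- 1) * rho m \<xi> * t) * a' \<xi> * (cis ((- 1) * rho m \<xi> * \<tau>) * ?h \<tau> \<xi>))"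
      unfolding c by (rule Henstock_Kurzweil_Integration.integral_diff[OF i])
    finally show "cis (\<xi> * x) * integral {0..t} (\<lambda>\<tau>. M \<xi> (t - \<tau>) * ?h \<tau> \<xi>) =
       cis (\<xi> * x - 1 * rho m \<xi> * t) * a \<xi> * time_ft (F 0 0) (e * \<xi>) (\<i> * of_real (1 * rho m \<xi>)) t
     - cis (\<xi> * x - (- 1) * rho m \<xi> * t) * a' \<xi> * time_ft (F 0 0) (e * \<xi>) (\<i> * of_real ((- 1) * rho m \<xi>)) t"
      unfolding time_ft_integral[OF F] by simp
  qed
qed

lemma decays_zero: "decays K (\<lambda>x t. 0)"
proof (induction K)
  case 0
  then show ?case by (auto simp: rapid_def)
next
  case (Suc K)
  then show ?case
    by (auto simp: rapid_def intro!: exI[of _ "\<lambda>x t. 0"])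
qed

lemma recovered_decays:
  assumes g: "schwartz_half_line g" and M: "propagator M N"
  shows "decays K (\<lambda>x t. N (recovered e g) t x)"
proof (cases "e = 1")
  case True
  have "decays K (\<lambda>x t. of_real (2 * pi) * N g t x)"
    using decays_cmult[OF propagated_decays[OF M schwartz_family_half_line[OF g]]]
    by (simp add: half_line_deriv_0)
  then show ?thesis
    using True by (simp only: recovered_def if_True simp_thms propagator_cmult_right[OF M])
next
  case False
  then show ?thesis
    using decays_zero by (simp only: recovered_def if_False propagator_0[OF M])
qed

lemma recovered_duhamel_decays:
  assumes F: "schwartz_family F" and M: "propagator M N"
  shows "decays K (\<lambda>x t. integral {0..t} (\<lambda>\<tau>. N (recovered e (\<lambda>y. F 0 0 y \<tau>)) (t - \<tau>) x))"
proof (cases "e = 1")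
  case True
  have "decays K (\<lambda>x t. of_real (2 * pi) * integral {0..t} (\<lambda>\<tau>. N (\<lambda>y. F 0 0 y \<tau>) (t - \<tau>) x))"
    by (rule decays_cmult[OF duhamel_decays[OF M F]])
  then show ?thesis
    using True by (simp only: recovered_def if_True simp_thms propagator_cmult_right[OF M] integral_mult_right)
next
  case False
  then show ?thesis
    using decays_zero by (simp only: recovered_def if_False propagator_0[OF M] Henstock_Kurzweil_Integration.integral_0)
qed

text \<open>The common form of the sixteen data and forcing integrands: \<sigma> is the sign of the phase, \<kappa> the sign of \<rho> in the symbol,
s the sign of the second summand, and X, X' are transforms of the two components of the data. Passing from \<omega>_1 to
\<omega>_2 changes \<sigma> and \<kappa> together.\<close>

definition wave_integrand ::
  "real \<Rightarrow> real \<Rightarrow> real \<Rightarrow> real \<Rightarrow> real \<Rightarrow> real \<Rightarrow> (real \<Rightarrow> complex) \<Rightarrow> (real \<Rightarrow> complex) \<Rightarrow> real \<Rightarrow> complex" where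
  "wave_integrand m x t \<sigma> \<kappa> s X X' \<xi> = cis (\<xi> * x - \<sigma> * rho m \<xi> * t) *
     (of_real \<xi> * X \<xi> + of_real s * of_real (\<kappa> * rho m \<xi> + m) * X' \<xi>) / of_real (2 * rho m \<xi>)"

lemma wave_integrand_split:
  "wave_integrand m x t \<sigma> \<kappa> s X X' = (\<lambda>\<xi>.
     1 / 2 * (cis (\<xi> * x - \<sigma> * rho m \<xi> * t) * of_real (\<xi> / rho m \<xi>) * X \<xi>)
     + of_real s / 2 * (cis (\<xi> * x - \<sigma> * rho m \<xi> * t) * of_real ((\<kappa> * rho m \<xi> + m) / rho m \<xi>) * X' \<xi>))"
  by (simp add: fun_eq_iff wave_integrand_def distrib_left add_divide_distrib mult_ac)

lemma combine_diff: "p * (a - b) + q * (c - d) = (p * a + q * c) - (p * b + q * d)" for a b c d p q :: complex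
  by (simp add: algebra_simps)

text \<open>The difference of the two integrals has two values: the symmetric limit obtained from convergence of each
integral, and the average of the data obtained from inversion. They agree by uniqueness of limits.\<close>

lemma initial_pair_decays:
  assumes m: "m \<ge> 0" and g: "schwartz_half_line g" "schwartz_half_line g'" and \<kappa>: "\<kappa> \<in> {-1, 1}" and e: "e \<in> {-1, 1}"
  shows "decays K (\<lambda>x t. gen_integral (wave_integrand m x t 1 \<kappa> s (\<lambda>\<xi>. half_ft g (e * \<xi>)) (\<lambda>\<xi>. half_ft g' (e * \<xi>)))
     - gen_integral (wave_integrand m x t (-1) (- \<kappa>) s (\<lambda>\<xi>. half_ft g (e * \<xi>)) (\<lambda>\<xi>. half_ft g' (e * \<xi>))))"
proof -
  obtain M N where M: "propagator M N" and Meq: "\<And>\<xi> s. \<xi> \<noteq> 0 \<Longrightarrow>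
     M \<xi> s = of_real (\<xi> / rho m \<xi>) * cis (- (rho m \<xi> * s)) - of_real (\<xi> / rho m \<xi>) * cis (rho m \<xi> * s)"
    using propagator_momentum by blast
  obtain M' N' where M': "propagator M' N'" and Meq': "\<And>\<xi> s. \<xi> \<noteq> 0 \<Longrightarrow>
     M' \<xi> s = of_real ((\<kappa> * rho m \<xi> + m) / rho m \<xi>) * cis (- (rho m \<xi> * s))
       - of_real ((- \<kappa> * rho m \<xi> + m) / rho m \<xi>) * cis (rho m \<xi> * s)"
    using propagator_energy by blast
  have "decays K (\<lambda>x t. 1 / 2 * N (recovered e g) t x + of_real s / 2 * N' (recovered e g') t x)"
    by (intro decays_add decays_cmult recovered_decays[OF g(1) M] recovered_decays[OF g(2) M'])
  then show ?thesis
  proof (rule decays_cong)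
    fix x t :: real assume t: "0 < t" "t < x"
    have conv: "conv_integral (wave_integrand m x t \<sigma> \<kappa> s (\<lambda>\<xi>. half_ft g (e * \<xi>)) (\<lambda>\<xi>. half_ft g' (e * \<xi>)))"
      if "\<sigma> \<in> {-1, 1}" "\<kappa> \<in> {-1, 1}" for \<sigma> \<kappa>
    proof -
      obtain C1 C2 C3 C4 where C: "decay2_C1 C1 (half_line_deriv 0 g) (half_line_deriv (Suc 0) g)"
          "decay2_C1 C2 (half_line_deriv (Suc 0) g) (half_line_deriv (Suc (Suc 0)) g)"
          "decay2_C1 C3 (half_line_deriv 0 g') (half_line_deriv (Suc 0) g')"
          "decay2_C1 C4 (half_line_deriv (Suc 0) g') (half_line_deriv (Suc (Suc 0)) g')"
        using schwartz_half_line_decay2[OF g(1)] schwartz_half_line_decay2[OF g(2)] by meson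
      show ?thesis
        unfolding wave_integrand_split
        by (intro conv_integral_add conv_integral_cmult
            conv_integral_initial[OF coefficient_momentum C(1)[unfolded half_line_deriv_0] C(2) e that(1)]
            conv_integral_initial[OF coefficient_energy[OF m that(2)] C(3)[unfolded half_line_deriv_0] C(4) e that(1)])
           (use t in auto)
    qed
    have "sym_integral (\<lambda>\<xi>. wave_integrand m x t 1 \<kappa> s (\<lambda>\<xi>. half_ft g (e * \<xi>)) (\<lambda>\<xi>. half_ft g' (e * \<xi>)) \<xi>
        - wave_integrand m x t (-1) (- \<kappa>) s (\<lambda>\<xi>. half_ft g (e * \<xi>)) (\<lambda>\<xi>. half_ft g' (e * \<xi>)) \<xi>)
       (gen_integral (wave_integrand m x t 1 \<kappa> s (\<lambda>\<xi>. half_ft g (e * \<xi>)) (\<lambda>\<xi>. half_ft g' (e * \<xi>)))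
     - gen_integral (wave_integrand m x t (-1) (- \<kappa>) s (\<lambda>\<xi>. half_ft g (e * \<xi>)) (\<lambda>\<xi>. half_ft g' (e * \<xi>))))"
      using \<kappa> by (intro sym_integral_diff gen_integral_symmetric conv) auto
    moreover have "sym_integral (\<lambda>\<xi>. wave_integrand m x t 1 \<kappa> s (\<lambda>\<xi>. half_ft g (e * \<xi>)) (\<lambda>\<xi>. half_ft g' (e * \<xi>)) \<xi>
        - wave_integrand m x t (-1) (- \<kappa>) s (\<lambda>\<xi>. half_ft g (e * \<xi>)) (\<lambda>\<xi>. half_ft g' (e * \<xi>)) \<xi>)
       (1 / 2 * N (recovered e g) t x + of_real s / 2 * N' (recovered e g') t x)"
      by (rule sym_integral_cong[OF sym_integral_add[OF sym_integral_cmult[OF initial_block[OF g(1) M e t Meq], of "1 / 2"]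
            sym_integral_cmult[OF initial_block[OF g(2) M' e t Meq'], of "of_real s / 2"]]])
         (assumption, assumption, simp only: wave_integrand_split combine_diff)
    ultimately show "1 / 2 * N (recovered e g) t x + of_real s / 2 * N' (recovered e g') t x =
       gen_integral (wave_integrand m x t 1 \<kappa> s (\<lambda>\<xi>. half_ft g (e * \<xi>)) (\<lambda>\<xi>. half_ft g' (e * \<xi>)))
     - gen_integral (wave_integrand m x t (-1) (- \<kappa>) s (\<lambda>\<xi>. half_ft g (e * \<xi>)) (\<lambda>\<xi>. half_ft g' (e * \<xi>)))"
      by (rule sym_integral_unique[rotated])
  qed
qed

text \<open>The same comparison as for the initial data; here each integral converges absolutely.\<close>

lemma forcing_pair_decays:
  assumes m: "m \<ge> 0" and F: "schwartz_family F" "schwartz_family F'" and \<kappa>: "\<kappa> \<in> {-1, 1}" and e: "e \<in> {-1, 1}"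
  shows "decays K (\<lambda>x t.
     (LBINT \<xi>. wave_integrand m x t 1 \<kappa> s (\<lambda>\<xi>. time_ft (F 0 0) (e * \<xi>) (\<i> * of_real (1 * rho m \<xi>)) t)
         (\<lambda>\<xi>. time_ft (F' 0 0) (e * \<xi>) (\<i> * of_real (1 * rho m \<xi>)) t) \<xi>)
     - (LBINT \<xi>. wave_integrand m x t (-1) (- \<kappa>) s (\<lambda>\<xi>. time_ft (F 0 0) (e * \<xi>) (\<i> * of_real ((-1) * rho m \<xi>)) t)
         (\<lambda>\<xi>. time_ft (F' 0 0) (e * \<xi>) (\<i> * of_real ((-1) * rho m \<xi>)) t) \<xi>))"
proof -
  obtain M N where M: "propagator M N" and Meq: "\<And>\<xi> s. \<xi> \<noteq> 0 \<Longrightarrow>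
     M \<xi> s = of_real (\<xi> / rho m \<xi>) * cis (- (rho m \<xi> * s)) - of_real (\<xi> / rho m \<xi>) * cis (rho m \<xi> * s)"
    using propagator_momentum by blast
  obtain M' N' where M': "propagator M' N'" and Meq': "\<And>\<xi> s. \<xi> \<noteq> 0 \<Longrightarrow>
     M' \<xi> s = of_real ((\<kappa> * rho m \<xi> + m) / rho m \<xi>) * cis (- (rho m \<xi> * s))
       - of_real ((- \<kappa> * rho m \<xi> + m) / rho m \<xi>) * cis (rho m \<xi> * s)"
    using propagator_energy by blast
  let ?X = "\<lambda>\<sigma> F t \<xi>. time_ft (F 0 0) (e * \<xi>) (\<i> * of_real (\<sigma> * rho m \<xi>)) t"
  let ?V = "\<lambda>x t. 1 / 2 * integral {0..t} (\<lambda>\<tau>. N (recovered e (\<lambda>y. F 0 0 y \<tau>)) (t - \<tau>) x)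
     + of_real s / 2 * integral {0..t} (\<lambda>\<tau>. N' (recovered e (\<lambda>y. F' 0 0 y \<tau>)) (t - \<tau>) x)"
  have "decays K ?V"
    by (intro decays_add decays_cmult recovered_duhamel_decays[OF F(1) M] recovered_duhamel_decays[OF F(2) M'])
  then show ?thesis
  proof (rule decays_cong)
    fix x t :: real assume t: "0 < t" "t < x"
    have int: "integrable lborel (wave_integrand m x t \<sigma> \<kappa> s (?X \<sigma> F t) (?X \<sigma> F' t))"
      if "\<sigma> \<in> {-1, 1}" "\<kappa> \<in> {-1, 1}" for \<sigma> \<kappa>
      unfolding wave_integrand_split
      by (intro Bochner_Integration.integrable_add integrable_mult_right
          forcing_integrable[OF coefficient_momentum F(1) that(1) e t(1)]
          forcing_integrable[OF coefficient_energy[OF m that(2)] F(2) that(1) e t(1)])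
    have "sym_integral (\<lambda>\<xi>. wave_integrand m x t 1 \<kappa> s (?X 1 F t) (?X 1 F' t) \<xi>
        - wave_integrand m x t (-1) (- \<kappa>) s (?X (-1) F t) (?X (-1) F' t) \<xi>)
       ((LBINT \<xi>. wave_integrand m x t 1 \<kappa> s (?X 1 F t) (?X 1 F' t) \<xi>)
        - (LBINT \<xi>. wave_integrand m x t (-1) (- \<kappa>) s (?X (-1) F t) (?X (-1) F' t) \<xi>))"
      using \<kappa> by (intro sym_integral_diff sym_integral_integrable int) auto
    moreover have "sym_integral (\<lambda>\<xi>. wave_integrand m x t 1 \<kappa> s (?X 1 F t) (?X 1 F' t) \<xi>
        - wave_integrand m x t (-1) (- \<kappa>) s (?X (-1) F t) (?X (-1) F' t) \<xi>) (?V x t)"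
      by (rule sym_integral_cong[OF sym_integral_add[OF sym_integral_cmult[OF forcing_block[OF F(1) M e t Meq], of "1 / 2"]
            sym_integral_cmult[OF forcing_block[OF F(2) M' e t Meq'], of "of_real s / 2"]]])
         (assumption, assumption, simp only: wave_integrand_split combine_diff)
    ultimately show "?V x t = (LBINT \<xi>. wave_integrand m x t 1 \<kappa> s (?X 1 F t) (?X 1 F' t) \<xi>)
        - (LBINT \<xi>. wave_integrand m x t (-1) (- \<kappa>) s (?X (-1) F t) (?X (-1) F' t) \<xi>)"
      by (rule sym_integral_unique[rotated])
  qed
qed

lemma boundary_pair_zero:
  assumes h: "smooth_half_line h" and M: "propagator M N" and a: "coefficient a" "coefficient a'" and t: "0 < t" "t < x"
    and Meq: "\<And>\<xi> s. \<xi> \<noteq> 0 \<Longrightarrow> M \<xi> s = a \<xi> * cis (- (rho m \<xi> * s)) - a' \<xi> * cis (rho m \<xi> * s)"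
  shows "gen_integral (\<lambda>\<xi>. cis (\<xi> * x - 1 * rho m \<xi> * t) * a \<xi> * integral {0..t} (\<lambda>\<tau>. h \<tau> * cis (1 * rho m \<xi> * \<tau>)))
     = gen_integral (\<lambda>\<xi>. cis (\<xi> * x - (- 1) * rho m \<xi> * t) * a' \<xi> * integral {0..t} (\<lambda>\<tau>. h \<tau> * cis ((- 1) * rho m \<xi> * \<tau>)))"
proof -
  have hd: "(half_line_deriv n h has_vector_derivative half_line_deriv (Suc n) h \<tau>) (at \<tau> within {0..t})" if "\<tau> \<in> {0..t}" for \<tau> n
    using half_line_deriv_has_derivative[OF h, of \<tau> n] that
    by (auto intro: has_vector_derivative_within_subset)
  have ch: "continuous_on {0..t} (half_line_deriv n h)" for n
    by (rule continuous_on_subset[OF continuous_on_half_line_deriv[OF h]]) auto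
  have "conv_integral (\<lambda>\<xi>. cis (\<xi> * x - \<sigma> * rho m \<xi> * t) * a \<xi> * integral {0..t} (\<lambda>\<tau>. h \<tau> * cis (\<sigma> * rho m \<xi> * \<tau>)))"
    if "coefficient a" "\<sigma> \<in> {-1, 1}" for a \<sigma>
    by (rule conv_integral_boundary[OF that less_imp_le[OF t(1)] t(2) hd[of _ 0, unfolded half_line_deriv_0] hd ch])
  from sym_integral_diff[OF gen_integral_symmetric[OF this] gen_integral_symmetric[OF this], OF a(1) _ a(2), of 1 "-1"]
  show ?thesis
    using sym_integral_unique[OF boundary_block[OF h M t Meq]] by fastforce
qed

section \<open>The solution beyond the light cone\<close>

lemma phase_omega:
  "phase \<xi> (omega1 m \<xi>) x t = cis (\<xi> * x - 1 * rho m \<xi> * t)"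
  "phase \<xi> (omega2 m \<xi>) x t = cis (\<xi> * x - (- 1) * rho m \<xi> * t)"
  by (simp_all add: phase_def omega1_def omega2_def cis_conv_exp algebra_simps)

lemma i_omega: "\<i> * omega1 m \<xi> = of_real (- rho m \<xi>)" "\<i> * omega2 m \<xi> = of_real (rho m \<xi>)"
  by (simp_all add: omega1_def omega2_def)

lemma omega_sign: "omega1 m \<xi> = \<i> * of_real (1 * rho m \<xi>)" "omega2 m \<xi> = \<i> * of_real ((- 1) * rho m \<xi>)"
  by (simp_all add: omega1_def omega2_def)

lemma time_int_cis:
  assumes h: "smooth_half_line h"
  shows "time_int h (\<i> * of_real r) t = integral {0..t} (\<lambda>\<tau>. h \<tau> * cis (r * \<tau>))"
proof -
  have ch: "continuous_on {0..t} h"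
    using continuous_on_subset[OF continuous_on_half_line_deriv[OF h, of 0], of "{0..t}"]
    by (simp add: half_line_deriv_0 subset_iff)
  have "time_int h (\<i> * of_real r) t = (LBINT \<tau>:{0..t}. h \<tau> * cis (r * \<tau>))"
    by (simp add: time_int_def cis_conv_exp mult.assoc)
  also have "\<dots> = integral {0..t} (\<lambda>\<tau>. h \<tau> * cis (r * \<tau>))"
    by (intro set_borel_integral_eq_integral borel_integrable_atLeastAtMost' continuous_intros ch)
  finally show ?thesis .
qed

text \<open>Only differences of these integrals occur in \<Psi>, so beyond the light cone the boundary value has no influence.\<close>

lemma boundary_terms_cancel:
  assumes h: "smooth_half_line h" and m: "m \<ge> 0" and t: "0 < t" "t < x"
  shows "H11 m h x t = H12 m h x t" "H21 m h x t = H22 m h x t"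
proof -
  obtain M N where M: "propagator M N" and Meq: "\<And>\<xi> s. \<xi> \<noteq> 0 \<Longrightarrow>
     M \<xi> s = of_real (\<xi> / rho m \<xi>) * cis (- (rho m \<xi> * s)) - of_real (\<xi> / rho m \<xi>) * cis (rho m \<xi> * s)"
    using propagator_momentum by blast
  have "H11 m h x t = gen_integral (\<lambda>\<xi>. cis (\<xi> * x - 1 * rho m \<xi> * t) * of_real (\<xi> / rho m \<xi>) *
      integral {0..t} (\<lambda>\<tau>. h \<tau> * cis (1 * rho m \<xi> * \<tau>)))"
    unfolding H11_def phase_omega(1) unfolding omega_sign(1) time_int_cis[OF h] by (simp add: mult_ac)
  moreover have "H12 m h x t = gen_integral (\<lambda>\<xi>. cis (\<xi> * x - (- 1) * rho m \<xi> * t) * of_real (\<xi> / rho m \<xi>) *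
      integral {0..t} (\<lambda>\<tau>. h \<tau> * cis ((- 1) * rho m \<xi> * \<tau>)))"
    unfolding H12_def phase_omega(2) unfolding omega_sign(2) time_int_cis[OF h] by (simp add: mult_ac)
  ultimately show "H11 m h x t = H12 m h x t"
    using boundary_pair_zero[OF h M coefficient_momentum coefficient_momentum t Meq] by simp
  obtain M' N' where M': "propagator M' N'" and Meq': "\<And>\<xi> s. \<xi> \<noteq> 0 \<Longrightarrow>
     M' \<xi> s = of_real ((- 1 * rho m \<xi> + m) / rho m \<xi>) * cis (- (rho m \<xi> * s))
       - of_real ((- (- 1) * rho m \<xi> + m) / rho m \<xi>) * cis (rho m \<xi> * s)"
    using propagator_energy by blast
  have "H21 m h x t = gen_integral (\<lambda>\<xi>. cis (\<xi> * x - 1 * rho m \<xi> * t) * of_real ((- 1 * rho m \<xi> + m) / rho m \<xi>) *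
      integral {0..t} (\<lambda>\<tau>. h \<tau> * cis (1 * rho m \<xi> * \<tau>)))"
    unfolding H21_def phase_omega(1) i_omega unfolding omega_sign(1) time_int_cis[OF h] by (simp add: mult_ac)
  moreover have "H22 m h x t = gen_integral (\<lambda>\<xi>. cis (\<xi> * x - (- 1) * rho m \<xi> * t) * of_real ((- (- 1) * rho m \<xi> + m) / rho m \<xi>) *
      integral {0..t} (\<lambda>\<tau>. h \<tau> * cis ((- 1) * rho m \<xi> * \<tau>)))"
    unfolding H22_def phase_omega(2) i_omega unfolding omega_sign(2) time_int_cis[OF h] by (simp add: mult_ac)
  ultimately show "H21 m h x t = H22 m h x t"
    using boundary_pair_zero[OF h M' coefficient_energy[OF m] coefficient_energy[OF m] t Meq'] by simp
qed

lemma G_wave_integrand: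
  "G11 m g1 g2 x t = gen_integral (wave_integrand m x t 1 1 1 (\<lambda>\<xi>. half_ft g2 (1 * \<xi>)) (\<lambda>\<xi>. half_ft g1 (1 * \<xi>)))"
  "G12 m g1 g2 x t = gen_integral (wave_integrand m x t 1 1 (-1) (\<lambda>\<xi>. half_ft g2 (-1 * \<xi>)) (\<lambda>\<xi>. half_ft g1 (-1 * \<xi>)))"
  "G13 m g1 g2 x t = gen_integral (wave_integrand m x t (-1) (-1) 1 (\<lambda>\<xi>. half_ft g2 (1 * \<xi>)) (\<lambda>\<xi>. half_ft g1 (1 * \<xi>)))"
  "G14 m g1 g2 x t = gen_integral (wave_integrand m x t (-1) (-1) (-1) (\<lambda>\<xi>. half_ft g2 (-1 * \<xi>)) (\<lambda>\<xi>. half_ft g1 (-1 * \<xi>)))"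
  "G21 m g1 g2 x t = gen_integral (wave_integrand m x t 1 (-1) (-1) (\<lambda>\<xi>. half_ft g1 (1 * \<xi>)) (\<lambda>\<xi>. half_ft g2 (1 * \<xi>)))"
  "G22 m g1 g2 x t = gen_integral (wave_integrand m x t 1 (-1) 1 (\<lambda>\<xi>. half_ft g1 (-1 * \<xi>)) (\<lambda>\<xi>. half_ft g2 (-1 * \<xi>)))"
  "G23 m g1 g2 x t = gen_integral (wave_integrand m x t (-1) (- (-1)) (-1) (\<lambda>\<xi>. half_ft g1 (1 * \<xi>)) (\<lambda>\<xi>. half_ft g2 (1 * \<xi>)))"
  "G24 m g1 g2 x t = gen_integral (wave_integrand m x t (-1) (- (-1)) 1 (\<lambda>\<xi>. half_ft g1 (-1 * \<xi>)) (\<lambda>\<xi>. half_ft g2 (-1 * \<xi>)))"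
  unfolding G11_def G12_def G13_def G14_def G21_def G22_def G23_def G24_def phase_omega i_omega wave_integrand_def[abs_def]
  by (simp_all add: algebra_simps)

lemma F_wave_integrand:
  "F11 m f1 f2 x t = (LBINT \<xi>. wave_integrand m x t 1 1 1 (\<lambda>\<xi>. time_ft f2 (1 * \<xi>) (\<i> * of_real (1 * rho m \<xi>)) t) (\<lambda>\<xi>. time_ft f1 (1 * \<xi>) (\<i> * of_real (1 * rho m \<xi>)) t) \<xi>)
    + (LBINT \<xi>. wave_integrand m x t 1 1 (-1) (\<lambda>\<xi>. time_ft f2 (-1 * \<xi>) (\<i> * of_real (1 * rho m \<xi>)) t) (\<lambda>\<xi>. time_ft f1 (-1 * \<xi>) (\<i> * of_real (1 * rho m \<xi>)) t) \<xi>)"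
  "F12 m f1 f2 x t = - (LBINT \<xi>. wave_integrand m x t (-1) (-1) 1 (\<lambda>\<xi>. time_ft f2 (1 * \<xi>) (\<i> * of_real ((-1) * rho m \<xi>)) t) (\<lambda>\<xi>. time_ft f1 (1 * \<xi>) (\<i> * of_real ((-1) * rho m \<xi>)) t) \<xi>)
    - (LBINT \<xi>. wave_integrand m x t (-1) (-1) (-1) (\<lambda>\<xi>. time_ft f2 (-1 * \<xi>) (\<i> * of_real ((-1) * rho m \<xi>)) t) (\<lambda>\<xi>. time_ft f1 (-1 * \<xi>) (\<i> * of_real ((-1) * rho m \<xi>)) t) \<xi>)"
  "F21 m f1 f2 x t = (LBINT \<xi>. wave_integrand m x t 1 (-1) (-1) (\<lambda>\<xi>. time_ft f1 (1 * \<xi>) (\<i> * of_real (1 * rho m \<xi>)) t) (\<lambda>\<xi>. time_ft f2 (1 * \<xi>) (\<i> * of_real (1 * rho m \<xi>)) t) \<xi>)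
    - (LBINT \<xi>. wave_integrand m x t 1 (-1) 1 (\<lambda>\<xi>. time_ft f1 (-1 * \<xi>) (\<i> * of_real (1 * rho m \<xi>)) t) (\<lambda>\<xi>. time_ft f2 (-1 * \<xi>) (\<i> * of_real (1 * rho m \<xi>)) t) \<xi>)"
  "F22 m f1 f2 x t = - (LBINT \<xi>. wave_integrand m x t (-1) (- (-1)) (-1) (\<lambda>\<xi>. time_ft f1 (1 * \<xi>) (\<i> * of_real ((-1) * rho m \<xi>)) t) (\<lambda>\<xi>. time_ft f2 (1 * \<xi>) (\<i> * of_real ((-1) * rho m \<xi>)) t) \<xi>)
    + (LBINT \<xi>. wave_integrand m x t (-1) (- (-1)) 1 (\<lambda>\<xi>. time_ft f1 (-1 * \<xi>) (\<i> * of_real ((-1) * rho m \<xi>)) t) (\<lambda>\<xi>. time_ft f2 (-1 * \<xi>) (\<i> * of_real ((-1) * rho m \<xi>)) t) \<xi>)"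
  unfolding F11_def F12_def F21_def F22_def phase_omega i_omega wave_integrand_def unfolding omega_sign
  by (simp_all add: algebra_simps)

text \<open>Regrouping the sixteen integrals so that each group pairs the two phases.\<close>

lemma Psi_decays:
  assumes m: "m \<ge> 0" and g: "schwartz_half_line g1" "schwartz_half_line g2" and h: "smooth_half_line h1"
    and F: "schwartz_family (\<lambda>n l. mixed_partial closed_quadrant n l f1)" "schwartz_family (\<lambda>n l. mixed_partial closed_quadrant n l f2)"
  shows "decays K (Psi1 m g1 g2 h1 f1 f2)" "decays K (Psi2 m g1 g2 h1 f1 f2)"
proof -
  have f0: "mixed_partial closed_quadrant 0 0 f = f" for f
    by (simp add: mixed_partial_def)
  have s: "(1::real) \<in> {-1, 1}" "(-1::real) \<in> {-1, 1}" by auto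
  note forcing = forcing_pair_decays[OF m F(1) F(2), unfolded f0] forcing_pair_decays[OF m F(2) F(1), unfolded f0]
  let ?c = "1 / of_real (2 * pi) :: complex"
  have "decays K (\<lambda>x t. ?c * (((G11 m g1 g2 x t - G13 m g1 g2 x t) + (G12 m g1 g2 x t - G14 m g1 g2 x t)) + (F11 m f1 f2 x t + F12 m f1 f2 x t)))"
  proof (intro decays_cmult decays_add[of K "\<lambda>x t. (G11 m g1 g2 x t - G13 m g1 g2 x t) + (G12 m g1 g2 x t - G14 m g1 g2 x t)"])
    show "decays K (\<lambda>x t. (G11 m g1 g2 x t - G13 m g1 g2 x t) + (G12 m g1 g2 x t - G14 m g1 g2 x t))"
      unfolding G_wave_integrand
      by (intro decays_add initial_pair_decays[OF m g(2,1) s(1) s(1)] initial_pair_decays[OF m g(2,1) s(1) s(2)])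
    from decays_add[OF forcing(2)[OF s(1) s(1), of K 1] forcing(2)[OF s(1) s(2), of K "-1"]]
    show "decays K (\<lambda>x t. F11 m f1 f2 x t + F12 m f1 f2 x t)"
      unfolding F_wave_integrand by (rule decays_cong) algebra
  qed
  then show "decays K (Psi1 m g1 g2 h1 f1 f2)"
  proof (rule decays_cong)
    fix x t :: real assume t: "0 < t" "t < x"
    show "?c * (((G11 m g1 g2 x t - G13 m g1 g2 x t) + (G12 m g1 g2 x t - G14 m g1 g2 x t)) + (F11 m f1 f2 x t + F12 m f1 f2 x t)) = Psi1 m g1 g2 h1 f1 f2 x t"
      unfolding Psi1_def boundary_terms_cancel(1)[OF h m t] divide_inverse by algebra
  qed
  have "decays K (\<lambda>x t. ?c * (((G21 m g1 g2 x t - G23 m g1 g2 x t) + -1 * (G22 m g1 g2 x t - G24 m g1 g2 x t)) + (F21 m f1 f2 x t + F22 m f1 f2 x t)))"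
  proof (intro decays_cmult decays_add[of K "\<lambda>x t. (G21 m g1 g2 x t - G23 m g1 g2 x t) + -1 * (G22 m g1 g2 x t - G24 m g1 g2 x t)"])
    show "decays K (\<lambda>x t. (G21 m g1 g2 x t - G23 m g1 g2 x t) + -1 * (G22 m g1 g2 x t - G24 m g1 g2 x t))"
      unfolding G_wave_integrand
      by (intro decays_add decays_cmult initial_pair_decays[OF m g(1,2) s(2) s(1)] initial_pair_decays[OF m g(1,2) s(2) s(2)])
    from decays_add[OF forcing(1)[OF s(2) s(1), of K "-1"] decays_cmult[OF forcing(1)[OF s(2) s(2), of K 1], of "-1"]]
    show "decays K (\<lambda>x t. F21 m f1 f2 x t + F22 m f1 f2 x t)"
      unfolding F_wave_integrand by (rule decays_cong) algebra
  qed
  then show "decays K (Psi2 m g1 g2 h1 f1 f2)"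
  proof (rule decays_cong)
    fix x t :: real assume t: "0 < t" "t < x"
    show "?c * (((G21 m g1 g2 x t - G23 m g1 g2 x t) + -1 * (G22 m g1 g2 x t - G24 m g1 g2 x t)) + (F21 m f1 f2 x t + F22 m f1 f2 x t)) = Psi2 m g1 g2 h1 f1 f2 x t"
      unfolding Psi2_def boundary_terms_cancel(2)[OF h m t] divide_inverse by algebra
  qed
qed

theorem theorem6:
  fixes m :: real
    and g1 g2 h1 :: "real \<Rightarrow> complex"
    and f1 f2 :: "real \<Rightarrow> real \<Rightarrow> complex"
  assumes "m \<ge> 0"
    and "schwartz_half_line g1" and "schwartz_half_line g2"
    and "smooth_half_line h1"
    and "smooth_on closed_quadrant f1" and "smooth_on closed_quadrant f2"
    and "\<And>T n l E. T > 0 \<Longrightarrow>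
           bdd_above ((\<lambda>(x, t). x ^ E * norm (mixed_partial closed_quadrant n l f1 x t))
             ` ({0<..} \<times> {0..T}))"
    and "\<And>T n l E. T > 0 \<Longrightarrow>
           bdd_above ((\<lambda>(x, t). x ^ E * norm (mixed_partial closed_quadrant n l f2 x t))
             ` ({0<..} \<times> {0..T}))"
  shows "\<forall>u\<in>{Psi1 m g1 g2 h1 f1 f2, Psi2 m g1 g2 h1 f1 f2}. \<forall>T>0. \<forall>n l E.
           (\<forall>\<^sub>F x in at_top. \<forall>t\<in>{0<..T}.
              partially_differentiable Psi_domain (mixed_partial Psi_domain n l u) x t) \<and>
           uniform_limit {0<..T}
             (\<lambda>x t. of_real (x ^ E) * mixed_partial Psi_domain n l u x t) (\<lambda>t. 0) at_top"
proof -
  have F: "schwartz_family (\<lambda>n l. mixed_partial closed_quadrant n l f1)"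
    "schwartz_family (\<lambda>n l. mixed_partial closed_quadrant n l f2)"
    by (rule schwartz_family_mixed_partial[OF assms(5) assms(7)], assumption)
       (rule schwartz_family_mixed_partial[OF assms(6) assms(8)])
  show ?thesis
    using decays_imp_limit[OF Psi_decays(1)[OF assms(1-4) F]] decays_imp_limit[OF Psi_decays(2)[OF assms(1-4) F]]
    by blast
qed

end
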